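(* Let $\phi:(\mathbb X,\sigma_0)\to(\mathbb Y,\tau_0)$ be a covering of developable complexes of groups over a morphism of scwols $f:X\to Y$, and set $G:=\pi_1(\mathbb Y,\tau_0)$, $U:=\phi_\ast(\pi_1(\mathbb X,\sigma_0))\le G$. Let $K:=\ker(\pi_1(\mathbb Y,\tau_0)\curvearrowright\tilde Y_{\tau_0})$ be the subgroup of elements acting trivially on $\tilde Y_{\tau_0}$, and let $C:=C_G(U)\cap K$. Then the map $\varepsilon:N_G(U)\to\mathrm{Deck}(\phi)$ defined in the context is a surjective homomorphism of groups with $\ker(\varepsilon)=C\cdot U$. In particular, $$\mathrm{Deck}(\phi)\cong N_G(U)/(C\cdot U).$$
   Context: Scwols. A scwol $X$ consists of sets $VX$ (vertices), $EX$ (edges), maps $i,t:EX\to VX$ and a composition $E^2X:=\{(a,b)\in EX\times EX: i(a)=t(b)\}\to EX$, $(a,b)\mapsto ab$, with $i(ab)=i(b)$, $t(ab)=t(a)$; $(ab)c=a(bc)$ whenever $i(a)=t(b)$, $i(b)=t(c)$; and $i(a)\neq t(a)$ for all $a\in EX$. $E^3X$ is the set of triples of edges $(a,b,c)$ with $i(a)=t(b)$, $i(b)=t(c)$. A morphism of scwols $f:X\to Y$ maps vertices to vertices and edges to edges, commutes with $i,t$, satisfies $f(ab)=f(a)f(b)$ for $(a,b)\in E^2X$, and for each $\sigma\in VX$ restricts to a bijection $\{a\in EX:i(a)=\sigma\}\to\{a'\in EY:i(a')=f(\sigma)\}$; it is an isomorphism if it is bijective on vertices and edges. Complexes of groups.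 A complex of groups $\mathbb X$ over $X$ is a tuple $((G_\sigma)_{\sigma\in VX},(\psi_a)_{a\in EX},(g_{a,b})_{(a,b)\in E^2X})$ with groups $G_\sigma$, injective homomorphisms $\psi_a:G_{i(a)}\to G_{t(a)}$ and elements $g_{a,b}\in G_{t(a)}$ such that $c_{g_{a,b}}\circ\psi_{ab}=\psi_a\circ\psi_b$ on $E^2X$ and $\psi_a(g_{b,c})g_{a,bc}=g_{a,b}g_{ab,c}$ on $E^3X$, where $c_h(g)=hgh^{-1}$. The same letters are used for all complexes of groups. Underlying scwols are always assumed connected (any two vertices are joined by a finite path as defined below). Morphisms. A morphism $\phi:\mathbb X\to\mathbb Y$ over $f:X\to Y$ consists of $f$, homomorphisms $\phi_\sigma:G_\sigma\to G_{f(\sigma)}$ ($\sigma\in VX$) and elements $\phi(a)\in G_{f(t(a))}$ ($a\in EX$) with $c_{\phi(a)}\circ\psi_{f(a)}\circ\phi_{i(a)}=\phi_{t(a)}\circ\psi_a$ for $a\in EX$ and $\phi_{t(a)}(g_{a,b})\phi(ab)=\phi(a)\psi_{f(a)}(\phi(b))g_{f(a),f(b)}$ for $(a,b)\in E^2X$. Writing $\phi:(\mathbb X,\sigma_0)\to(\mathbb Y,\tau_0)$ means $\sigma_0\in VX$ and $f(\sigma_0)=\tau_0$. The composition of $\phi:\mathbb U\to\mathbb X$ over $f$ and $\eta:\mathbb X\to\mathbb Y$ over $g$ is the morphism $\eta\circ\phi$ over $g\circ f$ with $(\eta\circ\phi)_\sigma=\eta_{f(\sigma)}\circ\phi_\sigma$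 and $(\eta\circ\phi)(a)=\eta_{f(t(a))}(\phi(a))\,\eta(f(a))$. $\phi$ is an isomorphism if $f$ and all $\phi_\sigma$ are isomorphisms; $\mathrm{Aut}(\mathbb X)$ is the set of isomorphisms $\mathbb X\to\mathbb X$. Coverings. A morphism $\phi:\mathbb X\to\mathbb Y$ over a surjective $f:X\to Y$ is a covering if for all $\sigma\in VX$: $\phi_\sigma$ is injective, and for all $a'\in EY$ with $t(a')=f(\sigma)$ the map $\coprod_{a\in f^{-1}(a'),\,t(a)=\sigma}G_\sigma/\psi_a(G_{i(a)})\to G_{f(\sigma)}/\psi_{a'}(G_{i(a')})$, $g\,\psi_a(G_{i(a)})\mapsto\phi_\sigma(g)\phi(a)\,\psi_{a'}(G_{i(a')})$, is a bijection. Paths. Oriented edges are the $a\in EX$ and formal inverses $a^{-1}$, with $i(a^{-1})=t(a)$, $t(a^{-1})=i(a)$, $(a^{-1})^{-1}=a$. A path in $X$ is a finite sequence of oriented edges $(e_1,\dots,e_k)$ with $t(e_j)=i(e_{j+1})$. An $\mathbb X$-path is a tuple $p=(g_0,e_1,g_1,\dots,e_k,g_k)$ with $(e_1,\dots,e_k)$ a path, $g_0\in G_{i(e_1)}$, $g_j\in G_{t(e_j)}$; $i(p)=i(e_1)$, $t(p)=t(e_k)$ (for length $0$: $p=(g)$ with $g\in G_\sigma$, at a vertex $\sigma$). Concatenation $p\star q$ (when $t(p)=i(q)$) multiplies the last group element of $p$ with the first of $q$; $p^{-1}=(g_k^{-1},e_k^{-1},\dots,e_1^{-1},g_0^{-1})$.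 $\mathcal P_{\sigma}(\mathbb X)$ denotes the set of $\mathbb X$-paths starting at $\sigma$. Homotopy $\sim$ of $\mathbb X$-paths is the equivalence relation generated by the following replacements of subpaths: $(kg,a,h)\to(k,a,\psi_a(g)h)$; $(g,a^{-1},hk)\to(g\psi_a(h),a^{-1},k)$; $(g,a,\psi_a(h),a^{-1},k)\to(ghk)$; $(g,b^{-1},h,b,k)\to(g\psi_b(h)k)$; $(g,b,1,a,k)\to(g,ab,g_{a,b}^{-1}k)$ and $(g,a^{-1},1,b^{-1},k)\to(gg_{a,b},(ab)^{-1},k)$ for $(a,b)\in E^2X$. $[p]$ is the homotopy class. $\pi_1(\mathbb X,\sigma_0)$ is the group of homotopy classes of $\mathbb X$-paths from $\sigma_0$ to $\sigma_0$ with $[p][q]=[p\star q]$. $\mathbb X$ is developable if it arises (up to isomorphism) from an action of a group on a scwol; equivalently (and this may be taken as the definition), for every $\sigma\in VX$ the homomorphism $G_\sigma\to\pi_1(\mathbb X,\sigma)$, $g\mapsto[(g)]$, is injective. Universal complex. For $p,q\in\mathcal P_{\sigma_0}(\mathbb X)$ put $p\equiv q$ iff $[q]=[p\star(g)]$ for some $g\in G_{t(p)}$; $[\![p]\!]$ is the $\equiv$-class. The scwol $\tilde X_{\sigma_0}$ has vertices $[\![p]\!]$, $p\in\mathcal P_{\sigma_0}(\mathbb X)$, edges the triples $([\![p]\!],a,[\![p\star(1,a,1)]\!])$ with $a\in EX$, $i(a)=t(p)$; $i,t$ are the first and third projections, and the composite of $([\![p\star(1,b,1)]\!],a,\cdot)$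 with $([\![p]\!],b,\cdot)$ is $([\![p]\!],ab,[\![p\star(1,ab,1)]\!])$. $\pi_1(\mathbb X,\sigma_0)$ acts on it by $[q]\cdot[\![p]\!]=[\![q\star p]\!]$ and $[q]\cdot([\![p]\!],a,\cdot)=([\![q\star p]\!],a,\cdot)$. Induced homomorphism. $\mathfrak p_\phi$ is the map from $\mathbb X$-paths to $\mathbb Y$-paths compatible with $\star$ and given by $(g)\mapsto(\phi_\sigma(g))$ for $g\in G_\sigma$, $(1,a,1)\mapsto(1,f(a),\phi(a)^{-1})$, $(1,a^{-1},1)\mapsto(\phi(a),f(a)^{-1},1)$; $\phi_\ast=\phi_{\ast,\sigma_0}:\pi_1(\mathbb X,\sigma_0)\to\pi_1(\mathbb Y,f(\sigma_0))$ is $[p]\mapsto[\mathfrak p_\phi(p)]$. Homotopy of morphisms. For morphisms $\phi,\eta:\mathbb X\to\mathbb Y$ over the same $f$, a family $k_\sigma\in G_{f(\sigma)}$ ($\sigma\in VX$) defines a homotopy from $\phi$ to $\eta$ if $\eta_\sigma=c_{k_\sigma}\circ\phi_\sigma$ and $\eta(a)=k_{t(a)}\phi(a)\psi_{f(a)}(k_{i(a)}^{-1})$ for all $\sigma\in VX$, $a\in EX$. If such a family exists, $\phi\sim\eta$; if it can be chosen with $k_{\sigma_0}=1$, $\phi\sim_{\sigma_0}\eta$ (homotopic relative $\sigma_0$). $[\phi]$ is the homotopy class for $\sim$. For $g\in G_{f(\sigma_0)}$, $\phi^{(k_{\sigma_0}=g)}$ is the morphism such that the family with $k_{\sigma_0}=g$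 and $k_\sigma=1$ for $\sigma\ne\sigma_0$ defines a homotopy from $\phi$ to $\phi^{(k_{\sigma_0}=g)}$. Deck transformations. $\mathrm{Deck}(\phi)=\{[\eta]:\eta\in\mathrm{Aut}(\mathbb X),\ \phi\sim\phi\circ\eta\}$, a group under $[\eta^1][\eta^2]=[\eta^1\circ\eta^2]$. The map $\varepsilon$. Every $h\in N_G(U)$ can be written $h=[\mathfrak p_\phi(p)\star(g)]$ with $p\in\mathcal P_{\sigma_0}(\mathbb X)$, $t(p)\in f^{-1}(\tau_0)$, $g\in G_{\tau_0}$; for such $p,g$ there is an automorphism $\eta_p^g\in\mathrm{Aut}(\mathbb X)$ over an automorphism $l_p^g$ of $X$ with $l_p^g(\sigma_0)=t(p)$ and $\phi\circ\eta_p^g\sim_{\sigma_0}\phi^{(k_{\sigma_0}=g)}$. The class $[\eta_p^g]\in\mathrm{Deck}(\phi)$ depends only on $h$, and $\varepsilon(h):=[\eta_p^g]$. *)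

theory Defs
  imports "HOL-Algebra.Left_Coset" "HOL-Algebra.Group_Action"
begin

section \<open>Scwols\<close>

record ('v, 'e) pre_scwol =
  verts :: "'v set"
  edges :: "'e set"
  ini :: "'e \<Rightarrow> 'v"
  ter :: "'e \<Rightarrow> 'v"
  cmp :: "'e \<Rightarrow> 'e \<Rightarrow> 'e"

locale scwol =
  fixes X :: "('v, 'e) pre_scwol"
  assumes ini_closed: "a \<in> edges X \<Longrightarrow> ini X a \<in> verts X"
    and ter_closed: "a \<in> edges X \<Longrightarrow> ter X a \<in> verts X"
    and cmp_closed: "\<lbrakk>a \<in> edges X; b \<in> edges X; ini X a = ter X b\<rbrakk> \<Longrightarrow> cmp X a b \<in> edges X"
    and ini_cmp: "\<lbrakk>a \<in> edges X; b \<in> edges X; ini X a = ter X b\<rbrakk> \<Longrightarrow> ini X (cmp X a b) = ini X b"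
    and ter_cmp: "\<lbrakk>a \<in> edges X; b \<in> edges X; ini X a = ter X b\<rbrakk> \<Longrightarrow> ter X (cmp X a b) = ter X a"
    and cmp_assoc: "\<lbrakk>a \<in> edges X; b \<in> edges X; c \<in> edges X; ini X a = ter X b; ini X b = ter X c\<rbrakk>
        \<Longrightarrow> cmp X (cmp X a b) c = cmp X a (cmp X b c)"
    and no_loops: "a \<in> edges X \<Longrightarrow> ini X a \<noteq> ter X a"

datatype 'e oedge = Fwd 'e | Bwd 'e

fun oedge_base :: "'e oedge \<Rightarrow> 'e" where
  "oedge_base (Fwd a) = a"
| "oedge_base (Bwd a) = a"

fun oini :: "('v, 'e) pre_scwol \<Rightarrow> 'e oedge \<Rightarrow> 'v" where
  "oini X (Fwd a) = ini X a"
| "oini X (Bwd a) = ter X a"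

fun oter :: "('v, 'e) pre_scwol \<Rightarrow> 'e oedge \<Rightarrow> 'v" where
  "oter X (Fwd a) = ter X a"
| "oter X (Bwd a) = ini X a"

fun edge_path :: "('v, 'e) pre_scwol \<Rightarrow> 'v \<Rightarrow> 'e oedge list \<Rightarrow> 'v \<Rightarrow> bool" where
  "edge_path X \<sigma> [] \<tau> \<longleftrightarrow> \<sigma> \<in> verts X \<and> \<sigma> = \<tau>"
| "edge_path X \<sigma> (e # es) \<tau> \<longleftrightarrow>
     oedge_base e \<in> edges X \<and> oini X e = \<sigma> \<and> edge_path X (oter X e) es \<tau>"

definition scwol_connected :: "('v, 'e) pre_scwol \<Rightarrow> bool" where
  "scwol_connected X \<longleftrightarrow> (\<forall>\<sigma>\<in>verts X. \<forall>\<tau>\<in>verts X. \<exists>es. edge_path X \<sigma> es \<tau>)"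

definition scwol_morphism ::
  "('v, 'e) pre_scwol \<Rightarrow> ('w, 'd) pre_scwol \<Rightarrow> ('v \<Rightarrow> 'w) \<Rightarrow> ('e \<Rightarrow> 'd) \<Rightarrow> bool" where
  "scwol_morphism X Y fV fE \<longleftrightarrow>
     (\<forall>\<sigma>\<in>verts X. fV \<sigma> \<in> verts Y) \<and>
     (\<forall>a\<in>edges X. fE a \<in> edges Y \<and> ini Y (fE a) = fV (ini X a) \<and> ter Y (fE a) = fV (ter X a)) \<and>
     (\<forall>a\<in>edges X. \<forall>b\<in>edges X. ini X a = ter X b \<longrightarrow> fE (cmp X a b) = cmp Y (fE a) (fE b)) \<and>
     (\<forall>\<sigma>\<in>verts X. bij_betw fE {a \<in> edges X. ini X a = \<sigma>} {a' \<in> edges Y. ini Y a' = fV \<sigma>})"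

definition scwol_iso ::
  "('v, 'e) pre_scwol \<Rightarrow> ('w, 'd) pre_scwol \<Rightarrow> ('v \<Rightarrow> 'w) \<Rightarrow> ('e \<Rightarrow> 'd) \<Rightarrow> bool" where
  "scwol_iso X Y fV fE \<longleftrightarrow> scwol_morphism X Y fV fE \<and>
     bij_betw fV (verts X) (verts Y) \<and> bij_betw fE (edges X) (edges Y)"


section \<open>Complexes of groups\<close>

text \<open>All local groups of a complex have their carriers in one common type \<open>'g\<close>. This is no
  restriction: any family of groups can be realised inside a disjoint union.\<close>

record ('v, 'e, 'g) cog =
  shape :: "('v, 'e) pre_scwol"
  grp :: "'v \<Rightarrow> 'g monoid"
  psi :: "'e \<Rightarrow> 'g \<Rightarrow> 'g"
  twist :: "'e \<Rightarrow> 'e \<Rightarrow> 'g"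

definition conj_by :: "('g, 'm) monoid_scheme \<Rightarrow> 'g \<Rightarrow> 'g \<Rightarrow> 'g" where
  "conj_by G h g = h \<otimes>\<^bsub>G\<^esub> g \<otimes>\<^bsub>G\<^esub> inv\<^bsub>G\<^esub> h"

locale complex_of_groups = scwol "shape X" for X :: "('v, 'e, 'g) cog" +
  assumes local_group: "\<sigma> \<in> verts (shape X) \<Longrightarrow> group (grp X \<sigma>)"
    and psi_mon: "a \<in> edges (shape X) \<Longrightarrow>
        psi X a \<in> mon (grp X (ini (shape X) a)) (grp X (ter (shape X) a))"
    and twist_closed: "\<lbrakk>a \<in> edges (shape X); b \<in> edges (shape X); ini (shape X) a = ter (shape X) b\<rbrakk>
        \<Longrightarrow> twist X a b \<in> carrier (grp X (ter (shape X) a))"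
    and twist_psi: "\<lbrakk>a \<in> edges (shape X); b \<in> edges (shape X); ini (shape X) a = ter (shape X) b;
          g \<in> carrier (grp X (ini (shape X) b))\<rbrakk>
        \<Longrightarrow> conj_by (grp X (ter (shape X) a)) (twist X a b) (psi X (cmp (shape X) a b) g)
              = psi X a (psi X b g)"
    and twist_cocycle: "\<lbrakk>a \<in> edges (shape X); b \<in> edges (shape X); c \<in> edges (shape X);
          ini (shape X) a = ter (shape X) b; ini (shape X) b = ter (shape X) c\<rbrakk>
        \<Longrightarrow> psi X a (twist X b c) \<otimes>\<^bsub>grp X (ter (shape X) a)\<^esub> twist X a (cmp (shape X) b c)
              = twist X a b \<otimes>\<^bsub>grp X (ter (shape X) a)\<^esub> twist X (cmp (shape X) a b) c"


section \<open>Morphisms and coverings\<close>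

text \<open>A morphism \<open>\<phi>\<close> over \<open>f\<close>: \<open>mV\<close> and \<open>mE\<close> are the action of \<open>f\<close> on vertices and edges, \<open>mG\<close> is
  the family of local homomorphisms and \<open>mA\<close> the family of elements \<open>\<phi>(a)\<close>. Values at vertices,
  edges and group elements outside the domain are irrelevant.\<close>

record ('v, 'e, 'g, 'w, 'd, 'h) cog_map =
  mV :: "'v \<Rightarrow> 'w"
  mE :: "'e \<Rightarrow> 'd"
  mG :: "'v \<Rightarrow> 'g \<Rightarrow> 'h"
  mA :: "'e \<Rightarrow> 'h"

definition cog_morphism ::
  "('v, 'e, 'g) cog \<Rightarrow> ('w, 'd, 'h) cog \<Rightarrow> ('v, 'e, 'g, 'w, 'd, 'h) cog_map \<Rightarrow> bool" where
  "cog_morphism X Y \<phi> \<longleftrightarrow>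
     scwol_morphism (shape X) (shape Y) (mV \<phi>) (mE \<phi>) \<and>
     (\<forall>\<sigma>\<in>verts (shape X). mG \<phi> \<sigma> \<in> hom (grp X \<sigma>) (grp Y (mV \<phi> \<sigma>))) \<and>
     (\<forall>a\<in>edges (shape X). mA \<phi> a \<in> carrier (grp Y (mV \<phi> (ter (shape X) a)))) \<and>
     (\<forall>a\<in>edges (shape X). \<forall>g\<in>carrier (grp X (ini (shape X) a)).
        conj_by (grp Y (mV \<phi> (ter (shape X) a))) (mA \<phi> a)
             (psi Y (mE \<phi> a) (mG \<phi> (ini (shape X) a) g))
          = mG \<phi> (ter (shape X) a) (psi X a g)) \<and>
     (\<forall>a\<in>edges (shape X). \<forall>b\<in>edges (shape X). ini (shape X) a = ter (shape X) b \<longrightarrow>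
        (let H = grp Y (mV \<phi> (ter (shape X) a)) in
          mG \<phi> (ter (shape X) a) (twist X a b) \<otimes>\<^bsub>H\<^esub> mA \<phi> (cmp (shape X) a b)
            = mA \<phi> a \<otimes>\<^bsub>H\<^esub> psi Y (mE \<phi> a) (mA \<phi> b) \<otimes>\<^bsub>H\<^esub> twist Y (mE \<phi> a) (mE \<phi> b)))"

definition cog_id :: "('v, 'e, 'g) cog \<Rightarrow> ('v, 'e, 'g, 'v, 'e, 'g) cog_map" where
  "cog_id X = \<lparr>mV = (\<lambda>\<sigma>. \<sigma>), mE = (\<lambda>a. a), mG = (\<lambda>\<sigma> g. g),
               mA = (\<lambda>a. \<one>\<^bsub>grp X (ter (shape X) a)\<^esub>)\<rparr>"

definition cog_comp ::
  "('u, 'c, 'k) cog \<Rightarrow> ('w, 'd, 'h) cog \<Rightarrow> ('v, 'e, 'g, 'w, 'd, 'h) cog_map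
    \<Rightarrow> ('u, 'c, 'k, 'v, 'e, 'g) cog_map \<Rightarrow> ('u, 'c, 'k, 'w, 'd, 'h) cog_map" where
  "cog_comp U Y \<eta> \<phi> =
     \<lparr>mV = mV \<eta> \<circ> mV \<phi>,
      mE = mE \<eta> \<circ> mE \<phi>,
      mG = (\<lambda>\<sigma>. mG \<eta> (mV \<phi> \<sigma>) \<circ> mG \<phi> \<sigma>),
      mA = (\<lambda>a. let \<tau> = mV \<phi> (ter (shape U) a) in
              mG \<eta> \<tau> (mA \<phi> a) \<otimes>\<^bsub>grp Y (mV \<eta> \<tau>)\<^esub> mA \<eta> (mE \<phi> a))\<rparr>"

definition cog_iso ::
  "('v, 'e, 'g) cog \<Rightarrow> ('w, 'd, 'h) cog \<Rightarrow> ('v, 'e, 'g, 'w, 'd, 'h) cog_map \<Rightarrow> bool" where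
  "cog_iso X Y \<phi> \<longleftrightarrow> cog_morphism X Y \<phi> \<and>
     scwol_iso (shape X) (shape Y) (mV \<phi>) (mE \<phi>) \<and>
     (\<forall>\<sigma>\<in>verts (shape X). mG \<phi> \<sigma> \<in> iso (grp X \<sigma>) (grp Y (mV \<phi> \<sigma>)))"

definition cog_Aut :: "('v, 'e, 'g) cog \<Rightarrow> ('v, 'e, 'g, 'v, 'e, 'g) cog_map set" where
  "cog_Aut X = {\<eta>. cog_iso X X \<eta>}"

text \<open>The map on cosets in the definition of a covering sends \<open>C = g \<psi>\<^sub>a(G\<^sub>i\<^sub>(\<^sub>a\<^sub>))\<close> to the product set
  \<open>\<phi>\<^sub>\<sigma>(C) \<phi>(a) \<psi>\<^sub>b(G\<^sub>i\<^sub>(\<^sub>b\<^sub>))\<close>, where \<open>b = f(a)\<close>. For a morphism this set is the single coset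
  \<open>\<phi>\<^sub>\<sigma>(g) \<phi>(a) \<psi>\<^sub>b(G\<^sub>i\<^sub>(\<^sub>b\<^sub>))\<close>, independently of the representative \<open>g\<close>.\<close>

definition psi_image :: "('v, 'e, 'g) cog \<Rightarrow> 'e \<Rightarrow> 'g set" where
  "psi_image X a = psi X a ` carrier (grp X (ini (shape X) a))"

definition cog_covering ::
  "('v, 'e, 'g) cog \<Rightarrow> ('w, 'd, 'h) cog \<Rightarrow> ('v, 'e, 'g, 'w, 'd, 'h) cog_map \<Rightarrow> bool" where
  "cog_covering X Y \<phi> \<longleftrightarrow> cog_morphism X Y \<phi> \<and>
     mV \<phi> ` verts (shape X) = verts (shape Y) \<and> mE \<phi> ` edges (shape X) = edges (shape Y) \<and>
     (\<forall>\<sigma>\<in>verts (shape X).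
        inj_on (mG \<phi> \<sigma>) (carrier (grp X \<sigma>)) \<and>
        (\<forall>b\<in>edges (shape Y). ter (shape Y) b = mV \<phi> \<sigma> \<longrightarrow>
           bij_betw
             (\<lambda>(a, C). (mG \<phi> \<sigma> ` C #>\<^bsub>grp Y (mV \<phi> \<sigma>)\<^esub> mA \<phi> a) <#>\<^bsub>grp Y (mV \<phi> \<sigma>)\<^esub> psi_image Y b)
             (SIGMA a:{a \<in> edges (shape X). mE \<phi> a = b \<and> ter (shape X) a = \<sigma>}.
                lcosets\<^bsub>grp X \<sigma>\<^esub> (psi_image X a))
             (lcosets\<^bsub>grp Y (mV \<phi> \<sigma>)\<^esub> (psi_image Y b))))"


section \<open>Paths, homotopy and the fundamental group\<close>

text \<open>The path \<open>(g\<^sub>0, e\<^sub>1, g\<^sub>1, \<dots>, e\<^sub>k, g\<^sub>k)\<close> is stored as \<open>(\<sigma>, g\<^sub>0, [(e\<^sub>1, g\<^sub>1), \<dots>, (e\<^sub>k, g\<^sub>k)])\<close> with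
  its initial vertex \<open>\<sigma>\<close> made explicit, since the latter is needed for paths of length 0.\<close>

type_synonym ('v, 'e, 'g) cpath = "'v \<times> 'g \<times> ('e oedge \<times> 'g) list"

fun pini :: "('v, 'e, 'g) cpath \<Rightarrow> 'v" where
  "pini (\<sigma>, g, s) = \<sigma>"

fun pter :: "('v, 'e, 'g) cog \<Rightarrow> ('v, 'e, 'g) cpath \<Rightarrow> 'v" where
  "pter X (\<sigma>, g, s) = (if s = [] then \<sigma> else oter (shape X) (fst (last s)))"

fun is_cpath :: "('v, 'e, 'g) cog \<Rightarrow> ('v, 'e, 'g) cpath \<Rightarrow> bool" where
  "is_cpath X (\<sigma>, g, s) \<longleftrightarrow>
     (\<exists>\<tau>. edge_path (shape X) \<sigma> (map fst s) \<tau>) \<and> g \<in> carrier (grp X \<sigma>) \<and>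
     (\<forall>(e, h)\<in>set s. h \<in> carrier (grp X (oter (shape X) e)))"

definition cpaths_from :: "('v, 'e, 'g) cog \<Rightarrow> 'v \<Rightarrow> ('v, 'e, 'g) cpath set" where
  "cpaths_from X \<sigma> = {p. is_cpath X p \<and> pini p = \<sigma>}"

definition cloops :: "('v, 'e, 'g) cog \<Rightarrow> 'v \<Rightarrow> ('v, 'e, 'g) cpath set" where
  "cloops X \<sigma> = {p \<in> cpaths_from X \<sigma>. pter X p = \<sigma>}"

fun pcat :: "('v, 'e, 'g) cog \<Rightarrow> ('v, 'e, 'g) cpath \<Rightarrow> ('v, 'e, 'g) cpath \<Rightarrow> ('v, 'e, 'g) cpath" where
  "pcat X (\<sigma>, g, []) (\<tau>, h, r) = (\<sigma>, g \<otimes>\<^bsub>grp X \<sigma>\<^esub> h, r)"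
| "pcat X (\<sigma>, g, (e, k) # s) q =
     (case pcat X (oter (shape X) e, k, s) q of (_, k', s') \<Rightarrow> (\<sigma>, g, (e, k') # s'))"

definition pconst :: "'v \<Rightarrow> 'g \<Rightarrow> ('v, 'e, 'g) cpath" where
  "pconst \<sigma> g = (\<sigma>, g, [])"

definition pfwd :: "('v, 'e, 'g) cog \<Rightarrow> 'e \<Rightarrow> ('v, 'e, 'g) cpath" where
  "pfwd X a = (ini (shape X) a, \<one>\<^bsub>grp X (ini (shape X) a)\<^esub>,
               [(Fwd a, \<one>\<^bsub>grp X (ter (shape X) a)\<^esub>)])"

inductive elem_move :: "('v, 'e, 'g) cog \<Rightarrow> ('v, 'e, 'g) cpath \<Rightarrow> ('v, 'e, 'g) cpath \<Rightarrow> bool"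
  for X :: "('v, 'e, 'g) cog" where
  slide_fwd:
    "\<lbrakk>a \<in> edges (shape X); \<sigma> = ini (shape X) a; \<tau> = ter (shape X) a;
      k \<in> carrier (grp X \<sigma>); g \<in> carrier (grp X \<sigma>); h \<in> carrier (grp X \<tau>)\<rbrakk>
     \<Longrightarrow> elem_move X (\<sigma>, k \<otimes>\<^bsub>grp X \<sigma>\<^esub> g, [(Fwd a, h)])
                     (\<sigma>, k, [(Fwd a, psi X a g \<otimes>\<^bsub>grp X \<tau>\<^esub> h)])"
| slide_bwd:
    "\<lbrakk>a \<in> edges (shape X); \<sigma> = ini (shape X) a; \<tau> = ter (shape X) a;
      g \<in> carrier (grp X \<tau>); h \<in> carrier (grp X \<sigma>); k \<in> carrier (grp X \<sigma>)\<rbrakk>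
     \<Longrightarrow> elem_move X (\<tau>, g, [(Bwd a, h \<otimes>\<^bsub>grp X \<sigma>\<^esub> k)])
                     (\<tau>, g \<otimes>\<^bsub>grp X \<tau>\<^esub> psi X a h, [(Bwd a, k)])"
| cancel_fwd_bwd:
    "\<lbrakk>a \<in> edges (shape X); \<sigma> = ini (shape X) a;
      g \<in> carrier (grp X \<sigma>); h \<in> carrier (grp X \<sigma>); k \<in> carrier (grp X \<sigma>)\<rbrakk>
     \<Longrightarrow> elem_move X (\<sigma>, g, [(Fwd a, psi X a h), (Bwd a, k)])
                     (\<sigma>, g \<otimes>\<^bsub>grp X \<sigma>\<^esub> h \<otimes>\<^bsub>grp X \<sigma>\<^esub> k, [])"
| cancel_bwd_fwd:
    "\<lbrakk>b \<in> edges (shape X); \<sigma> = ini (shape X) b; \<tau> = ter (shape X) b;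
      g \<in> carrier (grp X \<tau>); h \<in> carrier (grp X \<sigma>); k \<in> carrier (grp X \<tau>)\<rbrakk>
     \<Longrightarrow> elem_move X (\<tau>, g, [(Bwd b, h), (Fwd b, k)])
                     (\<tau>, g \<otimes>\<^bsub>grp X \<tau>\<^esub> psi X b h \<otimes>\<^bsub>grp X \<tau>\<^esub> k, [])"
| compose_fwd:
    "\<lbrakk>a \<in> edges (shape X); b \<in> edges (shape X); ini (shape X) a = ter (shape X) b;
      \<sigma> = ini (shape X) b; \<rho> = ter (shape X) b; \<tau> = ter (shape X) a;
      g \<in> carrier (grp X \<sigma>); k \<in> carrier (grp X \<tau>)\<rbrakk>
     \<Longrightarrow> elem_move X (\<sigma>, g, [(Fwd b, \<one>\<^bsub>grp X \<rho>\<^esub>), (Fwd a, k)])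
                     (\<sigma>, g, [(Fwd (cmp (shape X) a b), inv\<^bsub>grp X \<tau>\<^esub> (twist X a b) \<otimes>\<^bsub>grp X \<tau>\<^esub> k)])"
| compose_bwd:
    "\<lbrakk>a \<in> edges (shape X); b \<in> edges (shape X); ini (shape X) a = ter (shape X) b;
      \<sigma> = ini (shape X) b; \<rho> = ter (shape X) b; \<tau> = ter (shape X) a;
      g \<in> carrier (grp X \<tau>); k \<in> carrier (grp X \<sigma>)\<rbrakk>
     \<Longrightarrow> elem_move X (\<tau>, g, [(Bwd a, \<one>\<^bsub>grp X \<rho>\<^esub>), (Bwd b, k)])
                     (\<tau>, g \<otimes>\<^bsub>grp X \<tau>\<^esub> twist X a b, [(Bwd (cmp (shape X) a b), k)])"

text \<open>Replacing a subpath \<open>s\<close> by \<open>s'\<close> is expressed through concatenation. This gives the same relation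
  as literal replacement inside a tuple, because each elementary move is stable under multiplying
  the outermost group elements on the outside.\<close>

inductive cpath_htpy :: "('v, 'e, 'g) cog \<Rightarrow> ('v, 'e, 'g) cpath \<Rightarrow> ('v, 'e, 'g) cpath \<Rightarrow> bool"
  for X :: "('v, 'e, 'g) cog" where
  replace: "\<lbrakk>elem_move X s s'; is_cpath X p; is_cpath X q; pter X p = pini s; pini q = pter X s\<rbrakk>
     \<Longrightarrow> cpath_htpy X (pcat X p (pcat X s q)) (pcat X p (pcat X s' q))"
| refl: "is_cpath X p \<Longrightarrow> cpath_htpy X p p"
| sym: "cpath_htpy X p q \<Longrightarrow> cpath_htpy X q p"
| trans: "\<lbrakk>cpath_htpy X p q; cpath_htpy X q r\<rbrakk> \<Longrightarrow> cpath_htpy X p r"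

definition hclass :: "('v, 'e, 'g) cog \<Rightarrow> ('v, 'e, 'g) cpath \<Rightarrow> ('v, 'e, 'g) cpath set" where
  "hclass X p = {q. cpath_htpy X p q}"

text \<open>Operations on homotopy classes are given as unions over all representatives; where the
  operation is well defined all members of the union coincide.\<close>

definition pi1 :: "('v, 'e, 'g) cog \<Rightarrow> 'v \<Rightarrow> ('v, 'e, 'g) cpath set monoid" where
  "pi1 X \<sigma> = \<lparr>carrier = hclass X ` cloops X \<sigma>,
              mult = (\<lambda>A B. \<Union>p\<in>A. \<Union>q\<in>B. hclass X (pcat X p q)),
              one = hclass X (pconst \<sigma> \<one>\<^bsub>grp X \<sigma>\<^esub>)\<rparr>"

definition developable :: "('v, 'e, 'g) cog \<Rightarrow> bool" where
  "developable X \<longleftrightarrow>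
     (\<forall>\<sigma>\<in>verts (shape X). inj_on (\<lambda>g. hclass X (pconst \<sigma> g)) (carrier (grp X \<sigma>)))"

fun pmap_oedge :: "('v, 'e, 'g) cog \<Rightarrow> ('w, 'd, 'h) cog \<Rightarrow> ('v, 'e, 'g, 'w, 'd, 'h) cog_map
    \<Rightarrow> 'e oedge \<Rightarrow> ('w, 'd, 'h) cpath" where
  "pmap_oedge X Y \<phi> (Fwd a) =
     (let \<sigma> = mV \<phi> (ini (shape X) a); \<tau> = mV \<phi> (ter (shape X) a) in
       (\<sigma>, \<one>\<^bsub>grp Y \<sigma>\<^esub>, [(Fwd (mE \<phi> a), inv\<^bsub>grp Y \<tau>\<^esub> (mA \<phi> a))]))"
| "pmap_oedge X Y \<phi> (Bwd a) =
     (let \<sigma> = mV \<phi> (ini (shape X) a); \<tau> = mV \<phi> (ter (shape X) a) in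
       (\<tau>, mA \<phi> a, [(Bwd (mE \<phi> a), \<one>\<^bsub>grp Y \<sigma>\<^esub>)]))"

fun pmap :: "('v, 'e, 'g) cog \<Rightarrow> ('w, 'd, 'h) cog \<Rightarrow> ('v, 'e, 'g, 'w, 'd, 'h) cog_map
    \<Rightarrow> ('v, 'e, 'g) cpath \<Rightarrow> ('w, 'd, 'h) cpath" where
  "pmap X Y \<phi> (\<sigma>, g, []) = pconst (mV \<phi> \<sigma>) (mG \<phi> \<sigma> g)"
| "pmap X Y \<phi> (\<sigma>, g, (e, h) # s) =
     pcat Y (pconst (mV \<phi> \<sigma>) (mG \<phi> \<sigma> g))
       (pcat Y (pmap_oedge X Y \<phi> e) (pmap X Y \<phi> (oter (shape X) e, h, s)))"

definition induced_hom :: "('v, 'e, 'g) cog \<Rightarrow> ('w, 'd, 'h) cog \<Rightarrow> ('v, 'e, 'g, 'w, 'd, 'h) cog_map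
    \<Rightarrow> ('v, 'e, 'g) cpath set \<Rightarrow> ('w, 'd, 'h) cpath set" where
  "induced_hom X Y \<phi> A = (\<Union>p\<in>A. hclass Y (pmap X Y \<phi> p))"


section \<open>The universal complex and the action of the fundamental group\<close>

definition uclass :: "('v, 'e, 'g) cog \<Rightarrow> 'v \<Rightarrow> ('v, 'e, 'g) cpath \<Rightarrow> ('v, 'e, 'g) cpath set" where
  "uclass X \<sigma>\<^sub>0 p = {q \<in> cpaths_from X \<sigma>\<^sub>0.
     \<exists>g\<in>carrier (grp X (pter X p)). hclass X q = hclass X (pcat X p (pconst (pter X p) g))}"

definition uedge :: "('v, 'e, 'g) cog \<Rightarrow> 'v \<Rightarrow> ('v, 'e, 'g) cpath \<Rightarrow> 'e
    \<Rightarrow> ('v, 'e, 'g) cpath set \<times> 'e \<times> ('v, 'e, 'g) cpath set" where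
  "uedge X \<sigma>\<^sub>0 p a = (uclass X \<sigma>\<^sub>0 p, a, uclass X \<sigma>\<^sub>0 (pcat X p (pfwd X a)))"

definition universal_scwol :: "('v, 'e, 'g) cog \<Rightarrow> 'v
    \<Rightarrow> (('v, 'e, 'g) cpath set, ('v, 'e, 'g) cpath set \<times> 'e \<times> ('v, 'e, 'g) cpath set) pre_scwol" where
  "universal_scwol X \<sigma>\<^sub>0 =
     \<lparr>verts = uclass X \<sigma>\<^sub>0 ` cpaths_from X \<sigma>\<^sub>0,
      edges = {uedge X \<sigma>\<^sub>0 p a | p a.
                 p \<in> cpaths_from X \<sigma>\<^sub>0 \<and> a \<in> edges (shape X) \<and> ini (shape X) a = pter X p},
      ini = (\<lambda>(A, a, B). A),
      ter = (\<lambda>(A, a, B). B),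
      cmp = (\<lambda>(A, a, B) (C, b, D).
               (C, cmp (shape X) a b,
                \<Union>p\<in>C. uclass X \<sigma>\<^sub>0 (pcat X p (pfwd X (cmp (shape X) a b)))))\<rparr>"

definition act_vert :: "('v, 'e, 'g) cog \<Rightarrow> 'v \<Rightarrow> ('v, 'e, 'g) cpath set
    \<Rightarrow> ('v, 'e, 'g) cpath set \<Rightarrow> ('v, 'e, 'g) cpath set" where
  "act_vert X \<sigma>\<^sub>0 c A = (\<Union>q\<in>c. \<Union>p\<in>A. uclass X \<sigma>\<^sub>0 (pcat X q p))"

definition act_edge :: "('v, 'e, 'g) cog \<Rightarrow> 'v \<Rightarrow> ('v, 'e, 'g) cpath set
    \<Rightarrow> ('v, 'e, 'g) cpath set \<times> 'e \<times> ('v, 'e, 'g) cpath set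
    \<Rightarrow> ('v, 'e, 'g) cpath set \<times> 'e \<times> ('v, 'e, 'g) cpath set" where
  "act_edge X \<sigma>\<^sub>0 c = (\<lambda>(A, a, B). (act_vert X \<sigma>\<^sub>0 c A, a, act_vert X \<sigma>\<^sub>0 c B))"

definition act_kernel :: "('v, 'e, 'g) cog \<Rightarrow> 'v \<Rightarrow> ('v, 'e, 'g) cpath set set" where
  "act_kernel X \<sigma>\<^sub>0 = {c \<in> carrier (pi1 X \<sigma>\<^sub>0).
     (\<forall>A\<in>verts (universal_scwol X \<sigma>\<^sub>0). act_vert X \<sigma>\<^sub>0 c A = A) \<and>
     (\<forall>x\<in>edges (universal_scwol X \<sigma>\<^sub>0). act_edge X \<sigma>\<^sub>0 c x = x)}"

definition centralizer :: "('a, 'm) monoid_scheme \<Rightarrow> 'a set \<Rightarrow> 'a set" where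
  "centralizer G U = {g \<in> carrier G. \<forall>u\<in>U. g \<otimes>\<^bsub>G\<^esub> u = u \<otimes>\<^bsub>G\<^esub> g}"


section \<open>Homotopy of morphisms and deck transformations\<close>

definition mor_htpy_by :: "('v, 'e, 'g) cog \<Rightarrow> ('w, 'd, 'h) cog \<Rightarrow> ('v \<Rightarrow> 'h)
    \<Rightarrow> ('v, 'e, 'g, 'w, 'd, 'h) cog_map \<Rightarrow> ('v, 'e, 'g, 'w, 'd, 'h) cog_map \<Rightarrow> bool" where
  "mor_htpy_by X Y k \<phi> \<eta> \<longleftrightarrow>
     cog_morphism X Y \<phi> \<and> cog_morphism X Y \<eta> \<and>
     (\<forall>\<sigma>\<in>verts (shape X). mV \<eta> \<sigma> = mV \<phi> \<sigma>) \<and> (\<forall>a\<in>edges (shape X). mE \<eta> a = mE \<phi> a) \<and>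
     (\<forall>\<sigma>\<in>verts (shape X). k \<sigma> \<in> carrier (grp Y (mV \<phi> \<sigma>))) \<and>
     (\<forall>\<sigma>\<in>verts (shape X). \<forall>g\<in>carrier (grp X \<sigma>).
        mG \<eta> \<sigma> g = conj_by (grp Y (mV \<phi> \<sigma>)) (k \<sigma>) (mG \<phi> \<sigma> g)) \<and>
     (\<forall>a\<in>edges (shape X).
        let \<sigma> = ini (shape X) a; \<tau> = ter (shape X) a; H = grp Y (mV \<phi> \<tau>) in
          mA \<eta> a = k \<tau> \<otimes>\<^bsub>H\<^esub> mA \<phi> a \<otimes>\<^bsub>H\<^esub> psi Y (mE \<phi> a) (inv\<^bsub>grp Y (mV \<phi> \<sigma>)\<^esub> (k \<sigma>)))"

definition mor_htpy :: "('v, 'e, 'g) cog \<Rightarrow> ('w, 'd, 'h) cog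
    \<Rightarrow> ('v, 'e, 'g, 'w, 'd, 'h) cog_map \<Rightarrow> ('v, 'e, 'g, 'w, 'd, 'h) cog_map \<Rightarrow> bool" where
  "mor_htpy X Y \<phi> \<eta> \<longleftrightarrow> (\<exists>k. mor_htpy_by X Y k \<phi> \<eta>)"

definition mor_htpy_rel :: "('v, 'e, 'g) cog \<Rightarrow> ('w, 'd, 'h) cog \<Rightarrow> 'v
    \<Rightarrow> ('v, 'e, 'g, 'w, 'd, 'h) cog_map \<Rightarrow> ('v, 'e, 'g, 'w, 'd, 'h) cog_map \<Rightarrow> bool" where
  "mor_htpy_rel X Y \<sigma>\<^sub>0 \<phi> \<eta> \<longleftrightarrow>
     (\<exists>k. mor_htpy_by X Y k \<phi> \<eta> \<and> k \<sigma>\<^sub>0 = \<one>\<^bsub>grp Y (mV \<phi> \<sigma>\<^sub>0)\<^esub>)"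

definition mor_class :: "('v, 'e, 'g) cog \<Rightarrow> ('w, 'd, 'h) cog
    \<Rightarrow> ('v, 'e, 'g, 'w, 'd, 'h) cog_map \<Rightarrow> ('v, 'e, 'g, 'w, 'd, 'h) cog_map set" where
  "mor_class X Y \<phi> = {\<eta>. mor_htpy X Y \<phi> \<eta>}"

definition mor_shift :: "('v, 'e, 'g) cog \<Rightarrow> ('w, 'd, 'h) cog \<Rightarrow> ('v \<Rightarrow> 'h)
    \<Rightarrow> ('v, 'e, 'g, 'w, 'd, 'h) cog_map \<Rightarrow> ('v, 'e, 'g, 'w, 'd, 'h) cog_map" where
  "mor_shift X Y k \<phi> =
     \<lparr>mV = mV \<phi>,
      mE = mE \<phi>,
      mG = (\<lambda>\<sigma> g. conj_by (grp Y (mV \<phi> \<sigma>)) (k \<sigma>) (mG \<phi> \<sigma> g)),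
      mA = (\<lambda>a. let \<sigma> = ini (shape X) a; \<tau> = ter (shape X) a; H = grp Y (mV \<phi> \<tau>) in
              k \<tau> \<otimes>\<^bsub>H\<^esub> mA \<phi> a \<otimes>\<^bsub>H\<^esub> psi Y (mE \<phi> a) (inv\<^bsub>grp Y (mV \<phi> \<sigma>)\<^esub> (k \<sigma>)))\<rparr>"

text \<open>The morphism \<open>\<phi>\<close> shifted by the family with value \<open>g\<close> at \<open>\<sigma>\<^sub>0\<close> and \<open>1\<close> elsewhere.\<close>

definition mor_shift_at :: "('v, 'e, 'g) cog \<Rightarrow> ('w, 'd, 'h) cog \<Rightarrow> 'v \<Rightarrow> 'h
    \<Rightarrow> ('v, 'e, 'g, 'w, 'd, 'h) cog_map \<Rightarrow> ('v, 'e, 'g, 'w, 'd, 'h) cog_map" where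
  "mor_shift_at X Y \<sigma>\<^sub>0 g \<phi> = mor_shift X Y ((\<lambda>\<sigma>. \<one>\<^bsub>grp Y (mV \<phi> \<sigma>)\<^esub>)(\<sigma>\<^sub>0 := g)) \<phi>"

definition Deck :: "('v, 'e, 'g) cog \<Rightarrow> ('w, 'd, 'h) cog \<Rightarrow> ('v, 'e, 'g, 'w, 'd, 'h) cog_map
    \<Rightarrow> ('v, 'e, 'g, 'v, 'e, 'g) cog_map set monoid" where
  "Deck X Y \<phi> =
     \<lparr>carrier = {mor_class X X \<eta> | \<eta>. \<eta> \<in> cog_Aut X \<and> mor_htpy X Y \<phi> (cog_comp X Y \<phi> \<eta>)},
      mult = (\<lambda>A B. \<Union>\<eta>\<^sub>1\<in>A. \<Union>\<eta>\<^sub>2\<in>B. mor_class X X (cog_comp X X \<eta>\<^sub>1 \<eta>\<^sub>2)),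
      one = mor_class X X (cog_id X)\<rparr>"

text \<open>\<open>is_eps X Y \<phi> \<sigma>\<^sub>0 h D\<close>: the class \<open>D\<close> is \<open>[\<eta>]\<close> for an automorphism \<open>\<eta>\<close> that qualifies as
  \<open>\<eta>\<^sub>p\<^sup>g\<close> for some \<open>p\<close> and \<open>g\<close> with \<open>h = [\<pp>\<^sub>\<phi>(p) \<star> (g)]\<close>.\<close>

definition is_eps :: "('v, 'e, 'g) cog \<Rightarrow> ('w, 'd, 'h) cog \<Rightarrow> ('v, 'e, 'g, 'w, 'd, 'h) cog_map
    \<Rightarrow> 'v \<Rightarrow> ('w, 'd, 'h) cpath set \<Rightarrow> ('v, 'e, 'g, 'v, 'e, 'g) cog_map set \<Rightarrow> bool" where
  "is_eps X Y \<phi> \<sigma>\<^sub>0 h D \<longleftrightarrow>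
     (\<exists>p g \<eta>. p \<in> cpaths_from X \<sigma>\<^sub>0 \<and> mV \<phi> (pter X p) = mV \<phi> \<sigma>\<^sub>0 \<and> g \<in> carrier (grp Y (mV \<phi> \<sigma>\<^sub>0)) \<and>
        h = hclass Y (pcat Y (pmap X Y \<phi> p) (pconst (mV \<phi> \<sigma>\<^sub>0) g)) \<and>
        \<eta> \<in> cog_Aut X \<and> mV \<eta> \<sigma>\<^sub>0 = pter X p \<and>
        mor_htpy_rel X Y \<sigma>\<^sub>0 (cog_comp X Y \<phi> \<eta>) (mor_shift_at X Y \<sigma>\<^sub>0 g \<phi>) \<and>
        D = mor_class X X \<eta>)"

definition eps :: "('v, 'e, 'g) cog \<Rightarrow> ('w, 'd, 'h) cog \<Rightarrow> ('v, 'e, 'g, 'w, 'd, 'h) cog_map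
    \<Rightarrow> 'v \<Rightarrow> ('w, 'd, 'h) cpath set \<Rightarrow> ('v, 'e, 'g, 'v, 'e, 'g) cog_map set" where
  "eps X Y \<phi> \<sigma>\<^sub>0 h = (THE D. is_eps X Y \<phi> \<sigma>\<^sub>0 h D)"

end

theory Submission
  imports Defs
begin

text \<open>Homotopy classes of paths form the fundamental groupoid. A morphism of complexes of groups induces
  a functor, and developability lets one recover a morphism from its functor and homotopies of
  morphisms from natural transformations, so everything becomes a computation in groupoids. A covering
  \<open>\<phi>\<close> has unique lifting: each arrow \<open>y\<close> starting at \<open>f(\<sigma>)\<close> is \<open>\<phi>(x) g\<close> with \<open>g\<close> in a local group of
  the target and \<open>x\<close> unique up to a local factor. For \<open>h\<close> in the normalizer of \<open>U\<close>, lifting \<open>h \<phi>(x)\<close> for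
  all arrows \<open>x\<close> from \<open>\<sigma>\<^sub>0\<close> gives \<open>h \<phi>(x) = \<phi>(p \<eta>(x)) k\<close> for an automorphism \<open>\<eta>\<close> and a homotopy \<open>k\<close>. This
  identity determines \<open>\<eta>\<close> up to homotopy and is multiplicative in \<open>h\<close>, and every deck transformation
  satisfies it for some \<open>h\<close>, which then normalizes \<open>U\<close>. It holds with \<open>\<eta> = 1\<close> iff \<open>h = c u\<close> with
  \<open>u \<in> U\<close> and \<open>c\<close> commuting with \<open>U\<close> and fixing the vertices of the universal scwol.\<close>

section \<open>Paths up to homotopy\<close>

text \<open>The delicate point is uniqueness of lifts, since homotopies in the target do not visibly
  come from homotopies in the source. Path classes are therefore treated through generators (local
  elements and edges) and relations: values respecting the relations extend to all classes. This is
  used twice, with values in another groupoid, which makes a morphism a functor, and with values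
  binary relations on classes of states, which makes the target groupoid act. Backward edges act by
  converse relations, so no inverse maps are built.

  A lift is unique only up to a local factor; this is why an automorphism is determined only up to
  homotopy. The data kept for \<open>h\<close> are \<open>\<eta>\<close>, a homotopy
  \<open>k\<close> from \<open>\<phi>\<close> to \<open>\<phi>\<close> after \<open>\<eta>\<close>,
  and an arrow \<open>p\<close> from the base vertex to its image, with \<open>h\<close> equal to
  \<open>\<phi>(p)\<close> times the value of \<open>k\<close> at the base. Changing
  \<open>\<eta>\<close> in its class changes \<open>k\<close> and \<open>p\<close> but not
  \<open>h\<close>.

  The group \<open>C\<close> consists of base values of homotopies from \<open>\<phi>\<close> to
  itself: naturality at loops makes such a value commute with \<open>U\<close>, and naturality along
  all arrows, with lifting, makes it act trivially on the universal scwol.\<close>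

abbreviation "vts X \<equiv> verts (shape X)"
abbreviation "eds X \<equiv> edges (shape X)"
abbreviation "org X \<equiv> ini (shape X)"
abbreviation "trg X \<equiv> ter (shape X)"
abbreviation "cpo X \<equiv> cmp (shape X)"

abbreviation Gr :: "('v, 'e, 'g) cog \<Rightarrow> 'v \<Rightarrow> 'g set" where
  "Gr X \<sigma> \<equiv> carrier (grp X \<sigma>)"

abbreviation lmul :: "'g \<Rightarrow> ('v, 'e, 'g) cog \<Rightarrow> 'v \<Rightarrow> 'g \<Rightarrow> 'g" ("_ \<odot>[_,_] _" [70,0,0,71] 70) where
  "g \<odot>[X,\<sigma>] h \<equiv> g \<otimes>\<^bsub>grp X \<sigma>\<^esub> h"

abbreviation lone :: "('v, 'e, 'g) cog \<Rightarrow> 'v \<Rightarrow> 'g" where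
  "lone X \<sigma> \<equiv> \<one>\<^bsub>grp X \<sigma>\<^esub>"

abbreviation linv :: "('v, 'e, 'g) cog \<Rightarrow> 'v \<Rightarrow> 'g \<Rightarrow> 'g" where
  "linv X \<sigma> g \<equiv> inv\<^bsub>grp X \<sigma>\<^esub> g"

definition pbwd :: "('v, 'e, 'g) cog \<Rightarrow> 'e \<Rightarrow> ('v, 'e, 'g) cpath" where
  "pbwd X a = (trg X a, lone X (trg X a), [(Bwd a, lone X (org X a))])"

lemma is_cpath_Nil [simp]: "is_cpath X (\<sigma>, g, []) \<longleftrightarrow> \<sigma> \<in> vts X \<and> g \<in> Gr X \<sigma>"
  by auto

lemma is_cpath_Cons [simp]:
  "is_cpath X (\<sigma>, g, (e, h) # s) \<longleftrightarrow> g \<in> Gr X \<sigma> \<and> oedge_base e \<in> eds X \<and>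
     oini (shape X) e = \<sigma> \<and> is_cpath X (oter (shape X) e, h, s)"
  by auto

lemma pter_Nil [simp]: "pter X (\<sigma>, g, []) = \<sigma>"
  by simp

lemma pter_Cons [simp]: "pter X (\<sigma>, g, (e, h) # s) = pter X (oter (shape X) e, h, s)"
  by simp

declare is_cpath.simps [simp del] pter.simps [simp del]

lemma pini_pcat [simp]: "pini (pcat X p q) = pini p"
  by (induction X p q rule: pcat.induct) (auto split: prod.splits)

lemma pcat_Cons:
  "pcat X (\<sigma>, g, (e, k) # s) q =
     (\<sigma>, g, (e, fst (snd (pcat X (oter (shape X) e, k, s) q)))
        # snd (snd (pcat X (oter (shape X) e, k, s) q)))"
  by (simp split: prod.splits)

context complex_of_groups
begin

lemma ini_vert [simp]: "a \<in> eds X \<Longrightarrow> org X a \<in> vts X"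
  by (rule ini_closed)

lemma ter_vert [simp]: "a \<in> eds X \<Longrightarrow> trg X a \<in> vts X"
  by (rule ter_closed)

lemma oini_vert [simp]: "oedge_base e \<in> eds X \<Longrightarrow> oini (shape X) e \<in> vts X"
  by (cases e) auto

text \<open>The laws of the local groups are restated with membership in the vertex set as the only
  group hypothesis, so that most calculations mixing several local groups need no interpretation of
  each one.\<close>

lemma l_closed [simp]: "\<lbrakk>\<sigma> \<in> vts X; g \<in> Gr X \<sigma>; h \<in> Gr X \<sigma>\<rbrakk> \<Longrightarrow> g \<odot>[X,\<sigma>] h \<in> Gr X \<sigma>"
  using local_group by (simp add: group.is_monoid monoid.m_closed)

lemma l_one_closed [simp]: "\<sigma> \<in> vts X \<Longrightarrow> lone X \<sigma> \<in> Gr X \<sigma>"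
  using local_group by (simp add: group.is_monoid monoid.one_closed)

lemma l_inv_closed [simp]: "\<lbrakk>\<sigma> \<in> vts X; g \<in> Gr X \<sigma>\<rbrakk> \<Longrightarrow> linv X \<sigma> g \<in> Gr X \<sigma>"
  using local_group by (simp add: group.inv_closed)

lemma l_assoc: "\<lbrakk>\<sigma> \<in> vts X; g \<in> Gr X \<sigma>; h \<in> Gr X \<sigma>; k \<in> Gr X \<sigma>\<rbrakk>
    \<Longrightarrow> (g \<odot>[X,\<sigma>] h) \<odot>[X,\<sigma>] k = g \<odot>[X,\<sigma>] (h \<odot>[X,\<sigma>] k)"
  using local_group by (simp add: group.is_monoid monoid.m_assoc)

lemma l_one_l [simp]: "\<lbrakk>\<sigma> \<in> vts X; g \<in> Gr X \<sigma>\<rbrakk> \<Longrightarrow> lone X \<sigma> \<odot>[X,\<sigma>] g = g"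
  using local_group by (simp add: group.is_monoid)

lemma l_one_r [simp]: "\<lbrakk>\<sigma> \<in> vts X; g \<in> Gr X \<sigma>\<rbrakk> \<Longrightarrow> g \<odot>[X,\<sigma>] lone X \<sigma> = g"
  using local_group by (simp add: group.is_monoid)

lemma l_inv_l [simp]: "\<lbrakk>\<sigma> \<in> vts X; g \<in> Gr X \<sigma>\<rbrakk> \<Longrightarrow> linv X \<sigma> g \<odot>[X,\<sigma>] g = lone X \<sigma>"
  using local_group by (simp add: group.l_inv)

lemma l_inv_r [simp]: "\<lbrakk>\<sigma> \<in> vts X; g \<in> Gr X \<sigma>\<rbrakk> \<Longrightarrow> g \<odot>[X,\<sigma>] linv X \<sigma> g = lone X \<sigma>"
  using local_group by (simp add: group.r_inv)

lemma l_inv_inv [simp]: "\<lbrakk>\<sigma> \<in> vts X; g \<in> Gr X \<sigma>\<rbrakk> \<Longrightarrow> linv X \<sigma> (linv X \<sigma> g) = g"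
  using local_group by (simp add: group.inv_inv)

lemma l_cancel [simp]:
  assumes "\<sigma> \<in> vts X" "g \<in> Gr X \<sigma>" "h \<in> Gr X \<sigma>"
  shows "linv X \<sigma> g \<odot>[X,\<sigma>] (g \<odot>[X,\<sigma>] h) = h" "g \<odot>[X,\<sigma>] (linv X \<sigma> g \<odot>[X,\<sigma>] h) = h"
  using assms by (simp_all add: l_assoc[symmetric])

lemma l_inv_one [simp]: "\<sigma> \<in> vts X \<Longrightarrow> linv X \<sigma> (lone X \<sigma>) = lone X \<sigma>"
  using local_group by (simp add: group.is_monoid monoid.inv_one)

lemma psi_hom: "a \<in> eds X \<Longrightarrow> psi X a \<in> hom (grp X (org X a)) (grp X (trg X a))"
  using psi_mon by (auto simp: mon_def)

lemma psi_closed [simp]: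
  "\<lbrakk>a \<in> eds X; g \<in> Gr X (org X a)\<rbrakk> \<Longrightarrow> psi X a g \<in> Gr X (trg X a)"
  using psi_hom by (auto simp: hom_def)

lemma psi_mult: "\<lbrakk>a \<in> eds X; g \<in> Gr X (org X a); h \<in> Gr X (org X a)\<rbrakk>
    \<Longrightarrow> psi X a (g \<odot>[X,org X a] h) = psi X a g \<odot>[X,trg X a] psi X a h"
  using psi_hom by (auto simp: hom_def)

lemma psi_inj: "a \<in> eds X \<Longrightarrow> inj_on (psi X a) (Gr X (org X a))"
  using psi_mon by (auto simp: mon_def)

lemma psi_one [simp]: "a \<in> eds X \<Longrightarrow> psi X a (lone X (org X a)) = lone X (trg X a)"
  by (rule hom_one[OF psi_hom]) (simp_all add: local_group)

lemma psi_inv: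
  assumes "a \<in> eds X" "g \<in> Gr X (org X a)"
  shows "psi X a (linv X (org X a) g) = linv X (trg X a) (psi X a g)"
  using group_hom.hom_inv[OF group_hom.intro[OF _ _ group_hom_axioms.intro[OF psi_hom]]] assms
  by (simp add: local_group)

lemma pini_vert [simp]: "is_cpath X p \<Longrightarrow> pini p \<in> vts X"
proof (cases p)
  case (fields \<sigma> g s)
  then show "is_cpath X p \<Longrightarrow> pini p \<in> vts X"
    by (cases s) auto
qed

lemma pter_vert [simp]: "is_cpath X p \<Longrightarrow> pter X p \<in> vts X"
proof -
  have "is_cpath X (\<sigma>, g, s) \<Longrightarrow> pter X (\<sigma>, g, s) \<in> vts X" for \<sigma> g s
    by (induction s arbitrary: \<sigma> g) auto
  then show "is_cpath X p \<Longrightarrow> pter X p \<in> vts X"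
    by (cases p) auto
qed

lemma pcat_closed:
  assumes "is_cpath X p" "is_cpath X q" "pter X p = pini q"
  shows "is_cpath X (pcat X p q) \<and> pter X (pcat X p q) = pter X q"
proof -
  obtain \<tau> h r where q: "q = (\<tau>, h, r)" by (cases q)
  have "is_cpath X (\<sigma>, g, s) \<Longrightarrow> pter X (\<sigma>, g, s) = \<tau> \<Longrightarrow>
      is_cpath X (pcat X (\<sigma>, g, s) q) \<and> pter X (pcat X (\<sigma>, g, s) q) = pter X q" for \<sigma> g s
  proof (induction s arbitrary: \<sigma> g)
    case Nil
    then show ?case using assms(2) unfolding q by (cases r) auto
  next
    case (Cons x s)
    obtain e k where x: "x = (e, k)" by (cases x)
    obtain g' s' where eq: "pcat X (oter (shape X) e, k, s) q = (oter (shape X) e, g', s')"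
      by (metis pini.simps pini_pcat prod.exhaust)
    show ?case using Cons.IH[of "oter (shape X) e" k] Cons.prems unfolding x
      by (simp add: eq del: pcat.simps add: pcat_Cons)
  qed
  then show ?thesis using assms q by (cases p) auto
qed

lemma is_cpath_pcat [simp]:
  "\<lbrakk>is_cpath X p; is_cpath X q; pter X p = pini q\<rbrakk> \<Longrightarrow> is_cpath X (pcat X p q)"
  and pter_pcat [simp]:
  "\<lbrakk>is_cpath X p; is_cpath X q; pter X p = pini q\<rbrakk> \<Longrightarrow> pter X (pcat X p q) = pter X q"
  using pcat_closed by blast+

lemma pcat_assoc:
  assumes "is_cpath X p" "is_cpath X q" "is_cpath X r" "pter X p = pini q" "pter X q = pini r"
  shows "pcat X (pcat X p q) r = pcat X p (pcat X q r)"
proof -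
  obtain \<tau> h t where q: "q = (\<tau>, h, t)" by (cases q)
  obtain \<rho> k u where r: "r = (\<rho>, k, u)" by (cases r)
  have "is_cpath X (\<sigma>, g, s) \<Longrightarrow> pter X (\<sigma>, g, s) = \<tau> \<Longrightarrow>
      pcat X (pcat X (\<sigma>, g, s) q) r = pcat X (\<sigma>, g, s) (pcat X q r)" for \<sigma> g s
  proof (induction s arbitrary: \<sigma> g)
    case Nil
    then show ?case using assms(2,3,5) unfolding q r by (cases t; cases u) (auto simp: l_assoc pcat_Cons simp del: pcat.simps(2))
  next
    case (Cons x s)
    obtain e k where x: "x = (e, k)" by (cases x)
    obtain g' s' where eq: "pcat X (oter (shape X) e, k, s) q = (oter (shape X) e, g', s')"
      by (metis pini.simps pini_pcat prod.exhaust)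
    show ?case using Cons.IH[of "oter (shape X) e" k] Cons.prems unfolding x
      by (simp add: eq del: pcat.simps add: pcat_Cons)
  qed
  then show ?thesis using assms q by (cases p) auto
qed

lemma pconst_cpath [simp]: "\<lbrakk>\<sigma> \<in> vts X; g \<in> Gr X \<sigma>\<rbrakk> \<Longrightarrow> is_cpath X (pconst \<sigma> g)"
  by (simp add: pconst_def)

lemma pini_pconst [simp]: "pini (pconst \<sigma> g) = \<sigma>" and pter_pconst [simp]: "pter X (pconst \<sigma> g) = \<sigma>"
  by (simp_all add: pconst_def)

lemma pfwd_cpath [simp]: "a \<in> eds X \<Longrightarrow> is_cpath X (pfwd X a)"
  and pini_pfwd [simp]: "pini (pfwd X a) = org X a"
  and pter_pfwd [simp]: "pter X (pfwd X a) = trg X a"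
  by (simp_all add: pfwd_def)

lemma pbwd_cpath [simp]: "a \<in> eds X \<Longrightarrow> is_cpath X (pbwd X a)"
  and pini_pbwd [simp]: "pini (pbwd X a) = trg X a"
  and pter_pbwd [simp]: "pter X (pbwd X a) = org X a"
  by (simp_all add: pbwd_def)

lemma pconst_pcat [simp]: "is_cpath X p \<Longrightarrow> pini p = \<sigma> \<Longrightarrow> pcat X (pconst \<sigma> (lone X \<sigma>)) p = p"
proof (cases p)
  case (fields \<sigma>' g s)
  then show "is_cpath X p \<Longrightarrow> pini p = \<sigma> \<Longrightarrow> pcat X (pconst \<sigma> (lone X \<sigma>)) p = p"
    by (cases s) (auto simp: pconst_def)
qed

lemma pcat_pconst [simp]: "is_cpath X p \<Longrightarrow> pter X p = \<tau> \<Longrightarrow> pcat X p (pconst \<tau> (lone X \<tau>)) = p"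
proof -
  have "is_cpath X (\<sigma>, g, s) \<Longrightarrow> pter X (\<sigma>, g, s) = \<tau> \<Longrightarrow>
     pcat X (\<sigma>, g, s) (pconst \<tau> (lone X \<tau>)) = (\<sigma>, g, s)" for \<sigma> g s
    by (induction s arbitrary: \<sigma> g) (auto simp: pconst_def pcat_Cons simp del: pcat.simps(2))
  then show "is_cpath X p \<Longrightarrow> pter X p = \<tau> \<Longrightarrow> pcat X p (pconst \<tau> (lone X \<tau>)) = p"
    by (cases p) auto
qed

lemma elem_move_ends:
  "elem_move X s s' \<Longrightarrow> is_cpath X s \<and> is_cpath X s' \<and> pini s' = pini s \<and> pter X s' = pter X s"
  by (induction rule: elem_move.induct) (auto simp: ini_cmp ter_cmp cmp_closed twist_closed)

lemma htpy_ends: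
  "cpath_htpy X p q \<Longrightarrow> is_cpath X p \<and> is_cpath X q \<and> pini q = pini p \<and> pter X q = pter X p"
  by (induction rule: cpath_htpy.induct) (auto dest: elem_move_ends)

text \<open>The extra prefix is absorbed into the outer context of the \<open>replace\<close>
  rule.\<close>

lemma htpy_cong_l:
  "cpath_htpy X p q \<Longrightarrow> is_cpath X r \<Longrightarrow> pter X r = pini p \<Longrightarrow> cpath_htpy X (pcat X r p) (pcat X r q)"
proof (induction rule: cpath_htpy.induct)
  case (replace s s' p q)
  note e = elem_move_ends[OF replace(1)]
  have "pcat X r (pcat X p (pcat X t q)) = pcat X (pcat X r p) (pcat X t q)" if "t = s \<or> t = s'" for t
    using replace e that by (auto simp: pcat_assoc)
  then show ?case using replace e by (simp add: cpath_htpy.replace)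
next
  case (sym p q)
  then show ?case using htpy_ends[of p q] by (auto intro: cpath_htpy.sym)
next
  case (trans p q r)
  then show ?case using htpy_ends[of p q] by (auto intro: cpath_htpy.trans)
qed (simp add: cpath_htpy.refl)

lemma htpy_cong_r:
  "cpath_htpy X p q \<Longrightarrow> is_cpath X r \<Longrightarrow> pter X p = pini r \<Longrightarrow> cpath_htpy X (pcat X p r) (pcat X q r)"
proof (induction rule: cpath_htpy.induct)
  case (replace s s' p q)
  note e = elem_move_ends[OF replace(1)]
  have "pcat X (pcat X p (pcat X t q)) r = pcat X p (pcat X t (pcat X q r))" if "t = s \<or> t = s'" for t
    using replace e that by (auto simp: pcat_assoc)
  then show ?case using replace e by (simp add: cpath_htpy.replace)
next
  case (sym p q)
  then show ?case using htpy_ends[of p q] by (auto intro: cpath_htpy.sym)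
next
  case (trans p q r)
  then show ?case using htpy_ends[of p q] by (auto intro: cpath_htpy.trans)
qed (simp add: cpath_htpy.refl)

lemma htpy_cong:
  assumes "cpath_htpy X p p'" "cpath_htpy X q q'" "pter X p = pini q"
  shows "cpath_htpy X (pcat X p q) (pcat X p' q')"
  using htpy_cong_l[OF assms(2), of p] htpy_cong_r[OF assms(1), of q'] htpy_ends[OF assms(1)]
    htpy_ends[OF assms(2)] assms(3) by (auto intro: cpath_htpy.trans)

lemma htpy_move: "elem_move X s s' \<Longrightarrow> cpath_htpy X s s'"
proof -
  assume a: "elem_move X s s'"
  note e = elem_move_ends[OF a]
  show ?thesis
    using cpath_htpy.replace[OF a, of "pconst (pini s) (lone X (pini s))" "pconst (pter X s) (lone X (pter X s))"] e
    by simp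
qed

lemma hclass_eq_iff: "is_cpath X p \<Longrightarrow> hclass X p = hclass X q \<longleftrightarrow> cpath_htpy X p q"
  unfolding hclass_def
  by (auto intro: cpath_htpy.refl cpath_htpy.sym cpath_htpy.trans)

lemma in_hclass_iff [simp]: "q \<in> hclass X p \<longleftrightarrow> cpath_htpy X p q"
  by (simp add: hclass_def)

end

section \<open>The fundamental groupoid\<close>

text \<open>The product of homotopy classes is empty when the end points do not match; with this
  convention it is associative without side conditions.\<close>

definition pm :: "('v, 'e, 'g) cog \<Rightarrow> ('v, 'e, 'g) cpath set \<Rightarrow> ('v, 'e, 'g) cpath set
    \<Rightarrow> ('v, 'e, 'g) cpath set" where
  "pm X A B = {r. \<exists>p\<in>A. \<exists>q\<in>B. is_cpath X p \<and> is_cpath X q \<and> pter X p = pini q \<and>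
     cpath_htpy X (pcat X p q) r}"

abbreviation pm_infix ("_ \<star>[_] _" [70, 0, 71] 70) where
  "x \<star>[X] y \<equiv> pm X x y"

definition ar :: "('v, 'e, 'g) cog \<Rightarrow> ('v, 'e, 'g) cpath set \<Rightarrow> bool" where
  "ar X x \<longleftrightarrow> (\<exists>p. is_cpath X p \<and> x = hclass X p)"

text \<open>A class does not record its end points. They are read off a chosen representative, which
  is harmless because homotopy fixes end points.\<close>

definition src :: "('v, 'e, 'g) cpath set \<Rightarrow> 'v" where
  "src x = pini (SOME p. p \<in> x)"

definition tgt :: "('v, 'e, 'g) cog \<Rightarrow> ('v, 'e, 'g) cpath set \<Rightarrow> 'v" where
  "tgt X x = pter X (SOME p. p \<in> x)"

definition arr :: "('v, 'e, 'g) cog \<Rightarrow> 'v \<Rightarrow> 'v \<Rightarrow> ('v, 'e, 'g) cpath set set" where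
  "arr X \<sigma> \<tau> = {x. ar X x \<and> src x = \<sigma> \<and> tgt X x = \<tau>}"

definition lc :: "('v, 'e, 'g) cog \<Rightarrow> 'v \<Rightarrow> 'g \<Rightarrow> ('v, 'e, 'g) cpath set" where
  "lc X \<sigma> g = hclass X (pconst \<sigma> g)"

definition ed :: "('v, 'e, 'g) cog \<Rightarrow> 'e \<Rightarrow> ('v, 'e, 'g) cpath set" where
  "ed X a = hclass X (pfwd X a)"

definition bd :: "('v, 'e, 'g) cog \<Rightarrow> 'e \<Rightarrow> ('v, 'e, 'g) cpath set" where
  "bd X a = hclass X (pbwd X a)"

text \<open>The inverse is selected by its two-sided inverse property instead of by reversing paths,
  so that no compatibility of reversal with homotopy has to be shown.\<close>

definition iv :: "('v, 'e, 'g) cog \<Rightarrow> ('v, 'e, 'g) cpath set \<Rightarrow> ('v, 'e, 'g) cpath set" where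
  "iv X x = (SOME y. ar X y \<and> src y = tgt X x \<and> tgt X y = src x \<and>
     x \<star>[X] y = lc X (src x) (lone X (src x)) \<and> y \<star>[X] x = lc X (tgt X x) (lone X (tgt X x)))"

context complex_of_groups
begin

lemma ar_hclass [simp]: "is_cpath X p \<Longrightarrow> ar X (hclass X p)"
  unfolding ar_def by blast

lemma arE:
  assumes "ar X x"
  obtains p where "is_cpath X p" "x = hclass X p"
  using assms unfolding ar_def by blast

lemma pmI:
  "\<lbrakk>p \<in> A; q \<in> B; is_cpath X p; is_cpath X q; pter X p = pini q; cpath_htpy X (pcat X p q) r\<rbrakk>
    \<Longrightarrow> r \<in> A \<star>[X] B"
  unfolding pm_def by blast

lemma some_rep: "is_cpath X p \<Longrightarrow> cpath_htpy X p (SOME q. q \<in> hclass X p)"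
  using someI[of "\<lambda>q. q \<in> hclass X p" p] by (simp add: cpath_htpy.refl)

lemma src_hclass [simp]: "is_cpath X p \<Longrightarrow> src (hclass X p) = pini p"
  unfolding src_def using htpy_ends[OF some_rep] by simp

lemma tgt_hclass [simp]: "is_cpath X p \<Longrightarrow> tgt X (hclass X p) = pter X p"
  unfolding tgt_def using htpy_ends[OF some_rep] by simp

lemma hclass_pcat:
  assumes "is_cpath X p" "is_cpath X q" "pter X p = pini q"
  shows "hclass X (pcat X p q) = hclass X p \<star>[X] hclass X q"
proof -
  have "cpath_htpy X (pcat X p q) r" if "cpath_htpy X p p'" "cpath_htpy X q q'" "cpath_htpy X (pcat X p' q') r" for p' q' r
    using htpy_cong[OF that(1,2) assms(3)] that(3) by (rule cpath_htpy.trans)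
  moreover have "cpath_htpy X p p" "cpath_htpy X q q" using assms by (simp_all add: cpath_htpy.refl)
  ultimately show ?thesis using assms unfolding pm_def hclass_def by blast
qed

lemma pm_assoc: "x \<star>[X] y \<star>[X] z = x \<star>[X] (y \<star>[X] z)"
proof (intro subset_antisym subsetI)
  fix r assume "r \<in> x \<star>[X] y \<star>[X] z"
  then obtain s c p q where *: "c \<in> z" "is_cpath X s" "is_cpath X c" "pter X s = pini c" "cpath_htpy X (pcat X s c) r"
     "p \<in> x" "q \<in> y" "is_cpath X p" "is_cpath X q" "pter X p = pini q" "cpath_htpy X (pcat X p q) s"
    by (auto simp: pm_def)
  have e: "pter X q = pini c" using htpy_ends[OF *(11)] * by simp
  have "cpath_htpy X (pcat X (pcat X p q) c) r"
    using htpy_cong_r[OF *(11), of c] * e by (auto intro: cpath_htpy.trans)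
  then have "cpath_htpy X (pcat X p (pcat X q c)) r" using * e by (simp add: pcat_assoc)
  moreover have "pcat X q c \<in> y \<star>[X] z" using * e by - (rule pmI[where p = q and q = c]; simp_all add: cpath_htpy.refl)
  ultimately show "r \<in> x \<star>[X] (y \<star>[X] z)" using * e by - (rule pmI[where p = p and q = "pcat X q c"]; simp_all add: cpath_htpy.refl)
next
  fix r assume "r \<in> x \<star>[X] (y \<star>[X] z)"
  then obtain s c p q where *: "p \<in> x" "is_cpath X p" "is_cpath X s" "pter X p = pini s" "cpath_htpy X (pcat X p s) r"
     "q \<in> y" "c \<in> z" "is_cpath X q" "is_cpath X c" "pter X q = pini c" "cpath_htpy X (pcat X q c) s"
    by (auto simp: pm_def)
  have e: "pter X p = pini q" using htpy_ends[OF *(11)] * by simp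
  have "cpath_htpy X (pcat X p (pcat X q c)) r"
    using htpy_cong_l[OF *(11), of p] * e by (auto intro: cpath_htpy.trans)
  then have "cpath_htpy X (pcat X (pcat X p q) c) r" using * e by (simp add: pcat_assoc)
  moreover have "pcat X p q \<in> x \<star>[X] y" using * e by - (rule pmI[where p = p and q = q]; simp_all add: cpath_htpy.refl)
  ultimately show "r \<in> x \<star>[X] y \<star>[X] z" using * e by - (rule pmI[where p = "pcat X p q" and q = c]; simp_all add: cpath_htpy.refl)
qed

lemma ar_pm [simp]: "ar X x \<Longrightarrow> ar X y \<Longrightarrow> tgt X x = src y \<Longrightarrow> ar X (x \<star>[X] y)"
  and src_pm [simp]: "ar X x \<Longrightarrow> ar X y \<Longrightarrow> tgt X x = src y \<Longrightarrow> src (x \<star>[X] y) = src x"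
  and tgt_pm [simp]: "ar X x \<Longrightarrow> ar X y \<Longrightarrow> tgt X x = src y \<Longrightarrow> tgt X (x \<star>[X] y) = tgt X y"
proof -
  assume "ar X x" "ar X y" "tgt X x = src y"
  then obtain p q where "x = hclass X p" "y = hclass X q" "is_cpath X p" "is_cpath X q" "pter X p = pini q"
    unfolding ar_def by (metis src_hclass tgt_hclass)
  then show "ar X (x \<star>[X] y)" "src (x \<star>[X] y) = src x" "tgt X (x \<star>[X] y) = tgt X y"
    by (simp_all add: hclass_pcat[symmetric])
qed

lemma src_vert [simp]: "ar X x \<Longrightarrow> src x \<in> vts X"
  and tgt_vert [simp]: "ar X x \<Longrightarrow> tgt X x \<in> vts X"
  by (erule arE, simp)+

lemma lc_ends [simp]:
  assumes "\<sigma> \<in> vts X" "g \<in> Gr X \<sigma>"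
  shows "ar X (lc X \<sigma> g)" "src (lc X \<sigma> g) = \<sigma>" "tgt X (lc X \<sigma> g) = \<sigma>"
  using assms by (auto simp: lc_def)

lemma ed_ends [simp]:
  assumes "a \<in> eds X"
  shows "ar X (ed X a)" "src (ed X a) = org X a" "tgt X (ed X a) = trg X a"
  using assms by (auto simp: ed_def)

lemma bd_ends [simp]:
  assumes "a \<in> eds X"
  shows "ar X (bd X a)" "src (bd X a) = trg X a" "tgt X (bd X a) = org X a"
  using assms by (auto simp: bd_def)

lemma lc_mult: "\<sigma> \<in> vts X \<Longrightarrow> g \<in> Gr X \<sigma> \<Longrightarrow> h \<in> Gr X \<sigma> \<Longrightarrow>
    lc X \<sigma> (g \<odot>[X,\<sigma>] h) = lc X \<sigma> g \<star>[X] lc X \<sigma> h"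
  unfolding lc_def by (subst hclass_pcat[symmetric]) (simp_all add: pconst_def)

lemma lc_one_l [simp]: "ar X x \<Longrightarrow> src x = \<sigma> \<Longrightarrow> lc X \<sigma> (lone X \<sigma>) \<star>[X] x = x"
proof -
  have "ar X x \<Longrightarrow> lc X (src x) (lone X (src x)) \<star>[X] x = x"
    by (erule arE) (simp add: lc_def hclass_pcat[symmetric])
  then show "ar X x \<Longrightarrow> src x = \<sigma> \<Longrightarrow> lc X \<sigma> (lone X \<sigma>) \<star>[X] x = x" by blast
qed

lemma lc_one_r [simp]: "ar X x \<Longrightarrow> tgt X x = \<tau> \<Longrightarrow> x \<star>[X] lc X \<tau> (lone X \<tau>) = x"
proof -
  have "ar X x \<Longrightarrow> x \<star>[X] lc X (tgt X x) (lone X (tgt X x)) = x"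
    by (erule arE) (simp add: lc_def hclass_pcat[symmetric])
  then show "ar X x \<Longrightarrow> tgt X x = \<tau> \<Longrightarrow> x \<star>[X] lc X \<tau> (lone X \<tau>) = x" by blast
qed

text \<open>This and the next three lemmas are the elementary moves with trivial outer factors. The
  moves \<open>slide_bwd\<close> and \<open>compose_bwd\<close> need no counterpart: they follow
  once backward edges are inverse to forward ones.\<close>

lemma lc_ed:
  assumes "a \<in> eds X" "g \<in> Gr X (org X a)"
  shows "lc X (org X a) g \<star>[X] ed X a = ed X a \<star>[X] lc X (trg X a) (psi X a g)"
proof -
  let ?i = "org X a" and ?t = "trg X a"
  have "cpath_htpy X (?i, lone X ?i \<odot>[X,?i] g, [(Fwd a, lone X ?t)]) (?i, lone X ?i, [(Fwd a, psi X a g \<odot>[X,?t] lone X ?t)])"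
    using assms by (intro htpy_move elem_move.intros) auto
  then show ?thesis using assms unfolding lc_def ed_def
    by (simp add: hclass_pcat[symmetric] hclass_eq_iff) (simp add: pconst_def pfwd_def)
qed

lemma ed_bd:
  assumes "a \<in> eds X"
  shows "ed X a \<star>[X] bd X a = lc X (org X a) (lone X (org X a))"
proof -
  let ?i = "org X a" and ?t = "trg X a"
  have "cpath_htpy X (?i, lone X ?i, [(Fwd a, psi X a (lone X ?i)), (Bwd a, lone X ?i)])
          (?i, lone X ?i \<odot>[X,?i] lone X ?i \<odot>[X,?i] lone X ?i, [])"
    using assms by (intro htpy_move elem_move.intros) auto
  then show ?thesis using assms unfolding lc_def ed_def bd_def
    by (simp add: hclass_pcat[symmetric] hclass_eq_iff) (simp add: pconst_def pfwd_def pbwd_def)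
qed

lemma bd_ed:
  assumes "a \<in> eds X"
  shows "bd X a \<star>[X] ed X a = lc X (trg X a) (lone X (trg X a))"
proof -
  let ?i = "org X a" and ?t = "trg X a"
  have "cpath_htpy X (?t, lone X ?t, [(Bwd a, lone X ?i), (Fwd a, lone X ?t)])
          (?t, lone X ?t \<odot>[X,?t] psi X a (lone X ?i) \<odot>[X,?t] lone X ?t, [])"
    using assms by (intro htpy_move elem_move.intros) auto
  then show ?thesis using assms unfolding lc_def ed_def bd_def
    by (simp add: hclass_pcat[symmetric] hclass_eq_iff) (simp add: pconst_def pfwd_def pbwd_def)
qed

lemma ed_ed:
  assumes "a \<in> eds X" "b \<in> eds X" "org X a = trg X b"
  shows "ed X b \<star>[X] ed X a = ed X (cpo X a b) \<star>[X]
     lc X (trg X a) (linv X (trg X a) (twist X a b))"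
proof -
  let ?i = "org X b" and ?r = "trg X b" and ?t = "trg X a"
  have "cpath_htpy X (?i, lone X ?i, [(Fwd b, lone X ?r), (Fwd a, lone X ?t)])
          (?i, lone X ?i, [(Fwd (cpo X a b), linv X ?t (twist X a b) \<odot>[X,?t] lone X ?t)])"
    using assms by (intro htpy_move elem_move.intros) auto
  then show ?thesis using assms unfolding lc_def ed_def bd_def
    by (simp add: hclass_pcat[symmetric] hclass_eq_iff ini_cmp ter_cmp cmp_closed twist_closed)
      (simp add: pconst_def pfwd_def pbwd_def ini_cmp ter_cmp cmp_closed twist_closed)
qed

definition eo :: "'e oedge \<Rightarrow> ('v, 'e, 'g) cpath set" where
  "eo e = (case e of Fwd a \<Rightarrow> ed X a | Bwd a \<Rightarrow> bd X a)"

text \<open>Peeling off the first edge exhibits every class as a product of the generators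
  \<open>lc\<close>, \<open>ed\<close> and \<open>bd\<close>.\<close>

lemma hclass_Cons:
  assumes "is_cpath X (\<sigma>, g, (e, h) # s)"
  shows "hclass X (\<sigma>, g, (e, h) # s) = lc X \<sigma> g \<star>[X] (eo e \<star>[X] hclass X (oter (shape X) e, h, s))"
proof (cases e)
  case (Fwd a)
  have "(\<sigma>, g, (e, h) # s) = pcat X (pconst \<sigma> g) (pcat X (pfwd X a) (oter (shape X) e, h, s))"
    using assms Fwd by (cases s) (auto simp: pconst_def pfwd_def)
  then have "hclass X (\<sigma>, g, (e, h) # s) = hclass X (pcat X (pconst \<sigma> g) (pcat X (pfwd X a) (oter (shape X) e, h, s)))"
    by (rule arg_cong)
  also have "\<dots> = hclass X (pconst \<sigma> g) \<star>[X] (hclass X (pfwd X a) \<star>[X] hclass X (oter (shape X) e, h, s))"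
    using assms Fwd by (subst hclass_pcat, auto simp: hclass_pcat)
  finally show ?thesis using Fwd by (simp add: lc_def eo_def ed_def)
next
  case (Bwd a)
  have "(\<sigma>, g, (e, h) # s) = pcat X (pconst \<sigma> g) (pcat X (pbwd X a) (oter (shape X) e, h, s))"
    using assms Bwd by (cases s) (auto simp: pconst_def pbwd_def)
  then have "hclass X (\<sigma>, g, (e, h) # s) = hclass X (pcat X (pconst \<sigma> g) (pcat X (pbwd X a) (oter (shape X) e, h, s)))"
    by (rule arg_cong)
  also have "\<dots> = hclass X (pconst \<sigma> g) \<star>[X] (hclass X (pbwd X a) \<star>[X] hclass X (oter (shape X) e, h, s))"
    using assms Bwd by (subst hclass_pcat, auto simp: hclass_pcat)
  finally show ?thesis using Bwd by (simp add: lc_def eo_def bd_def)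
qed

text \<open>Arrows are products of generators, so a property closed under composition need only be
  checked on local elements and on edges in both directions. Later arguments about arrows use this
  instead of lists of oriented edges.\<close>

lemma arr_induct [consumes 1, case_names lc ed bd mult]:
  assumes "ar X x"
    and lc: "\<And>\<sigma> g. \<sigma> \<in> vts X \<Longrightarrow> g \<in> Gr X \<sigma> \<Longrightarrow> P (lc X \<sigma> g)"
    and ed: "\<And>a. a \<in> eds X \<Longrightarrow> P (ed X a)"
    and bd: "\<And>a. a \<in> eds X \<Longrightarrow> P (bd X a)"
    and mult: "\<And>x y. ar X x \<Longrightarrow> ar X y \<Longrightarrow> tgt X x = src y \<Longrightarrow> P x \<Longrightarrow> P y \<Longrightarrow> P (x \<star>[X] y)"
  shows "P x"
proof -
  have "is_cpath X (\<sigma>, g, s) \<Longrightarrow> P (hclass X (\<sigma>, g, s))" for \<sigma> g s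
  proof (induction s arbitrary: \<sigma> g)
    case Nil
    then show ?case using lc[of \<sigma> g] by (simp add: lc_def pconst_def)
  next
    case (Cons z s)
    obtain e h where z: "z = (e, h)" by (cases z)
    have P: "P (hclass X (oter (shape X) e, h, s))" using Cons z by simp
    have Q: "P (eo e) \<and> ar X (eo e) \<and> src (eo e) = \<sigma> \<and> tgt X (eo e) = oter (shape X) e"
      using Cons.prems z ed bd by (cases e) (auto simp: eo_def)
    have "P (lc X \<sigma> g)" using lc Cons.prems z by (auto intro: oini_vert)
    then show ?case using P Q Cons.prems unfolding z
      by (subst hclass_Cons) (auto intro!: mult simp: oini_vert)
  qed
  then show ?thesis using assms(1) unfolding ar_def by (metis prod.exhaust)
qed

text \<open>The generators are invertible, and the inverses of two composable arrows multiply in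
  reverse order.\<close>

lemma iv_ex:
  "ar X x \<Longrightarrow> \<exists>y. ar X y \<and> src y = tgt X x \<and> tgt X y = src x \<and>
     x \<star>[X] y = lc X (src x) (lone X (src x)) \<and> y \<star>[X] x = lc X (tgt X x) (lone X (tgt X x))"
proof (induction rule: arr_induct)
  case (lc \<sigma> g)
  then show ?case by (intro exI[of _ "lc X \<sigma> (linv X \<sigma> g)"]) (simp add: lc_mult[symmetric])
next
  case (ed a)
  then show ?case by (intro exI[of _ "bd X a"]) (simp add: ed_bd bd_ed)
next
  case (bd a)
  then show ?case by (intro exI[of _ "ed X a"]) (simp add: ed_bd bd_ed)
next
  case (mult x y)
  then obtain x' y' where x': "ar X x'" "src x' = tgt X x" "tgt X x' = src x"
     "x \<star>[X] x' = lc X (src x) (lone X (src x))" "x' \<star>[X] x = lc X (tgt X x) (lone X (tgt X x))"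
   and y': "ar X y'" "src y' = tgt X y" "tgt X y' = src y"
     "y \<star>[X] y' = lc X (src y) (lone X (src y))" "y' \<star>[X] y = lc X (tgt X y) (lone X (tgt X y))"
    by blast
  have "x \<star>[X] y \<star>[X] (y' \<star>[X] x') = x \<star>[X] (y \<star>[X] y' \<star>[X] x')" by (simp only: pm_assoc)
  moreover have "y' \<star>[X] x' \<star>[X] (x \<star>[X] y) = y' \<star>[X] (x' \<star>[X] x \<star>[X] y)" by (simp only: pm_assoc)
  ultimately show ?case using mult x' y'
    by (intro exI[of _ "y' \<star>[X] x'"]) (simp del: pm_assoc)
qed

lemma iv_simps [simp]:
  assumes "ar X x"
  shows "ar X (iv X x)" "src (iv X x) = tgt X x" "tgt X (iv X x) = src x"
    "x \<star>[X] iv X x = lc X (src x) (lone X (src x))" "iv X x \<star>[X] x = lc X (tgt X x) (lone X (tgt X x))"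
  using someI_ex[OF iv_ex[OF assms]] unfolding iv_def by blast+

lemma iv_cancel [simp]:
  assumes "ar X x" "ar X y"
  shows "tgt X x = src y \<Longrightarrow> iv X x \<star>[X] (x \<star>[X] y) = y"
    "src x = src y \<Longrightarrow> x \<star>[X] (iv X x \<star>[X] y) = y"
  using assms by (simp_all add: pm_assoc[symmetric])

text \<open>A right inverse is already the inverse: multiply by \<open>iv X x\<close> on the
  left.\<close>

lemma iv_unique:
  assumes "ar X x" "ar X y" "tgt X x = src y" "x \<star>[X] y = lc X (src x) (lone X (src x))"
  shows "y = iv X x"
proof -
  have "tgt X y = src x" using assms by (metis tgt_pm lc_ends(3) l_one_closed src_vert)
  have "y = iv X x \<star>[X] (x \<star>[X] y)" by (rule iv_cancel(1)[OF assms(1-3), symmetric])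
  then show ?thesis unfolding assms(4) using assms(1) by simp
qed

lemma pm_left_cancel:
  assumes "ar X x" "ar X y" "ar X z" "tgt X x = src y" "src z = src y" "x \<star>[X] y = x \<star>[X] z"
  shows "y = z"
  using assms by (metis iv_cancel(1))

lemma pm_right_cancel:
  assumes "ar X x" "ar X y" "ar X z" "src x = tgt X y" "tgt X z = tgt X y" "y \<star>[X] x = z \<star>[X] x"
  shows "y = z"
proof -
  have "w = w \<star>[X] x \<star>[X] iv X x" if "ar X w" "src x = tgt X w" for w
    using assms(1) that by (simp add: pm_assoc)
  then show ?thesis using assms by metis
qed

lemma iv_ed: "a \<in> eds X \<Longrightarrow> iv X (ed X a) = bd X a"
  by (rule iv_unique[symmetric]) (simp_all add: ed_bd)

lemma iv_iv [simp]: "ar X x \<Longrightarrow> iv X (iv X x) = x"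
  by (rule iv_unique[symmetric]) simp_all

end

section \<open>Evaluating homotopy classes through generators and relations\<close>

text \<open>A presentation of the groupoid of paths. The target is only assumed to be associative;
  instead of a unit there are the images of the local identities, which by \<open>fw_one\<close> and
  \<open>bw_one\<close> act as units next to an edge. Only relations for forward edges and for
  mutual inverseness are required, which keeps the two later instantiations short.\<close>

locale path_valuation = complex_of_groups X for X :: "('v, 'e, 'g) cog" +
  fixes m :: "'m \<Rightarrow> 'm \<Rightarrow> 'm" (infixl "\<bullet>" 70)
    and v :: "'v \<Rightarrow> 'g \<Rightarrow> 'm" and fw bw :: "'e \<Rightarrow> 'm"
  assumes m_assoc: "x \<bullet> y \<bullet> z = x \<bullet> (y \<bullet> z)"
    and v_mult: "\<sigma> \<in> vts X \<Longrightarrow> g \<in> Gr X \<sigma> \<Longrightarrow> h \<in> Gr X \<sigma> \<Longrightarrow> v \<sigma> (g \<odot>[X,\<sigma>] h) = v \<sigma> g \<bullet> v \<sigma> h"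
    and v_fw: "a \<in> eds X \<Longrightarrow> g \<in> Gr X (org X a) \<Longrightarrow>
       v (org X a) g \<bullet> fw a = fw a \<bullet> v (trg X a) (psi X a g)"
    and fw_one: "a \<in> eds X \<Longrightarrow> fw a \<bullet> v (trg X a) (lone X (trg X a)) = fw a"
    and bw_one: "a \<in> eds X \<Longrightarrow> bw a \<bullet> v (org X a) (lone X (org X a)) = bw a"
    and fw_bw: "a \<in> eds X \<Longrightarrow> fw a \<bullet> bw a = v (org X a) (lone X (org X a))"
    and bw_fw: "a \<in> eds X \<Longrightarrow> bw a \<bullet> fw a = v (trg X a) (lone X (trg X a))"
    and fw_fw: "a \<in> eds X \<Longrightarrow> b \<in> eds X \<Longrightarrow> org X a = trg X b \<Longrightarrow>
       fw b \<bullet> fw a = fw (cpo X a b) \<bullet> v (trg X a) (linv X (trg X a) (twist X a b))"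
begin

fun ev :: "('v, 'e, 'g) cpath \<Rightarrow> 'm" where
  "ev (\<sigma>, g, []) = v \<sigma> g"
| "ev (\<sigma>, g, (e, h) # s) = v \<sigma> g \<bullet> ((case e of Fwd a \<Rightarrow> fw a | Bwd a \<Rightarrow> bw a) \<bullet> ev (oter (shape X) e, h, s))"

lemma v_one: "\<sigma> \<in> vts X \<Longrightarrow> g \<in> Gr X \<sigma> \<Longrightarrow> v \<sigma> g \<bullet> v \<sigma> (lone X \<sigma>) = v \<sigma> g"
  by (simp add: v_mult[symmetric])

lemma ev_pcat:
  assumes "is_cpath X p" "is_cpath X q" "pter X p = pini q"
  shows "ev (pcat X p q) = ev p \<bullet> ev q"
proof -
  obtain \<tau> h r where q: "q = (\<tau>, h, r)" by (cases q)
  have "is_cpath X (\<sigma>, g, s) \<Longrightarrow> pter X (\<sigma>, g, s) = \<tau> \<Longrightarrow>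
      ev (pcat X (\<sigma>, g, s) q) = ev (\<sigma>, g, s) \<bullet> ev q" for \<sigma> g s
  proof (induction s arbitrary: \<sigma> g)
    case Nil
    then show ?case using assms(2) unfolding q
      by (cases r) (auto simp: v_mult m_assoc)
  next
    case (Cons x s)
    obtain e k where x: "x = (e, k)" by (cases x)
    obtain g' s' where eq: "pcat X (oter (shape X) e, k, s) q = (oter (shape X) e, g', s')"
      by (metis pini.simps pini_pcat prod.exhaust)
    show ?case using Cons.IH[of "oter (shape X) e" k] Cons.prems unfolding x
      by (simp add: eq m_assoc del: pcat.simps add: pcat_Cons)
  qed
  then show ?thesis using assms q by (cases p) auto
qed

text \<open>Append the trivial factor \<open>fw a \<bullet> bw a\<close> on the right, slide
  \<open>h\<close> through \<open>fw a\<close>, and cancel \<open>bw a \<bullet> fw a\<close> on the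
  left.\<close>

lemma bw_v: "a \<in> eds X \<Longrightarrow> h \<in> Gr X (org X a) \<Longrightarrow>
    bw a \<bullet> v (org X a) h = v (trg X a) (psi X a h) \<bullet> bw a"
proof -
  assume a: "a \<in> eds X" "h \<in> Gr X (org X a)"
  have "bw a \<bullet> v (org X a) h = bw a \<bullet> (v (org X a) h \<bullet> v (org X a) (lone X (org X a)))"
    using a by (simp add: v_one)
  also have "\<dots> = bw a \<bullet> (v (org X a) h \<bullet> fw a) \<bullet> bw a"
    using a by (simp add: fw_bw[symmetric] m_assoc)
  also have "\<dots> = bw a \<bullet> fw a \<bullet> v (trg X a) (psi X a h) \<bullet> bw a"
    using a by (simp add: v_fw m_assoc)
  also have "\<dots> = v (trg X a) (psi X a h) \<bullet> bw a"
    using a by (simp add: bw_fw v_mult[symmetric])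
  finally show ?thesis .
qed

lemma v_one_bw: "a \<in> eds X \<Longrightarrow> v (trg X a) (lone X (trg X a)) \<bullet> bw a = bw a"
  using bw_v[of a "lone X (org X a)"] bw_one[of a] by simp

lemma v_one_fw: "a \<in> eds X \<Longrightarrow> v (org X a) (lone X (org X a)) \<bullet> fw a = fw a"
  using v_fw[of a "lone X (org X a)"] by (simp add: fw_one)

text \<open>This is the inverse of \<open>fw_fw\<close>. With \<open>c\<close> the composite edge,
  append \<open>fw c \<bullet> bw c\<close>, expand \<open>fw c\<close> as
  \<open>fw b \<bullet> fw a\<close> times the twist, and cancel from the inside.\<close>

lemma bw_bw:
  assumes "a \<in> eds X" "b \<in> eds X" "org X a = trg X b"
  shows "bw a \<bullet> bw b = v (trg X a) (twist X a b) \<bullet> bw (cpo X a b)"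
proof -
  let ?t = "trg X a" and ?c = "cpo X a b"
  have c: "?c \<in> eds X" "org X ?c = org X b" "trg X ?c = ?t" "twist X a b \<in> Gr X ?t"
    using assms by (simp_all add: cmp_closed ini_cmp ter_cmp twist_closed)
  have f: "fw ?c = fw b \<bullet> fw a \<bullet> v ?t (twist X a b)"
    using assms c fw_one[of ?c] by (simp add: fw_fw m_assoc v_mult[symmetric])
  have "bw a \<bullet> bw b = bw a \<bullet> (bw b \<bullet> (fw ?c \<bullet> bw ?c))"
    using c assms bw_one[of b] by (simp add: fw_bw)
  also have "\<dots> = bw a \<bullet> (bw b \<bullet> fw b \<bullet> fw a) \<bullet> v ?t (twist X a b) \<bullet> bw ?c"
    unfolding f by (simp add: m_assoc)
  also have "bw b \<bullet> fw b \<bullet> fw a = fw a"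
    using assms v_one_fw[of a] by (simp add: bw_fw)
  also have "bw a \<bullet> fw a \<bullet> v ?t (twist X a b) \<bullet> bw ?c = v ?t (twist X a b) \<bullet> bw ?c"
    using assms c by (simp add: bw_fw v_mult[symmetric])
  finally show ?thesis .
qed

lemma ev_elem_move: "elem_move X s s' \<Longrightarrow> ev s = ev s'"
proof (induction rule: elem_move.induct)
  case (slide_fwd a \<sigma> \<tau> k g h)
  then show ?case by (simp add: v_mult m_assoc) (simp add: v_fw flip: m_assoc)
next
  case (slide_bwd a \<sigma> \<tau> g h k)
  then have "bw a \<bullet> (v \<sigma> h \<bullet> v \<sigma> k) = v \<tau> (psi X a h) \<bullet> (bw a \<bullet> v \<sigma> k)"
    by (metis m_assoc bw_v)
  then show ?case using slide_bwd by (simp add: v_mult m_assoc)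
next
  case (cancel_fwd_bwd a \<sigma> g h k)
  have "fw a \<bullet> (v (trg X a) (psi X a h) \<bullet> (bw a \<bullet> v \<sigma> k)) = v \<sigma> h \<bullet> (fw a \<bullet> bw a) \<bullet> v \<sigma> k"
    using cancel_fwd_bwd v_fw[of a h] by (simp add: m_assoc[symmetric])
  then show ?case using cancel_fwd_bwd by (simp add: fw_bw v_mult[symmetric] l_assoc)
next
  case (cancel_bwd_fwd b \<sigma> \<tau> g h k)
  have "bw b \<bullet> (v \<sigma> h \<bullet> (fw b \<bullet> v \<tau> k)) = (bw b \<bullet> fw b) \<bullet> (v \<tau> (psi X b h) \<bullet> v \<tau> k)"
    using cancel_bwd_fwd v_fw[of b h] by (metis m_assoc)
  then show ?case using cancel_bwd_fwd by (simp add: bw_fw v_mult[symmetric] l_assoc)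
next
  case (compose_fwd a b \<sigma> \<rho> \<tau> g k)
  have "fw b \<bullet> (v \<rho> (lone X \<rho>) \<bullet> (fw a \<bullet> v \<tau> k)) = fw b \<bullet> fw a \<bullet> v \<tau> k"
    using compose_fwd fw_one[of b] by (metis m_assoc)
  then show ?case using compose_fwd by (simp add: fw_fw m_assoc v_mult twist_closed ter_cmp)
next
  case (compose_bwd a b \<sigma> \<rho> \<tau> g k)
  have "bw a \<bullet> (v \<rho> (lone X \<rho>) \<bullet> (bw b \<bullet> v \<sigma> k)) = bw a \<bullet> bw b \<bullet> v \<sigma> k"
    using compose_bwd v_one_bw[of b] by (metis m_assoc)
  then show ?case using compose_bwd by (simp add: bw_bw m_assoc v_mult twist_closed ini_cmp)
qed

lemma ev_htpy: "cpath_htpy X p q \<Longrightarrow> ev p = ev q"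
proof (induction rule: cpath_htpy.induct)
  case (replace s s' p q)
  then show ?case using elem_move_ends[OF replace(1)] ev_elem_move[OF replace(1)]
    by (simp add: ev_pcat)
qed simp_all

definition evc :: "('v, 'e, 'g) cpath set \<Rightarrow> 'm" where
  "evc x = ev (SOME p. p \<in> x)"

lemma evc_hclass: "is_cpath X p \<Longrightarrow> evc (hclass X p) = ev p"
  unfolding evc_def using ev_htpy[OF some_rep] by simp

lemma evc_lc: "\<sigma> \<in> vts X \<Longrightarrow> g \<in> Gr X \<sigma> \<Longrightarrow> evc (lc X \<sigma> g) = v \<sigma> g"
  unfolding lc_def by (simp add: evc_hclass) (simp add: pconst_def)

lemma evc_ed: "a \<in> eds X \<Longrightarrow> evc (ed X a) = fw a"
  unfolding ed_def by (simp add: evc_hclass) (simp add: pfwd_def fw_one v_one_fw)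

lemma evc_bd: "a \<in> eds X \<Longrightarrow> evc (bd X a) = bw a"
  unfolding bd_def by (simp add: evc_hclass) (simp add: pbwd_def bw_one v_one_bw)

lemma evc_pm: "ar X x \<Longrightarrow> ar X y \<Longrightarrow> tgt X x = src y \<Longrightarrow> evc (x \<star>[X] y) = evc x \<bullet> evc y"
  by (elim arE) (simp add: hclass_pcat[symmetric] evc_hclass ev_pcat)

end

section \<open>The functor induced by a morphism\<close>

locale cog_pair = X: complex_of_groups X + Y: complex_of_groups Y
  for X :: "('v, 'e, 'g) cog" and Y :: "('w, 'd, 'h) cog"
begin

lemma mor_simps [simp]:
  assumes "cog_morphism X Y \<phi>"
  shows "\<sigma> \<in> vts X \<Longrightarrow> mV \<phi> \<sigma> \<in> vts Y"
    and "a \<in> eds X \<Longrightarrow> mE \<phi> a \<in> eds Y"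
    and "a \<in> eds X \<Longrightarrow> org Y (mE \<phi> a) = mV \<phi> (org X a)"
    and "a \<in> eds X \<Longrightarrow> trg Y (mE \<phi> a) = mV \<phi> (trg X a)"
    and "\<sigma> \<in> vts X \<Longrightarrow> g \<in> Gr X \<sigma> \<Longrightarrow> mG \<phi> \<sigma> g \<in> Gr Y (mV \<phi> \<sigma>)"
    and "a \<in> eds X \<Longrightarrow> mA \<phi> a \<in> Gr Y (mV \<phi> (trg X a))"
  using assms unfolding cog_morphism_def scwol_morphism_def hom_def by auto

lemma mE_cmp: "cog_morphism X Y \<phi> \<Longrightarrow> a \<in> eds X \<Longrightarrow> b \<in> eds X \<Longrightarrow>
    org X a = trg X b \<Longrightarrow> mE \<phi> (cpo X a b) = cpo Y (mE \<phi> a) (mE \<phi> b)"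
  unfolding cog_morphism_def scwol_morphism_def by blast

lemma mE_bij: "cog_morphism X Y \<phi> \<Longrightarrow> \<sigma> \<in> vts X \<Longrightarrow>
    bij_betw (mE \<phi>) {a \<in> eds X. org X a = \<sigma>} {b \<in> eds Y. org Y b = mV \<phi> \<sigma>}"
  unfolding cog_morphism_def scwol_morphism_def by blast

lemma mG_hom: "cog_morphism X Y \<phi> \<Longrightarrow> \<sigma> \<in> vts X \<Longrightarrow> mG \<phi> \<sigma> \<in> hom (grp X \<sigma>) (grp Y (mV \<phi> \<sigma>))"
  unfolding cog_morphism_def by blast

lemma mG_mult: "cog_morphism X Y \<phi> \<Longrightarrow> \<sigma> \<in> vts X \<Longrightarrow> g \<in> Gr X \<sigma> \<Longrightarrow> h \<in> Gr X \<sigma> \<Longrightarrow>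
    mG \<phi> \<sigma> (g \<odot>[X,\<sigma>] h) = mG \<phi> \<sigma> g \<odot>[Y,mV \<phi> \<sigma>] mG \<phi> \<sigma> h"
  using mG_hom[of \<phi> \<sigma>] by (simp add: hom_def)

lemma mG_one [simp]: "cog_morphism X Y \<phi> \<Longrightarrow> \<sigma> \<in> vts X \<Longrightarrow>
    mG \<phi> \<sigma> (lone X \<sigma>) = lone Y (mV \<phi> \<sigma>)"
  by (rule hom_one[OF mG_hom]) (simp_all add: X.local_group Y.local_group)

lemma mG_inv: "cog_morphism X Y \<phi> \<Longrightarrow> \<sigma> \<in> vts X \<Longrightarrow> g \<in> Gr X \<sigma> \<Longrightarrow>
    mG \<phi> \<sigma> (linv X \<sigma> g) = linv Y (mV \<phi> \<sigma>) (mG \<phi> \<sigma> g)"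
  using X.local_group[of \<sigma>] Y.local_group[of "mV \<phi> \<sigma>"] mG_hom[of \<phi> \<sigma>]
  by (simp add: group_hom.hom_inv[OF group_hom.intro[OF _ _ group_hom_axioms.intro]])

lemma mA_psi:
  assumes "cog_morphism X Y \<phi>" "a \<in> eds X" "g \<in> Gr X (org X a)"
  shows "mA \<phi> a \<odot>[Y,mV \<phi> (trg X a)] psi Y (mE \<phi> a) (mG \<phi> (org X a) g) =
         mG \<phi> (trg X a) (psi X a g) \<odot>[Y,mV \<phi> (trg X a)] mA \<phi> a"
proof -
  let ?t = "trg X a" and ?z = "psi Y (mE \<phi> a) (mG \<phi> (org X a) g)"
  have z: "?z \<in> Gr Y (mV \<phi> ?t)" using Y.psi_closed[of "mE \<phi> a"] assms by simp
  have "conj_by (grp Y (mV \<phi> ?t)) (mA \<phi> a) ?z = mG \<phi> ?t (psi X a g)"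
    using assms unfolding cog_morphism_def by blast
  then have "mG \<phi> ?t (psi X a g) \<odot>[Y,mV \<phi> ?t] mA \<phi> a =
     mA \<phi> a \<odot>[Y,mV \<phi> ?t] ?z \<odot>[Y,mV \<phi> ?t] linv Y (mV \<phi> ?t) (mA \<phi> a) \<odot>[Y,mV \<phi> ?t] mA \<phi> a"
    by (simp add: conj_by_def)
  then show ?thesis using assms z by (simp add: Y.l_assoc)
qed

lemma mA_twist:
  assumes "cog_morphism X Y \<phi>" "a \<in> eds X" "b \<in> eds X" "org X a = trg X b"
  shows "mG \<phi> (trg X a) (twist X a b) \<odot>[Y,mV \<phi> (trg X a)] mA \<phi> (cpo X a b)
     = mA \<phi> a \<odot>[Y,mV \<phi> (trg X a)] psi Y (mE \<phi> a) (mA \<phi> b)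
         \<odot>[Y,mV \<phi> (trg X a)] twist Y (mE \<phi> a) (mE \<phi> b)"
  using assms unfolding cog_morphism_def Let_def by blast

text \<open>Developability enters through this injectivity: an equation between classes of constant
  paths is an equation in the local group.\<close>

lemma lc_inj: "developable Y \<Longrightarrow> \<tau> \<in> vts Y \<Longrightarrow> g \<in> Gr Y \<tau> \<Longrightarrow> h \<in> Gr Y \<tau> \<Longrightarrow>
    lc Y \<tau> g = lc Y \<tau> h \<Longrightarrow> g = h"
  unfolding developable_def lc_def by (auto dest: inj_onD)

text \<open>Comparing \<open>F\<close> on the relations of the groupoid of \<open>X\<close> gives the axioms of a morphism up to
  homotopy, and developability turns these into equalities in the local groups.\<close>

lemma morphismI:
  assumes dev: "developable Y"
    and f: "scwol_morphism (shape X) (shape Y) (mV \<phi>) (mE \<phi>)"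
    and mult: "\<And>x y. ar X x \<Longrightarrow> ar X y \<Longrightarrow> tgt X x = src y \<Longrightarrow> F (x \<star>[X] y) = F x \<star>[Y] F y"
    and G: "\<And>\<sigma> g. \<sigma> \<in> vts X \<Longrightarrow> g \<in> Gr X \<sigma> \<Longrightarrow> mG \<phi> \<sigma> g \<in> Gr Y (mV \<phi> \<sigma>)"
    and F_lc: "\<And>\<sigma> g. \<sigma> \<in> vts X \<Longrightarrow> g \<in> Gr X \<sigma> \<Longrightarrow> F (lc X \<sigma> g) = lc Y (mV \<phi> \<sigma>) (mG \<phi> \<sigma> g)"
    and A: "\<And>a. a \<in> eds X \<Longrightarrow> mA \<phi> a \<in> Gr Y (mV \<phi> (trg X a))"
    and F_ed: "\<And>a. a \<in> eds X \<Longrightarrow> F (ed X a) =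
       ed Y (mE \<phi> a) \<star>[Y] lc Y (mV \<phi> (trg X a)) (linv Y (mV \<phi> (trg X a)) (mA \<phi> a))"
  shows "cog_morphism X Y \<phi>"
proof -
  have V: "\<sigma> \<in> vts X \<Longrightarrow> mV \<phi> \<sigma> \<in> vts Y" for \<sigma>
    using f unfolding scwol_morphism_def by blast
  have E: "mE \<phi> a \<in> eds Y" "org Y (mE \<phi> a) = mV \<phi> (org X a)"
    "trg Y (mE \<phi> a) = mV \<phi> (trg X a)" if "a \<in> eds X" for a
    using f that unfolding scwol_morphism_def by blast+
  have E2: "mE \<phi> (cpo X a b) = cpo Y (mE \<phi> a) (mE \<phi> b)"
    if "a \<in> eds X" "b \<in> eds X" "org X a = trg X b" for a b
    using f that unfolding scwol_morphism_def by blast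
  have ps: "psi Y (mE \<phi> a) g \<in> Gr Y (mV \<phi> (trg X a))"
    if "a \<in> eds X" "g \<in> Gr Y (mV \<phi> (org X a))" for a g
    using Y.psi_closed[of "mE \<phi> a" g] E that by simp
  have le: "lc Y (mV \<phi> (org X a)) g \<star>[Y] ed Y (mE \<phi> a) =
      ed Y (mE \<phi> a) \<star>[Y] lc Y (mV \<phi> (trg X a)) (psi Y (mE \<phi> a) g)"
    if "a \<in> eds X" "g \<in> Gr Y (mV \<phi> (org X a))" for a g
    using Y.lc_ed[of "mE \<phi> a" g] E that by simp
  have m: "mG \<phi> \<sigma> (g \<odot>[X,\<sigma>] h) = mG \<phi> \<sigma> g \<odot>[Y,mV \<phi> \<sigma>] mG \<phi> \<sigma> h"
    if "\<sigma> \<in> vts X" "g \<in> Gr X \<sigma>" "h \<in> Gr X \<sigma>" for \<sigma> g h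
  proof -
    have "lc Y (mV \<phi> \<sigma>) (mG \<phi> \<sigma> (g \<odot>[X,\<sigma>] h)) = F (lc X \<sigma> g \<star>[X] lc X \<sigma> h)"
      using that by (simp add: F_lc X.lc_mult[symmetric])
    also have "\<dots> = lc Y (mV \<phi> \<sigma>) (mG \<phi> \<sigma> g \<odot>[Y,mV \<phi> \<sigma>] mG \<phi> \<sigma> h)"
      using that by (simp add: F_lc mult Y.lc_mult G V)
    finally show ?thesis by (rule lc_inj[OF dev, rotated -1]) (simp_all add: that G V)
  qed
  then have hom: "mG \<phi> \<sigma> \<in> hom (grp X \<sigma>) (grp Y (mV \<phi> \<sigma>))" if "\<sigma> \<in> vts X" for \<sigma>
    using that G by (auto simp: hom_def)
  have c: "conj_by (grp Y (mV \<phi> (trg X a))) (mA \<phi> a) (psi Y (mE \<phi> a) (mG \<phi> (org X a) g))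
          = mG \<phi> (trg X a) (psi X a g)"
    if a: "a \<in> eds X" and g: "g \<in> Gr X (org X a)" for a g
  proof -
    let ?i = "org X a" and ?t = "trg X a"
    let ?A = "mA \<phi> a" and ?H = "grp Y (mV \<phi> (trg X a))"
    let ?z = "psi Y (mE \<phi> a) (mG \<phi> ?i g)" and ?w = "mG \<phi> ?t (psi X a g)"
    interpret H: group ?H using Y.local_group V a by simp
    note cl = ps[OF a G[OF _ g]] A[OF a] G[of ?t "psi X a g"]
    \<comment> \<open>Both ends of this chain are values of \<open>F\<close> on the slide relation
      of \<open>lc_ed\<close>; cancelling the common edge leaves an equation between local elements,
      which is the conjugation axiom solved for \<open>?z\<close>.\<close>
    have "ed Y (mE \<phi> a) \<star>[Y] lc Y (mV \<phi> ?t) (?z \<otimes>\<^bsub>?H\<^esub> inv\<^bsub>?H\<^esub> ?A) = F (lc X ?i g \<star>[X] ed X a)"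
      using a g cl by (simp add: mult F_lc F_ed Y.lc_mult V G)
        (simp add: le[OF a G[OF _ g]] flip: Y.pm_assoc)
    also have "\<dots> = ed Y (mE \<phi> a) \<star>[Y] lc Y (mV \<phi> ?t) (inv\<^bsub>?H\<^esub> ?A \<otimes>\<^bsub>?H\<^esub> ?w)"
      using a g cl by (simp add: X.lc_ed mult F_lc F_ed Y.lc_mult V G Y.pm_assoc)
    finally have "lc Y (mV \<phi> ?t) (?z \<otimes>\<^bsub>?H\<^esub> inv\<^bsub>?H\<^esub> ?A) = lc Y (mV \<phi> ?t) (inv\<^bsub>?H\<^esub> ?A \<otimes>\<^bsub>?H\<^esub> ?w)"
      by (rule Y.pm_left_cancel[rotated -1]) (use a g cl E V in simp_all)
    then have "?z \<otimes>\<^bsub>?H\<^esub> inv\<^bsub>?H\<^esub> ?A = inv\<^bsub>?H\<^esub> ?A \<otimes>\<^bsub>?H\<^esub> ?w"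
      by (rule lc_inj[OF dev, rotated -1]) (use a g cl E V in simp_all)
    then have "?A \<otimes>\<^bsub>?H\<^esub> (?z \<otimes>\<^bsub>?H\<^esub> inv\<^bsub>?H\<^esub> ?A) = ?A \<otimes>\<^bsub>?H\<^esub> (inv\<^bsub>?H\<^esub> ?A \<otimes>\<^bsub>?H\<^esub> ?w)"
      by (rule arg_cong)
    also have "\<dots> = ?w"
      using cl a g by (simp add: H.m_assoc[symmetric])
    finally show ?thesis using cl a g by (simp add: conj_by_def H.m_assoc)
  qed
  have t: "mG \<phi> (trg X a) (twist X a b) \<odot>[Y,mV \<phi> (trg X a)] mA \<phi> (cpo X a b)
     = mA \<phi> a \<odot>[Y,mV \<phi> (trg X a)] psi Y (mE \<phi> a) (mA \<phi> b)
         \<odot>[Y,mV \<phi> (trg X a)] twist Y (mE \<phi> a) (mE \<phi> b)"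
    if a: "a \<in> eds X" and b: "b \<in> eds X" and ab: "org X a = trg X b" for a b
  proof -
    let ?i = "org X b" and ?r = "trg X b" and ?t = "trg X a" and ?c = "cpo X a b"
    let ?H = "grp Y (mV \<phi> (trg X a))"
    let ?g = "twist X a b" and ?g' = "twist Y (mE \<phi> a) (mE \<phi> b)"
    interpret H: group ?H using Y.local_group V a by simp
    have c: "?c \<in> eds X" "org X ?c = ?i" "trg X ?c = ?t" "?g \<in> Gr X ?t"
      using a b ab by (simp_all add: X.cmp_closed X.ini_cmp X.ter_cmp X.twist_closed)
    have g': "?g' \<in> Gr Y (mV \<phi> ?t)" using Y.twist_closed[of "mE \<phi> a" "mE \<phi> b"] a b ab E by simp
    have q: "psi Y (mE \<phi> a) (linv Y (mV \<phi> ?r) (mA \<phi> b)) = inv\<^bsub>?H\<^esub> (psi Y (mE \<phi> a) (mA \<phi> b))"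
      using Y.psi_inv[OF E(1)[OF a], of "mA \<phi> b"] E a b ab A[OF b] by simp
    have hi: "mG \<phi> ?t (linv X ?t ?g) = inv\<^bsub>?H\<^esub> (mG \<phi> ?t ?g)"
      using group_hom.hom_inv[OF group_hom.intro[OF _ _ group_hom_axioms.intro[OF hom[of ?t]]], of ?g]
        X.local_group Y.local_group V a c by simp
    note cl = ps[OF a, unfolded ab, OF A[OF b]] A[OF a] A[OF b] A[OF c(1)] G[of ?t ?g] g' c
    \<comment> \<open>The image of the relation \<open>ed_ed\<close> under \<open>F\<close>. Edges
      carry the inverses of the elements \<open>mA\<close>, so this yields the inverse of the
      desired twist equation.\<close>
    have "ed Y (mE \<phi> ?c) \<star>[Y] lc Y (mV \<phi> ?t) (inv\<^bsub>?H\<^esub> ?g' \<otimes>\<^bsub>?H\<^esub> inv\<^bsub>?H\<^esub> (psi Y (mE \<phi> a) (mA \<phi> b)) \<otimes>\<^bsub>?H\<^esub> inv\<^bsub>?H\<^esub> mA \<phi> a)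
      = (ed Y (mE \<phi> b) \<star>[Y] ed Y (mE \<phi> a)) \<star>[Y] lc Y (mV \<phi> ?t) (inv\<^bsub>?H\<^esub> (psi Y (mE \<phi> a) (mA \<phi> b)) \<otimes>\<^bsub>?H\<^esub> inv\<^bsub>?H\<^esub> mA \<phi> a)"
      using Y.ed_ed[of "mE \<phi> a" "mE \<phi> b"] a b ab E V cl
      by (simp add: E2 Y.lc_mult Y.pm_assoc)
    also have "\<dots> = ed Y (mE \<phi> b) \<star>[Y] (ed Y (mE \<phi> a) \<star>[Y] lc Y (mV \<phi> ?t) (psi Y (mE \<phi> a) (linv Y (mV \<phi> ?r) (mA \<phi> b)))
          \<star>[Y] lc Y (mV \<phi> ?t) (inv\<^bsub>?H\<^esub> mA \<phi> a))"
      using cl V a by (simp add: q Y.lc_mult Y.pm_assoc)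
    also have "\<dots> = ed Y (mE \<phi> b) \<star>[Y] (lc Y (mV \<phi> ?r) (linv Y (mV \<phi> ?r) (mA \<phi> b)) \<star>[Y] ed Y (mE \<phi> a)
          \<star>[Y] lc Y (mV \<phi> ?t) (inv\<^bsub>?H\<^esub> mA \<phi> a))"
      using le[OF a, of "linv Y (mV \<phi> ?r) (mA \<phi> b)"] cl V b ab by simp
    also have "\<dots> = F (ed X b \<star>[X] ed X a)"
      using a b ab by (simp add: mult F_ed Y.pm_assoc)
    also have "\<dots> = F (ed X ?c \<star>[X] lc X ?t (linv X ?t ?g))"
      using X.ed_ed a b ab by simp
    also have "\<dots> = ed Y (mE \<phi> ?c) \<star>[Y] lc Y (mV \<phi> ?t) (inv\<^bsub>?H\<^esub> mA \<phi> ?c \<otimes>\<^bsub>?H\<^esub> inv\<^bsub>?H\<^esub> mG \<phi> ?t ?g)"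
      using a cl V by (simp add: mult F_ed F_lc hi Y.lc_mult Y.pm_assoc)
    finally have "lc Y (mV \<phi> ?t) (inv\<^bsub>?H\<^esub> ?g' \<otimes>\<^bsub>?H\<^esub> inv\<^bsub>?H\<^esub> (psi Y (mE \<phi> a) (mA \<phi> b)) \<otimes>\<^bsub>?H\<^esub> inv\<^bsub>?H\<^esub> mA \<phi> a)
        = lc Y (mV \<phi> ?t) (inv\<^bsub>?H\<^esub> mA \<phi> ?c \<otimes>\<^bsub>?H\<^esub> inv\<^bsub>?H\<^esub> mG \<phi> ?t ?g)"
      by (rule Y.pm_left_cancel[rotated -1]) (use a cl E V in simp_all)
    then have "inv\<^bsub>?H\<^esub> ?g' \<otimes>\<^bsub>?H\<^esub> inv\<^bsub>?H\<^esub> (psi Y (mE \<phi> a) (mA \<phi> b)) \<otimes>\<^bsub>?H\<^esub> inv\<^bsub>?H\<^esub> mA \<phi> a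
        = inv\<^bsub>?H\<^esub> mA \<phi> ?c \<otimes>\<^bsub>?H\<^esub> inv\<^bsub>?H\<^esub> mG \<phi> ?t ?g"
      by (rule lc_inj[OF dev, rotated -1]) (use a cl E V in simp_all)
    then have "inv\<^bsub>?H\<^esub> (mA \<phi> a \<otimes>\<^bsub>?H\<^esub> psi Y (mE \<phi> a) (mA \<phi> b) \<otimes>\<^bsub>?H\<^esub> ?g') = inv\<^bsub>?H\<^esub> (mG \<phi> ?t ?g \<otimes>\<^bsub>?H\<^esub> mA \<phi> ?c)"
      using cl a by (simp add: H.inv_mult_group H.m_assoc)
    then have "inv\<^bsub>?H\<^esub> (inv\<^bsub>?H\<^esub> (mA \<phi> a \<otimes>\<^bsub>?H\<^esub> psi Y (mE \<phi> a) (mA \<phi> b) \<otimes>\<^bsub>?H\<^esub> ?g')) =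
        inv\<^bsub>?H\<^esub> (inv\<^bsub>?H\<^esub> (mG \<phi> ?t ?g \<otimes>\<^bsub>?H\<^esub> mA \<phi> ?c))"
      by (rule arg_cong)
    then show ?thesis using cl a V by simp
  qed
  show ?thesis
    unfolding cog_morphism_def Let_def using f hom A c t by blast
qed

section \<open>The action of a morphism on homotopy classes\<close>

abbreviation im :: "('v, 'e, 'g, 'w, 'd, 'h) cog_map \<Rightarrow> ('v, 'e, 'g) cpath set \<Rightarrow> ('w, 'd, 'h) cpath set" where
  "im \<phi> \<equiv> induced_hom X Y \<phi>"

lemma Y_psi_closed [simp]:
  "cog_morphism X Y \<phi> \<Longrightarrow> a \<in> eds X \<Longrightarrow> g \<in> Gr Y (mV \<phi> (org X a)) \<Longrightarrow>
    psi Y (mE \<phi> a) g \<in> Gr Y (mV \<phi> (trg X a))"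
  using Y.psi_closed[of "mE \<phi> a" g] by simp

lemma Y_lc_ed:
  "cog_morphism X Y \<phi> \<Longrightarrow> a \<in> eds X \<Longrightarrow> g \<in> Gr Y (mV \<phi> (org X a)) \<Longrightarrow>
    lc Y (mV \<phi> (org X a)) g \<star>[Y] ed Y (mE \<phi> a) =
      ed Y (mE \<phi> a) \<star>[Y] lc Y (mV \<phi> (trg X a)) (psi Y (mE \<phi> a) g)"
  using Y.lc_ed[of "mE \<phi> a" g] by simp

abbreviation "im_v \<phi> \<equiv> \<lambda>\<sigma> g. lc Y (mV \<phi> \<sigma>) (mG \<phi> \<sigma> g)"

text \<open>The element \<open>mA \<phi> a\<close> stands inverted behind a forward edge and
  uninverted in front of a backward one, as in \<open>pmap_oedge\<close>; this makes the two images
  mutually inverse.\<close>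

abbreviation "im_fw \<phi> \<equiv> \<lambda>a. ed Y (mE \<phi> a) \<star>[Y] lc Y (mV \<phi> (trg X a)) (linv Y (mV \<phi> (trg X a)) (mA \<phi> a))"

abbreviation "im_bw \<phi> \<equiv> \<lambda>a. lc Y (mV \<phi> (trg X a)) (mA \<phi> a) \<star>[Y] bd Y (mE \<phi> a)"

text \<open>The axioms of a morphism are the groupoid relations in disguise: the homomorphism law
  gives multiplicativity, \<open>mA_psi\<close> the slide relation, and \<open>mA_twist\<close> the
  composition relation.\<close>

lemma valuation:
  assumes mor: "cog_morphism X Y \<phi>"
  shows "path_valuation X (pm Y) (im_v \<phi>) (im_fw \<phi>) (im_bw \<phi>)"
proof (unfold_locales, goal_cases)
  case 1
  then show ?case by (rule Y.pm_assoc)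
next
  case (2 \<sigma> g h)
  then show ?case using mor by (simp add: mG_mult Y.lc_mult)
next
  case (3 a g)
  let ?t = "mV \<phi> (trg X a)"
  interpret H: group "grp Y ?t" using 3 mor Y.local_group by simp
  let ?z = "psi Y (mE \<phi> a) (mG \<phi> (org X a) g)" and ?w = "mG \<phi> (trg X a) (psi X a g)"
  have cl: "mA \<phi> a \<in> Gr Y ?t" "?z \<in> Gr Y ?t" "?w \<in> Gr Y ?t" using 3 mor by simp_all
  have "?z \<odot>[Y,?t] linv Y ?t (mA \<phi> a) = linv Y ?t (mA \<phi> a) \<odot>[Y,?t] (mA \<phi> a \<odot>[Y,?t] ?z) \<odot>[Y,?t] linv Y ?t (mA \<phi> a)"
    using cl by (simp add: H.m_assoc[symmetric])
  also have "\<dots> = linv Y ?t (mA \<phi> a) \<odot>[Y,?t] ?w"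
    unfolding mA_psi[OF mor 3] using cl by (simp add: H.m_assoc)
  finally have e: "?z \<odot>[Y,?t] linv Y ?t (mA \<phi> a) = linv Y ?t (mA \<phi> a) \<odot>[Y,?t] ?w" .
  have "ed Y (mE \<phi> a) \<star>[Y] lc Y ?t (?z \<odot>[Y,?t] linv Y ?t (mA \<phi> a)) =
    ed Y (mE \<phi> a) \<star>[Y] lc Y ?t (linv Y ?t (mA \<phi> a) \<odot>[Y,?t] ?w)"
    by (simp only: e)
  then show ?case using 3 mor cl
    by (simp add: Y.lc_mult Y.pm_assoc[symmetric] Y_lc_ed)
next
  case (4 a)
  then show ?case using mor by (simp add: Y.pm_assoc)
next
  case (5 a)
  then show ?case using mor by (simp add: Y.pm_assoc)
next
  case (6 a)
  let ?t = "mV \<phi> (trg X a)"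
  have "lc Y ?t (linv Y ?t (mA \<phi> a)) \<star>[Y] (lc Y ?t (mA \<phi> a) \<star>[Y] bd Y (mE \<phi> a)) = bd Y (mE \<phi> a)"
    using 6 mor by (simp add: Y.lc_mult[symmetric] Y.pm_assoc[symmetric])
  then show ?case using 6 mor by (simp add: Y.pm_assoc Y.ed_bd)
next
  case (7 a)
  let ?t = "mV \<phi> (trg X a)"
  have "bd Y (mE \<phi> a) \<star>[Y] (ed Y (mE \<phi> a) \<star>[Y] lc Y ?t (linv Y ?t (mA \<phi> a))) = lc Y ?t (linv Y ?t (mA \<phi> a))"
    using 7 mor by (simp add: Y.bd_ed Y.pm_assoc[symmetric])
  then show ?case using 7 mor by (simp add: Y.pm_assoc Y.lc_mult[symmetric])
next
  case (8 a b)
  let ?i = "org X b" and ?r = "trg X b" and ?t = "trg X a" and ?c = "cpo X a b"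
  let ?H = "grp Y (mV \<phi> (trg X a))"
  let ?g = "twist X a b" and ?g' = "twist Y (mE \<phi> a) (mE \<phi> b)"
  interpret H: group ?H using 8 mor Y.local_group by simp
  have c: "?c \<in> eds X" "org X ?c = ?i" "trg X ?c = ?t" "?g \<in> Gr X ?t"
    using 8 by (simp_all add: X.cmp_closed X.ini_cmp X.ter_cmp X.twist_closed)
  have mc: "mA \<phi> ?c \<in> Gr Y (mV \<phi> ?t)" using mor_simps(6)[OF mor c(1)] c by simp
  have g': "?g' \<in> Gr Y (mV \<phi> ?t)" using Y.twist_closed[of "mE \<phi> a" "mE \<phi> b"] 8 mor by simp
  have mb: "mA \<phi> b \<in> Gr Y (mV \<phi> (org X a))" using 8 mor by simp
  have q: "psi Y (mE \<phi> a) (linv Y (mV \<phi> ?r) (mA \<phi> b)) = inv\<^bsub>?H\<^esub> (psi Y (mE \<phi> a) (mA \<phi> b))"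
    using Y.psi_inv[of "mE \<phi> a" "mA \<phi> b"] 8 mor by simp
  have cl: "psi Y (mE \<phi> a) (mA \<phi> b) \<in> Gr Y (mV \<phi> ?t)" "mG \<phi> ?t ?g \<in> Gr Y (mV \<phi> ?t)"
    "mA \<phi> a \<in> Gr Y (mV \<phi> ?t)" "mE \<phi> a \<in> eds Y" "mE \<phi> b \<in> eds Y" "mV \<phi> ?t \<in> vts Y"
    "mE \<phi> ?c \<in> eds Y"
    using 8 mor c mb by simp_all
  \<comment> \<open>\<open>mA_twist\<close> is inverted because forward edges carry the inverse of
    \<open>mA\<close>.\<close>
  have "inv\<^bsub>?H\<^esub> (mA \<phi> a \<otimes>\<^bsub>?H\<^esub> psi Y (mE \<phi> a) (mA \<phi> b) \<otimes>\<^bsub>?H\<^esub> ?g') = inv\<^bsub>?H\<^esub> (mG \<phi> ?t ?g \<otimes>\<^bsub>?H\<^esub> mA \<phi> ?c)"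
    using mA_twist[OF mor 8] by simp
  then have e: "inv\<^bsub>?H\<^esub> ?g' \<otimes>\<^bsub>?H\<^esub> inv\<^bsub>?H\<^esub> (psi Y (mE \<phi> a) (mA \<phi> b)) \<otimes>\<^bsub>?H\<^esub> inv\<^bsub>?H\<^esub> mA \<phi> a
      = inv\<^bsub>?H\<^esub> mA \<phi> ?c \<otimes>\<^bsub>?H\<^esub> inv\<^bsub>?H\<^esub> mG \<phi> ?t ?g"
    using cl mc g' by (simp add: H.inv_mult_group H.m_assoc)
  have l: "lc Y (mV \<phi> (org X a)) (linv Y (mV \<phi> ?r) (mA \<phi> b)) \<star>[Y] ed Y (mE \<phi> a) =
      ed Y (mE \<phi> a) \<star>[Y] lc Y (mV \<phi> ?t) (psi Y (mE \<phi> a) (linv Y (mV \<phi> ?r) (mA \<phi> b)))"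
    by (rule Y_lc_ed[OF mor 8(1)]) (use 8 mor in simp)
  have "ed Y (mE \<phi> b) \<star>[Y] lc Y (mV \<phi> ?r) (linv Y (mV \<phi> ?r) (mA \<phi> b)) \<star>[Y]
      (ed Y (mE \<phi> a) \<star>[Y] lc Y (mV \<phi> ?t) (inv\<^bsub>?H\<^esub> mA \<phi> a)) =
     ed Y (mE \<phi> b) \<star>[Y] ((lc Y (mV \<phi> (org X a)) (linv Y (mV \<phi> ?r) (mA \<phi> b)) \<star>[Y] ed Y (mE \<phi> a))
       \<star>[Y] lc Y (mV \<phi> ?t) (inv\<^bsub>?H\<^esub> mA \<phi> a))"
    using 8 by (simp add: Y.pm_assoc)
  also have "\<dots> = (ed Y (mE \<phi> b) \<star>[Y] ed Y (mE \<phi> a)) \<star>[Y]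
      lc Y (mV \<phi> ?t) (inv\<^bsub>?H\<^esub> (psi Y (mE \<phi> a) (mA \<phi> b)) \<otimes>\<^bsub>?H\<^esub> inv\<^bsub>?H\<^esub> mA \<phi> a)"
    unfolding l using 8 mor cl by (simp add: q Y.pm_assoc Y.lc_mult)
  also have "\<dots> = ed Y (mE \<phi> ?c) \<star>[Y] lc Y (mV \<phi> ?t) (inv\<^bsub>?H\<^esub> ?g' \<otimes>\<^bsub>?H\<^esub> inv\<^bsub>?H\<^esub> (psi Y (mE \<phi> a) (mA \<phi> b)) \<otimes>\<^bsub>?H\<^esub> inv\<^bsub>?H\<^esub> mA \<phi> a)"
    using Y.ed_ed[of "mE \<phi> a" "mE \<phi> b"] 8 mor cl g' by (simp add: mE_cmp Y.pm_assoc Y.lc_mult)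
  also have "\<dots> = ed Y (mE \<phi> ?c) \<star>[Y] lc Y (mV \<phi> ?t) (inv\<^bsub>?H\<^esub> mA \<phi> ?c) \<star>[Y] lc Y (mV \<phi> ?t) (mG \<phi> ?t (linv X ?t ?g))"
    using cl mc 8 mor c by (simp only: e) (simp add: mG_inv Y.lc_mult Y.pm_assoc)
  finally show ?case by (simp only: c)
qed

text \<open>Identifying the class of \<open>pmap\<close> with the evaluation of the path makes
  homotopy invariance of \<open>pmap\<close> a case of \<open>ev_htpy\<close>.\<close>

lemma pmap_rep:
  assumes mor: "cog_morphism X Y \<phi>" and p: "is_cpath X p"
  shows "is_cpath Y (pmap X Y \<phi> p) \<and> pini (pmap X Y \<phi> p) = mV \<phi> (pini p) \<and> pter Y (pmap X Y \<phi> p) = mV \<phi> (pter X p) \<and>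
    hclass Y (pmap X Y \<phi> p) = path_valuation.ev X (pm Y) (im_v \<phi>) (im_fw \<phi>) (im_bw \<phi>) p"
proof -
  interpret V: path_valuation X "pm Y" "im_v \<phi>" "im_fw \<phi>" "im_bw \<phi>"
    by (rule valuation[OF mor])
  have oe: "is_cpath Y (pmap_oedge X Y \<phi> e) \<and> pini (pmap_oedge X Y \<phi> e) = mV \<phi> (oini (shape X) e) \<and>
     pter Y (pmap_oedge X Y \<phi> e) = mV \<phi> (oter (shape X) e) \<and>
     hclass Y (pmap_oedge X Y \<phi> e) = (case e of Fwd a \<Rightarrow> im_fw \<phi> a | Bwd a \<Rightarrow> im_bw \<phi> a)"
    if e: "oedge_base e \<in> eds X" for e
  proof (cases e)
    case (Fwd a)
    let ?t = "mV \<phi> (trg X a)"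
    have "pmap_oedge X Y \<phi> e = pcat Y (pfwd Y (mE \<phi> a)) (pconst ?t (linv Y ?t (mA \<phi> a)))"
      using mor e Fwd by (simp add: Let_def pfwd_def pconst_def)
    then show ?thesis using mor e Fwd by (simp add: Y.hclass_pcat ed_def lc_def)
  next
    case (Bwd a)
    let ?t = "mV \<phi> (trg X a)"
    have "pmap_oedge X Y \<phi> e = pcat Y (pconst ?t (mA \<phi> a)) (pbwd Y (mE \<phi> a))"
      using mor e Bwd by (simp add: Let_def pbwd_def pconst_def)
    then show ?thesis using mor e Bwd by (simp add: Y.hclass_pcat bd_def lc_def)
  qed
  have "is_cpath X (\<sigma>, g, s) \<Longrightarrow> is_cpath Y (pmap X Y \<phi> (\<sigma>, g, s)) \<and> pini (pmap X Y \<phi> (\<sigma>, g, s)) = mV \<phi> \<sigma> \<and>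
    pter Y (pmap X Y \<phi> (\<sigma>, g, s)) = mV \<phi> (pter X (\<sigma>, g, s)) \<and>
    hclass Y (pmap X Y \<phi> (\<sigma>, g, s)) = V.ev (\<sigma>, g, s)" for \<sigma> g s
  proof (induction s arbitrary: \<sigma> g)
    case Nil
    then show ?case using mor by (simp add: lc_def[symmetric])
  next
    case (Cons z s)
    obtain e h where z: "z = (e, h)" by (cases z)
    then have e: "oedge_base e \<in> eds X" "oini (shape X) e = \<sigma>" "g \<in> Gr X \<sigma>"
      and IH: "is_cpath X (oter (shape X) e, h, s)" using Cons.prems by auto
    have v: "\<sigma> \<in> vts X" using e X.oini_vert by blast
    show ?case using Cons.IH[OF IH] oe[OF e(1)] e v mor unfolding z
      by (simp add: Y.hclass_pcat lc_def[symmetric] del: pcat.simps)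
  qed
  then show ?thesis using p by (cases p) auto
qed

text \<open>All members of the union defining \<open>induced_hom\<close> coincide, because homotopic
  paths have the same evaluation.\<close>

lemma im_hclass:
  assumes mor: "cog_morphism X Y \<phi>" and p: "is_cpath X p"
  shows "im \<phi> (hclass X p) = hclass Y (pmap X Y \<phi> p)"
proof -
  interpret V: path_valuation X "pm Y" "im_v \<phi>" "im_fw \<phi>" "im_bw \<phi>" by (rule valuation[OF mor])
  have "hclass Y (pmap X Y \<phi> q) = hclass Y (pmap X Y \<phi> p)" if "cpath_htpy X p q" for q
    using V.ev_htpy[OF that] pmap_rep[OF mor p] pmap_rep[OF mor, of q] X.htpy_ends[OF that] by simp
  moreover have "cpath_htpy X p p" using p by (rule cpath_htpy.refl)
  ultimately show ?thesis unfolding induced_hom_def hclass_def[of X p] by blast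
qed

lemma im_evc:
  assumes mor: "cog_morphism X Y \<phi>" and x: "ar X x"
  shows "im \<phi> x = path_valuation.evc X (pm Y) (im_v \<phi>) (im_fw \<phi>) (im_bw \<phi>) x"
proof -
  interpret V: path_valuation X "pm Y" "im_v \<phi>" "im_fw \<phi>" "im_bw \<phi>" by (rule valuation[OF mor])
  show ?thesis using x by (rule X.arE) (simp add: im_hclass[OF mor] V.evc_hclass pmap_rep[OF mor])
qed

lemma im_ends [simp]:
  assumes "cog_morphism X Y \<phi>" "ar X x"
  shows "ar Y (im \<phi> x)" "src (im \<phi> x) = mV \<phi> (src x)" "tgt Y (im \<phi> x) = mV \<phi> (tgt X x)"
proof -
  obtain p where p: "is_cpath X p" "x = hclass X p" using assms(2) by (rule X.arE)
  have "is_cpath Y (pmap X Y \<phi> p)" "pini (pmap X Y \<phi> p) = mV \<phi> (pini p)" "pter Y (pmap X Y \<phi> p) = mV \<phi> (pter X p)"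
    using pmap_rep[OF assms(1) p(1)] by blast+
  then show "ar Y (im \<phi> x)" "src (im \<phi> x) = mV \<phi> (src x)" "tgt Y (im \<phi> x) = mV \<phi> (tgt X x)"
    using p by (simp_all add: im_hclass[OF assms(1) p(1)])
qed

lemma im_pm:
  assumes mor: "cog_morphism X Y \<phi>" and "ar X x" "ar X y" "tgt X x = src y"
  shows "im \<phi> (x \<star>[X] y) = im \<phi> x \<star>[Y] im \<phi> y"
  using assms path_valuation.evc_pm[OF valuation[OF mor]] by (simp add: im_evc)

lemma im_lc:
  assumes mor: "cog_morphism X Y \<phi>" and "\<sigma> \<in> vts X" "g \<in> Gr X \<sigma>"
  shows "im \<phi> (lc X \<sigma> g) = lc Y (mV \<phi> \<sigma>) (mG \<phi> \<sigma> g)"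
  using assms path_valuation.evc_lc[OF valuation[OF mor]] by (simp add: im_evc)

lemma im_ed:
  assumes mor: "cog_morphism X Y \<phi>" and "a \<in> eds X"
  shows "im \<phi> (ed X a) = ed Y (mE \<phi> a) \<star>[Y]
    lc Y (mV \<phi> (trg X a)) (linv Y (mV \<phi> (trg X a)) (mA \<phi> a))"
  using assms path_valuation.evc_ed[OF valuation[OF mor]] by (simp add: im_evc)

lemma im_bd:
  assumes mor: "cog_morphism X Y \<phi>" and "a \<in> eds X"
  shows "im \<phi> (bd X a) = lc Y (mV \<phi> (trg X a)) (mA \<phi> a) \<star>[Y] bd Y (mE \<phi> a)"
  using assms path_valuation.evc_bd[OF valuation[OF mor]] by (simp add: im_evc)

lemma im_one [simp]:
  assumes mor: "cog_morphism X Y \<phi>" and "\<sigma> \<in> vts X"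
  shows "im \<phi> (lc X \<sigma> (lone X \<sigma>)) = lc Y (mV \<phi> \<sigma>) (lone Y (mV \<phi> \<sigma>))"
  using assms by (simp add: im_lc)

lemma im_iv:
  assumes mor: "cog_morphism X Y \<phi>" and "ar X x"
  shows "im \<phi> (iv X x) = iv Y (im \<phi> x)"
  by (rule Y.iv_unique) (use assms in \<open>simp_all add: im_pm[symmetric]\<close>)

text \<open>Agreement on local elements and forward edges suffices: the value on a backward edge is
  forced as the inverse of the value on the forward one.\<close>

lemma im_eqI:
  assumes mor: "cog_morphism X Y \<phi>"
    and ends: "\<And>x. ar X x \<Longrightarrow> ar Y (F x)" "\<And>x. ar X x \<Longrightarrow> src (F x) = mV \<phi> (src x)"
    and mult: "\<And>x y. ar X x \<Longrightarrow> ar X y \<Longrightarrow> tgt X x = src y \<Longrightarrow> F (x \<star>[X] y) = F x \<star>[Y] F y"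
    and lc: "\<And>\<sigma> g. \<sigma> \<in> vts X \<Longrightarrow> g \<in> Gr X \<sigma> \<Longrightarrow> F (lc X \<sigma> g) = im \<phi> (lc X \<sigma> g)"
    and ed: "\<And>a. a \<in> eds X \<Longrightarrow> F (ed X a) = im \<phi> (ed X a)"
    and x: "ar X x"
  shows "im \<phi> x = F x"
  using x
proof (induction rule: X.arr_induct)
  case (bd a)
  have "im \<phi> (ed X a) \<star>[Y] F (bd X a) = im \<phi> (lc X (org X a) (lone X (org X a)))"
    using bd by (simp add: mult[symmetric] X.ed_bd lc flip: ed)
  then have "F (bd X a) = iv Y (im \<phi> (ed X a))" using mor bd ends[of "bd X a"] by (intro Y.iv_unique) simp_all
  also have "\<dots> = im \<phi> (iv X (ed X a))" using mor bd by (simp add: im_iv)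
  finally show ?case using bd by (simp add: X.iv_ed)
qed (use mor in \<open>simp_all add: lc ed mult im_pm\<close>)

section \<open>Homotopies of morphisms as natural transformations\<close>

text \<open>The two equations defining a homotopy are the naturality squares at local elements and
  at forward edges; squares for composites are pasted together.\<close>

lemma htpy_natural:
  assumes h: "mor_htpy_by X Y k \<phi> \<eta>" and x: "ar X x"
  shows "lc Y (mV \<phi> (src x)) (k (src x)) \<star>[Y] im \<phi> x = im \<eta> x \<star>[Y] lc Y (mV \<phi> (tgt X x)) (k (tgt X x))"
proof -
  have mor: "cog_morphism X Y \<phi>" "cog_morphism X Y \<eta>" and V: "\<sigma> \<in> vts X \<Longrightarrow> mV \<eta> \<sigma> = mV \<phi> \<sigma>"
    and E: "a \<in> eds X \<Longrightarrow> mE \<eta> a = mE \<phi> a"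
    and k: "\<sigma> \<in> vts X \<Longrightarrow> k \<sigma> \<in> Gr Y (mV \<phi> \<sigma>)"
    and G: "\<sigma> \<in> vts X \<Longrightarrow> g \<in> Gr X \<sigma> \<Longrightarrow> mG \<eta> \<sigma> g = conj_by (grp Y (mV \<phi> \<sigma>)) (k \<sigma>) (mG \<phi> \<sigma> g)"
    and A: "a \<in> eds X \<Longrightarrow> mA \<eta> a = k (trg X a) \<odot>[Y,mV \<phi> (trg X a)] mA \<phi> a \<odot>[Y,mV \<phi> (trg X a)]
        psi Y (mE \<phi> a) (linv Y (mV \<phi> (org X a)) (k (org X a)))" for \<sigma> g a
    using h unfolding mor_htpy_by_def Let_def by blast+
  show ?thesis using x
  proof (induction rule: X.arr_induct)
    case (lc \<sigma> g)
    then have "k \<sigma> \<odot>[Y,mV \<phi> \<sigma>] mG \<phi> \<sigma> g = mG \<eta> \<sigma> g \<odot>[Y,mV \<phi> \<sigma>] k \<sigma>"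
      using mor k[of \<sigma>] by (simp add: G conj_by_def Y.l_assoc)
    then show ?case using lc mor k[of \<sigma>] V[of \<sigma>] mor_simps(5)[OF mor(2) lc] by (simp add: im_lc Y.lc_mult[symmetric])
  next
    case (ed a)
    let ?t = "trg X a" and ?i = "org X a"
    interpret H: group "grp Y (mV \<phi> ?t)" using ed mor Y.local_group by simp
    have cl: "k ?t \<in> Gr Y (mV \<phi> ?t)" "k ?i \<in> Gr Y (mV \<phi> ?i)" "psi Y (mE \<phi> a) (k ?i) \<in> Gr Y (mV \<phi> ?t)"
        "mA \<phi> a \<in> Gr Y (mV \<phi> ?t)"
      using ed k mor by simp_all
    have q: "psi Y (mE \<phi> a) (linv Y (mV \<phi> ?i) (k ?i)) = linv Y (mV \<phi> ?t) (psi Y (mE \<phi> a) (k ?i))"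
      using Y.psi_inv[of "mE \<phi> a" "k ?i"] ed mor cl by simp
    have "psi Y (mE \<phi> a) (k ?i) \<odot>[Y,mV \<phi> ?t] linv Y (mV \<phi> ?t) (mA \<phi> a) = linv Y (mV \<phi> ?t) (mA \<eta> a) \<odot>[Y,mV \<phi> ?t] k ?t"
      using cl ed by (simp add: A q H.inv_mult_group H.m_assoc)
    then have "ed Y (mE \<phi> a) \<star>[Y] (lc Y (mV \<phi> ?t) (psi Y (mE \<phi> a) (k ?i)) \<star>[Y] lc Y (mV \<phi> ?t) (linv Y (mV \<phi> ?t) (mA \<phi> a)))
      = ed Y (mE \<phi> a) \<star>[Y] (lc Y (mV \<phi> ?t) (linv Y (mV \<phi> ?t) (mA \<eta> a)) \<star>[Y] lc Y (mV \<phi> ?t) (k ?t))"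
      using ed cl mor mor_simps(6)[OF mor(2) ed] V[of ?t] by (simp add: Y.lc_mult[symmetric])
    then show ?case using ed mor cl V[of ?t] E[of a] by (simp add: im_ed Y.pm_assoc[symmetric] Y_lc_ed)
  next
    case (bd a)
    let ?t = "trg X a" and ?i = "org X a"
    interpret H: group "grp Y (mV \<phi> ?t)" using bd mor Y.local_group by simp
    have cl: "k ?t \<in> Gr Y (mV \<phi> ?t)" "k ?i \<in> Gr Y (mV \<phi> ?i)" "psi Y (mE \<phi> a) (k ?i) \<in> Gr Y (mV \<phi> ?t)"
        "mA \<phi> a \<in> Gr Y (mV \<phi> ?t)" "mA \<eta> a \<in> Gr Y (mV \<phi> ?t)"
      using bd k mor mor_simps(6)[OF mor(2) bd] V[of ?t] by simp_all
    have q: "psi Y (mE \<phi> a) (linv Y (mV \<phi> ?i) (k ?i)) = linv Y (mV \<phi> ?t) (psi Y (mE \<phi> a) (k ?i))"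
      using Y.psi_inv[of "mE \<phi> a" "k ?i"] bd mor cl by simp
    have e: "k ?t \<odot>[Y,mV \<phi> ?t] mA \<phi> a = mA \<eta> a \<odot>[Y,mV \<phi> ?t] psi Y (mE \<phi> a) (k ?i)"
      using cl bd by (simp add: A q H.m_assoc)
    \<comment> \<open>The slide for backward edges: insert \<open>ed\<close> times \<open>bd\<close>
      on the right, use the forward slide in the middle, and cancel \<open>bd\<close> times
      \<open>ed\<close>.\<close>
    have b: "bd Y (mE \<phi> a) \<star>[Y] lc Y (mV \<phi> ?i) (k ?i) = lc Y (mV \<phi> ?t) (psi Y (mE \<phi> a) (k ?i)) \<star>[Y] bd Y (mE \<phi> a)"
    proof -
      have "bd Y (mE \<phi> a) \<star>[Y] lc Y (mV \<phi> ?i) (k ?i) =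
          bd Y (mE \<phi> a) \<star>[Y] (lc Y (mV \<phi> ?i) (k ?i) \<star>[Y] (ed Y (mE \<phi> a) \<star>[Y] bd Y (mE \<phi> a)))"
        using mor bd cl by (simp add: Y.ed_bd)
      also have "\<dots> = (bd Y (mE \<phi> a) \<star>[Y] ed Y (mE \<phi> a)) \<star>[Y] (lc Y (mV \<phi> ?t) (psi Y (mE \<phi> a) (k ?i)) \<star>[Y] bd Y (mE \<phi> a))"
        using Y_lc_ed[OF mor(1) bd cl(2)] by (metis Y.pm_assoc)
      finally show ?thesis using mor bd cl by (simp add: Y.bd_ed)
    qed
    have "lc Y (mV \<phi> ?t) (k ?t) \<star>[Y] (lc Y (mV \<phi> ?t) (mA \<phi> a) \<star>[Y] bd Y (mE \<phi> a)) =
       lc Y (mV \<phi> ?t) (k ?t \<odot>[Y,mV \<phi> ?t] mA \<phi> a) \<star>[Y] bd Y (mE \<phi> a)"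
      using bd mor cl by (simp add: Y.lc_mult Y.pm_assoc)
    also have "\<dots> = lc Y (mV \<phi> ?t) (mA \<eta> a) \<star>[Y] bd Y (mE \<phi> a) \<star>[Y] lc Y (mV \<phi> ?i) (k ?i)"
      using bd mor cl by (simp add: e Y.lc_mult Y.pm_assoc b)
    finally show ?case using bd mor V[of ?t] E[of a] by (simp add: im_bd)
  next
    case (mult x y)
    then show ?case using mor by (simp add: im_pm) (metis Y.pm_assoc)
  qed
qed

text \<open>The converse of \<open>htpy_natural\<close>. The naturality squares at \<open>lc\<close>
  and \<open>ed\<close> are equations between classes; after cancelling the edge, developability
  turns them into the defining equations of a homotopy.\<close>

lemma htpyI:
  assumes dev: "developable Y" and mor: "cog_morphism X Y \<phi>" "cog_morphism X Y \<eta>"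
    and V: "\<And>\<sigma>. \<sigma> \<in> vts X \<Longrightarrow> mV \<eta> \<sigma> = mV \<phi> \<sigma>"
    and E: "\<And>a. a \<in> eds X \<Longrightarrow> mE \<eta> a = mE \<phi> a"
    and k: "\<And>\<sigma>. \<sigma> \<in> vts X \<Longrightarrow> k \<sigma> \<in> Gr Y (mV \<phi> \<sigma>)"
    and nat: "\<And>x. ar X x \<Longrightarrow>
      lc Y (mV \<phi> (src x)) (k (src x)) \<star>[Y] im \<phi> x = im \<eta> x \<star>[Y] lc Y (mV \<phi> (tgt X x)) (k (tgt X x))"
  shows "mor_htpy_by X Y k \<phi> \<eta>"
proof -
  have G: "mG \<eta> \<sigma> g = conj_by (grp Y (mV \<phi> \<sigma>)) (k \<sigma>) (mG \<phi> \<sigma> g)"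
    if \<sigma>: "\<sigma> \<in> vts X" and g: "g \<in> Gr X \<sigma>" for \<sigma> g
  proof -
    have cl: "mG \<phi> \<sigma> g \<in> Gr Y (mV \<phi> \<sigma>)" "mG \<eta> \<sigma> g \<in> Gr Y (mV \<phi> \<sigma>)" "mV \<phi> \<sigma> \<in> vts Y"
      using mor_simps(5)[OF mor(2) \<sigma> g] mor \<sigma> g V by simp_all
    have "lc Y (mV \<phi> \<sigma>) (k \<sigma> \<odot>[Y,mV \<phi> \<sigma>] mG \<phi> \<sigma> g) = lc Y (mV \<phi> \<sigma>) (mG \<eta> \<sigma> g \<odot>[Y,mV \<phi> \<sigma>] k \<sigma>)"
      using nat[of "lc X \<sigma> g"] \<sigma> g mor cl k by (simp add: im_lc Y.lc_mult V)
    then have "k \<sigma> \<odot>[Y,mV \<phi> \<sigma>] mG \<phi> \<sigma> g = mG \<eta> \<sigma> g \<odot>[Y,mV \<phi> \<sigma>] k \<sigma>"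
      by (rule lc_inj[OF dev, rotated -1]) (use cl \<sigma> k in simp_all)
    then show ?thesis using cl \<sigma> k by (simp add: conj_by_def Y.l_assoc)
  qed
  have A: "mA \<eta> a = k (trg X a) \<odot>[Y,mV \<phi> (trg X a)] mA \<phi> a \<odot>[Y,mV \<phi> (trg X a)]
        psi Y (mE \<phi> a) (linv Y (mV \<phi> (org X a)) (k (org X a)))"
    if a: "a \<in> eds X" for a
  proof -
    let ?t = "trg X a" and ?i = "org X a"
    interpret H: group "grp Y (mV \<phi> ?t)" using a mor Y.local_group by simp
    have cl: "k ?t \<in> Gr Y (mV \<phi> ?t)" "k ?i \<in> Gr Y (mV \<phi> ?i)" "psi Y (mE \<phi> a) (k ?i) \<in> Gr Y (mV \<phi> ?t)"
        "mA \<phi> a \<in> Gr Y (mV \<phi> ?t)" "mA \<eta> a \<in> Gr Y (mV \<phi> ?t)"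
      using a k mor mor_simps(6)[OF mor(2) a] V[of ?t] by simp_all
    have q: "psi Y (mE \<phi> a) (linv Y (mV \<phi> ?i) (k ?i)) = linv Y (mV \<phi> ?t) (psi Y (mE \<phi> a) (k ?i))"
      using Y.psi_inv[of "mE \<phi> a" "k ?i"] a mor cl by simp
    have "ed Y (mE \<phi> a) \<star>[Y] lc Y (mV \<phi> ?t) (psi Y (mE \<phi> a) (k ?i) \<odot>[Y,mV \<phi> ?t] linv Y (mV \<phi> ?t) (mA \<phi> a)) =
       ed Y (mE \<phi> a) \<star>[Y] lc Y (mV \<phi> ?t) (linv Y (mV \<phi> ?t) (mA \<eta> a) \<odot>[Y,mV \<phi> ?t] k ?t)"
      using nat[of "ed X a"] a mor cl
      by (simp add: im_ed V E Y.lc_mult Y.pm_assoc[symmetric] Y_lc_ed)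
    then have "lc Y (mV \<phi> ?t) (psi Y (mE \<phi> a) (k ?i) \<odot>[Y,mV \<phi> ?t] linv Y (mV \<phi> ?t) (mA \<phi> a)) =
       lc Y (mV \<phi> ?t) (linv Y (mV \<phi> ?t) (mA \<eta> a) \<odot>[Y,mV \<phi> ?t] k ?t)"
      by (rule Y.pm_left_cancel[rotated -1]) (use a cl mor in simp_all)
    then have "psi Y (mE \<phi> a) (k ?i) \<odot>[Y,mV \<phi> ?t] linv Y (mV \<phi> ?t) (mA \<phi> a) = linv Y (mV \<phi> ?t) (mA \<eta> a) \<odot>[Y,mV \<phi> ?t] k ?t"
      by (rule lc_inj[OF dev, rotated -1]) (use a cl mor in simp_all)
    then have "mA \<eta> a \<odot>[Y,mV \<phi> ?t] (psi Y (mE \<phi> a) (k ?i) \<odot>[Y,mV \<phi> ?t] linv Y (mV \<phi> ?t) (mA \<phi> a)) =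
        mA \<eta> a \<odot>[Y,mV \<phi> ?t] (linv Y (mV \<phi> ?t) (mA \<eta> a) \<odot>[Y,mV \<phi> ?t] k ?t)"
      by (rule arg_cong)
    also have "\<dots> = k ?t" using cl by (simp add: H.m_assoc[symmetric])
    finally have "k ?t = mA \<eta> a \<odot>[Y,mV \<phi> ?t] psi Y (mE \<phi> a) (k ?i) \<odot>[Y,mV \<phi> ?t] linv Y (mV \<phi> ?t) (mA \<phi> a)"
      using cl by (simp add: H.m_assoc)
    then show ?thesis using cl by (simp add: q H.m_assoc)
  qed
  show ?thesis unfolding mor_htpy_by_def Let_def using assms G A by blast
qed

lemma mor_htpyD:
  assumes "mor_htpy_by X Y k \<phi> \<eta>"
  shows "cog_morphism X Y \<phi>" "cog_morphism X Y \<eta>" "\<sigma> \<in> vts X \<Longrightarrow> mV \<eta> \<sigma> = mV \<phi> \<sigma>"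
    "a \<in> eds X \<Longrightarrow> mE \<eta> a = mE \<phi> a" "\<sigma> \<in> vts X \<Longrightarrow> k \<sigma> \<in> Gr Y (mV \<phi> \<sigma>)"
  using assms unfolding mor_htpy_by_def by blast+

end

section \<open>Lifting paths along coverings\<close>

context cog_pair
begin

text \<open>The surjective half of the coset bijection of a covering, in terms of elements. It is
  what lifting a backward edge needs, and it is stated for any morphism so that it can also be
  applied to automorphisms.\<close>

definition back_lifting :: "('v, 'e, 'g, 'w, 'd, 'h) cog_map \<Rightarrow> bool" where
  "back_lifting \<phi> \<longleftrightarrow> (\<forall>\<sigma>\<in>vts X. \<forall>b\<in>eds Y. trg Y b = mV \<phi> \<sigma> \<longrightarrow>
     (\<forall>y\<in>Gr Y (mV \<phi> \<sigma>). \<exists>a\<in>eds X. mE \<phi> a = b \<and> trg X a = \<sigma> \<and>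
        (\<exists>g\<in>Gr X \<sigma>. \<exists>h\<in>Gr Y (org Y b). y = mG \<phi> \<sigma> g \<odot>[Y,mV \<phi> \<sigma>] mA \<phi> a \<odot>[Y,mV \<phi> \<sigma>] psi Y b h)))"

text \<open>The factor \<open>k\<close> in front makes lifting inductive: the remainder left by one
  piece of a path becomes the initial factor of the next piece.\<close>

definition lifts :: "('v, 'e, 'g, 'w, 'd, 'h) cog_map \<Rightarrow> 'v \<Rightarrow> 'h \<Rightarrow> ('w, 'd, 'h) cpath set \<Rightarrow> bool" where
  "lifts \<phi> \<sigma> k y \<longleftrightarrow> (\<exists>x h. ar X x \<and> src x = \<sigma> \<and> mV \<phi> (tgt X x) = tgt Y y \<and> h \<in> Gr Y (tgt Y y) \<and>
     lc Y (src y) k \<star>[Y] y = im \<phi> x \<star>[Y] lc Y (tgt Y y) h)"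

text \<open>A local element is absorbed into the remainder, a forward edge lifts by the bijection on
  outgoing edges, a backward edge by \<open>back_lifting\<close>, and a product by passing the
  remainder on.\<close>

lemma lift_exists_aux:
  assumes mor: "cog_morphism X Y \<phi>" and bl: "back_lifting \<phi>" and y: "ar Y y"
  shows "\<forall>\<sigma>\<in>vts X. \<forall>k\<in>Gr Y (src y). mV \<phi> \<sigma> = src y \<longrightarrow>
    lifts \<phi> \<sigma> k y"
  using y
proof (induction rule: Y.arr_induct)
  case (lc \<tau> g)
  show ?case
  proof (intro ballI impI)
    fix \<sigma> k assume a: "\<sigma> \<in> vts X" "k \<in> Gr Y (src (lc Y \<tau> g))" "mV \<phi> \<sigma> = src (lc Y \<tau> g)"
    then show "lifts \<phi> \<sigma> k (lc Y \<tau> g)"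
      using mor lc unfolding lifts_def
      by (intro exI[of _ "lc X \<sigma> (lone X \<sigma>)"] exI[of _ "k \<odot>[Y,\<tau>] g"]) (simp add: Y.lc_mult)
  qed
next
  case (ed b)
  show ?case
  proof (intro ballI impI)
    fix \<sigma> k assume a: "\<sigma> \<in> vts X" "k \<in> Gr Y (src (ed Y b))" "mV \<phi> \<sigma> = src (ed Y b)"
    have "b \<in> mE \<phi> ` {a \<in> eds X. org X a = \<sigma>}"
      using bij_betw_imp_surj_on[OF mE_bij[OF mor a(1)]] ed a by auto
    then obtain a where e: "a \<in> eds X" "org X a = \<sigma>" "b = mE \<phi> a" by auto
    let ?t = "mV \<phi> (trg X a)"
    have k: "k \<in> Gr Y (mV \<phi> (org X a))" using a(2) e(1) mor unfolding e(3) by simp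
    have A: "mA \<phi> a \<in> Gr Y ?t" "psi Y (mE \<phi> a) k \<in> Gr Y ?t" using e mor k by simp_all
    \<comment> \<open>The remainder is \<open>mA \<phi> a\<close>, which undoes the inverse attached
      by \<open>im_ed\<close>, times the image of \<open>k\<close> after sliding along the
      edge.\<close>
    have "im \<phi> (ed X a) \<star>[Y] lc Y ?t (mA \<phi> a \<odot>[Y,?t] psi Y (mE \<phi> a) k) =
       ed Y (mE \<phi> a) \<star>[Y] lc Y ?t (linv Y ?t (mA \<phi> a) \<odot>[Y,?t] (mA \<phi> a \<odot>[Y,?t] psi Y (mE \<phi> a) k))"
      using e mor A by (simp add: im_ed Y.pm_assoc Y.lc_mult[symmetric])
    also have "\<dots> = lc Y (mV \<phi> (org X a)) k \<star>[Y] ed Y (mE \<phi> a)"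
      unfolding Y_lc_ed[OF mor e(1) k] using e(1) mor A by simp
    finally show "lifts \<phi> \<sigma> k (ed Y b)"
      using e mor A unfolding lifts_def by (intro exI[of _ "ed X a"] exI[of _ "mA \<phi> a \<odot>[Y,?t] psi Y (mE \<phi> a) k"]) simp
  qed
next
  case (bd b)
  show ?case
  proof (intro ballI impI)
    fix \<sigma> k assume a: "\<sigma> \<in> vts X" "k \<in> Gr Y (src (bd Y b))" "mV \<phi> \<sigma> = src (bd Y b)"
    then have "trg Y b = mV \<phi> \<sigma>" "k \<in> Gr Y (mV \<phi> \<sigma>)" using bd by simp_all
    then obtain a g h where e: "a \<in> eds X" "mE \<phi> a = b" "trg X a = \<sigma>" "g \<in> Gr X \<sigma>"
      "h \<in> Gr Y (org Y b)" "k = mG \<phi> \<sigma> g \<odot>[Y,mV \<phi> \<sigma>] mA \<phi> a \<odot>[Y,mV \<phi> \<sigma>] psi Y b h"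
      using bl a(1) bd unfolding back_lifting_def by metis
    have b: "org Y b = mV \<phi> (org X a)" "trg Y b = mV \<phi> \<sigma>" using e mor by auto
    have cl: "mA \<phi> a \<in> Gr Y (mV \<phi> \<sigma>)" "psi Y b h \<in> Gr Y (mV \<phi> \<sigma>)" "mG \<phi> \<sigma> g \<in> Gr Y (mV \<phi> \<sigma>)" "mV \<phi> \<sigma> \<in> vts Y"
      using e mor b a(1) Y.psi_closed[OF bd e(5)] by (auto simp: b)
    have "lc Y (mV \<phi> \<sigma>) (psi Y b h) \<star>[Y] bd Y b = bd Y b \<star>[Y] (ed Y b \<star>[Y] lc Y (trg Y b) (psi Y b h)) \<star>[Y] bd Y b"
      using bd cl b by (simp add: Y.bd_ed Y.pm_assoc[symmetric])
    also have "\<dots> = bd Y b \<star>[Y] (lc Y (org Y b) h \<star>[Y] (ed Y b \<star>[Y] bd Y b))"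
      unfolding Y.lc_ed[OF bd e(5), symmetric] by (simp only: Y.pm_assoc)
    also have "\<dots> = bd Y b \<star>[Y] lc Y (org Y b) h"
      using bd e by (simp add: Y.ed_bd)
    finally have s: "lc Y (mV \<phi> \<sigma>) (psi Y b h) \<star>[Y] bd Y b = bd Y b \<star>[Y] lc Y (org Y b) h" .
    \<comment> \<open>Of the three factors of \<open>k\<close>, the first two combine with the
      backward edge into the image of an arrow of the source; the last slides through the edge and
      becomes the remainder \<open>h\<close>.\<close>
    have "lc Y (mV \<phi> \<sigma>) k \<star>[Y] bd Y b = im \<phi> (lc X \<sigma> g \<star>[X] bd X a) \<star>[Y] lc Y (org Y b) h"
      using cl e a(1) mor by (simp add: im_pm im_lc im_bd Y.lc_mult Y.pm_assoc s)
    then show "lifts \<phi> \<sigma> k (bd Y b)"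
      using e a(1) bd b unfolding lifts_def by (intro exI[of _ "lc X \<sigma> g \<star>[X] bd X a"] exI[of _ h]) simp
  qed
next
  case (mult y z)
  show ?case
  proof (intro ballI impI)
    fix \<sigma> k assume a: "\<sigma> \<in> vts X" "k \<in> Gr Y (src (y \<star>[Y] z))" "mV \<phi> \<sigma> = src (y \<star>[Y] z)"
    then have "lifts \<phi> \<sigma> k y" using mult by simp
    then obtain x h where x: "ar X x" "src x = \<sigma>" "mV \<phi> (tgt X x) = tgt Y y" "h \<in> Gr Y (tgt Y y)"
       "lc Y (src y) k \<star>[Y] y = im \<phi> x \<star>[Y] lc Y (tgt Y y) h" unfolding lifts_def by blast
    then have "lifts \<phi> (tgt X x) h z" using mult by simp
    then obtain x' h' where x': "ar X x'" "src x' = tgt X x" "mV \<phi> (tgt X x') = tgt Y z" "h' \<in> Gr Y (tgt Y z)"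
       "lc Y (src z) h \<star>[Y] z = im \<phi> x' \<star>[Y] lc Y (tgt Y z) h'" unfolding lifts_def by blast
    have "lc Y (src y) k \<star>[Y] (y \<star>[Y] z) = im \<phi> x \<star>[Y] (lc Y (src z) h \<star>[Y] z)"
      using x(5) mult(3) by (metis Y.pm_assoc)
    also have "\<dots> = im \<phi> (x \<star>[X] x') \<star>[Y] lc Y (tgt Y z) h'"
      using x x' mor by (simp add: im_pm Y.pm_assoc)
    finally show "lifts \<phi> \<sigma> k (y \<star>[Y] z)"
      using x x' mult unfolding lifts_def by (intro exI[of _ "x \<star>[X] x'"] exI[of _ h']) simp
  qed
qed

lemma lift_exists:
  assumes "cog_morphism X Y \<phi>" "back_lifting \<phi>" "ar Y y" "\<sigma> \<in> vts X" "src y = mV \<phi> \<sigma>"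
  obtains x h where "ar X x" "src x = \<sigma>" "mV \<phi> (tgt X x) = tgt Y y" "h \<in> Gr Y (tgt Y y)"
    "y = im \<phi> x \<star>[Y] lc Y (tgt Y y) h"
proof -
  have "lone Y (src y) \<in> Gr Y (src y)" using assms(3) by simp
  then obtain x h where "ar X x" "src x = \<sigma>" "mV \<phi> (tgt X x) = tgt Y y" "h \<in> Gr Y (tgt Y y)"
    "lc Y (src y) (lone Y (src y)) \<star>[Y] y = im \<phi> x \<star>[Y] lc Y (tgt Y y) h"
    using lift_exists_aux[OF assms(1-3)] assms(4,5) unfolding lifts_def by metis
  then show ?thesis using that assms(3) by simp
qed

end

section \<open>The coset bijection of a covering in terms of elements\<close>

locale covering_map = cog_pair X Y for X :: "('v, 'e, 'g) cog" and Y :: "('w, 'd, 'h) cog" +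
  fixes \<phi> :: "('v, 'e, 'g, 'w, 'd, 'h) cog_map"
  assumes covering: "cog_covering X Y \<phi>"
begin

abbreviation "fV \<equiv> mV \<phi>"
abbreviation "fE \<equiv> mE \<phi>"
abbreviation "fG \<equiv> mG \<phi>"
abbreviation "fA \<equiv> mA \<phi>"
abbreviation "fP \<equiv> im \<phi>"

lemma mor [simp]: "cog_morphism X Y \<phi>"
  using covering by (simp add: cog_covering_def)

lemma mG_inj: "\<sigma> \<in> vts X \<Longrightarrow> g \<in> Gr X \<sigma> \<Longrightarrow> h \<in> Gr X \<sigma> \<Longrightarrow> fG \<sigma> g = fG \<sigma> h \<Longrightarrow> g = h"
  using covering unfolding cog_covering_def by (auto dest: inj_onD)

lemma subgroup_psi_image:
  assumes "complex_of_groups Z" "a \<in> eds Z"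
  shows "subgroup (psi_image Z a) (grp Z (trg Z a))"
proof -
  interpret Z: complex_of_groups Z by fact
  have "group_hom (grp Z (org Z a)) (grp Z (trg Z a)) (psi Z a)"
    using assms(2) by (intro group_hom.intro group_hom_axioms.intro Z.psi_hom) (simp_all add: Z.local_group)
  then show ?thesis unfolding psi_image_def by (rule group_hom.img_is_subgroup)
qed

text \<open>Surjectivity of the coset map at the coset of \<open>y\<close>: membership of
  \<open>y\<close> in the image set unfolds into the required factorization.\<close>

lemma back_lifting: "back_lifting \<phi>"
  unfolding back_lifting_def
proof (intro ballI impI)
  fix \<sigma> b y
  assume a: "\<sigma> \<in> vts X" "b \<in> eds Y" "trg Y b = fV \<sigma>" "y \<in> Gr Y (fV \<sigma>)"
  let ?H = "grp Y (fV \<sigma>)"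
  interpret H: group ?H using a by (simp add: Y.local_group)
  have sg: "subgroup (psi_image Y b) ?H" using subgroup_psi_image[OF Y.complex_of_groups_axioms a(2)] a(3) by simp
  let ?F = "\<lambda>(a, C). (fG \<sigma> ` C #>\<^bsub>?H\<^esub> fA a) <#>\<^bsub>?H\<^esub> psi_image Y b"
  let ?D = "SIGMA a:{a \<in> eds X. fE a = b \<and> trg X a = \<sigma>}. lcosets\<^bsub>grp X \<sigma>\<^esub> (psi_image X a)"
  have "bij_betw ?F ?D (lcosets\<^bsub>?H\<^esub> (psi_image Y b))"
    using covering a unfolding cog_covering_def by blast
  moreover have "y <#\<^bsub>?H\<^esub> psi_image Y b \<in> lcosets\<^bsub>?H\<^esub> (psi_image Y b)"
    using a by (auto simp: LCOSETS_def)
  ultimately have "y <#\<^bsub>?H\<^esub> psi_image Y b \<in> ?F ` ?D" by (simp only: bij_betw_imp_surj_on)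
  then obtain x where x: "y <#\<^bsub>?H\<^esub> psi_image Y b = ?F x" "x \<in> ?D" by (rule imageE)
  have "y \<in> ?F x" using H.lcos_self[OF a(4) sg] unfolding x(1) .
  then obtain e C where e: "e \<in> eds X" "fE e = b" "trg X e = \<sigma>"
     "C \<in> lcosets\<^bsub>grp X \<sigma>\<^esub> (psi_image X e)" "y \<in> (fG \<sigma> ` C #>\<^bsub>?H\<^esub> fA e) <#>\<^bsub>?H\<^esub> psi_image Y b"
    using x(2) by auto
  then obtain c h where c: "c \<in> C" "h \<in> Gr Y (org Y b)" "y = fG \<sigma> c \<odot>[Y,fV \<sigma>] fA e \<odot>[Y,fV \<sigma>] psi Y b h"
    unfolding set_mult_def r_coset_def psi_image_def by auto
  have "subgroup (psi_image X e) (grp X \<sigma>)" using subgroup_psi_image[OF X.complex_of_groups_axioms e(1)] e(3) by simp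
  then have "c \<in> Gr X \<sigma>"
    using subgroup.lcosets_carrier[OF _ X.local_group[OF a(1)] e(4)] c(1) by blast
  then show "\<exists>a\<in>eds X. fE a = b \<and> trg X a = \<sigma> \<and>
        (\<exists>g\<in>Gr X \<sigma>. \<exists>h\<in>Gr Y (org Y b). y = fG \<sigma> g \<odot>[Y,fV \<sigma>] fA a \<odot>[Y,fV \<sigma>] psi Y b h)"
    using e c by blast
qed

text \<open>The injective half. The pairs formed by \<open>a'\<close> with the trivial coset and by
  \<open>a\<close> with the coset of \<open>g\<close> have images sharing an element, hence equal
  images; so the edges agree and the coset of \<open>g\<close> is trivial.\<close>

lemma edge_lift_unique:
  assumes e: "a \<in> eds X" "a' \<in> eds X" "fE a' = fE a" "trg X a' = trg X a"
    and g: "g \<in> Gr X (trg X a)" and h: "h \<in> Gr Y (org Y (fE a))" "h' \<in> Gr Y (org Y (fE a))"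
    and eq: "fA a' \<odot>[Y,fV (trg X a)] psi Y (fE a) h' =
       fG (trg X a) g \<odot>[Y,fV (trg X a)] fA a \<odot>[Y,fV (trg X a)] psi Y (fE a) h"
  shows "a' = a" "g \<in> psi_image X a"
proof -
  let ?s = "trg X a"
  let ?H = "grp Y (fV ?s)" and ?b = "fE a"
  let ?G = "grp X ?s"
  interpret H: group ?H using e by (simp add: Y.local_group)
  interpret G: group ?G using e by (simp add: X.local_group)
  have sgY: "subgroup (psi_image Y ?b) ?H" using subgroup_psi_image[OF Y.complex_of_groups_axioms, of ?b] e by simp
  have sgX: "subgroup (psi_image X a) ?G" "subgroup (psi_image X a') ?G"
    using subgroup_psi_image[OF X.complex_of_groups_axioms] e by force+
  let ?F = "\<lambda>(a, C). (fG ?s ` C #>\<^bsub>?H\<^esub> fA a) <#>\<^bsub>?H\<^esub> psi_image Y ?b"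
  let ?D = "SIGMA x:{x \<in> eds X. fE x = ?b \<and> trg X x = ?s}. lcosets\<^bsub>?G\<^esub> (psi_image X x)"
  have bij: "bij_betw ?F ?D (lcosets\<^bsub>?H\<^esub> (psi_image Y ?b))"
  proof -
    have "?s \<in> vts X" "?b \<in> eds Y" "trg Y ?b = fV ?s" using e by simp_all
    then show ?thesis using covering unfolding cog_covering_def by blast
  qed
  have D: "(a', \<one>\<^bsub>?G\<^esub> <#\<^bsub>?G\<^esub> psi_image X a') \<in> ?D" "(a, g <#\<^bsub>?G\<^esub> psi_image X a) \<in> ?D"
    using e g by (auto simp: LCOSETS_def)
  have m: "fG ?s c \<odot>[Y,fV ?s] fA x \<odot>[Y,fV ?s] psi Y ?b k \<in> ?F (x, C)"
    if "c \<in> C" "k \<in> Gr Y (org Y ?b)" for c C k x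
    using that unfolding set_mult_def r_coset_def psi_image_def by auto
  have "fA a' \<odot>[Y,fV ?s] psi Y ?b h' \<in> ?F (a', \<one>\<^bsub>?G\<^esub> <#\<^bsub>?G\<^esub> psi_image X a')"
    using m[OF G.lcos_self[OF _ sgX(2)] h(2), of "\<one>\<^bsub>?G\<^esub>" a'] e mor_simps(6)[OF mor e(2)] by simp
  moreover have "fA a' \<odot>[Y,fV ?s] psi Y ?b h' \<in> ?F (a, g <#\<^bsub>?G\<^esub> psi_image X a)"
    using m[OF G.lcos_self[OF g sgX(1)] h(1), of a] eq by simp
  moreover have "?F (a', \<one>\<^bsub>?G\<^esub> <#\<^bsub>?G\<^esub> psi_image X a') \<in> lcosets\<^bsub>?H\<^esub> (psi_image Y ?b)"
    "?F (a, g <#\<^bsub>?G\<^esub> psi_image X a) \<in> lcosets\<^bsub>?H\<^esub> (psi_image Y ?b)"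
    using bij_betwE[OF bij] D by blast+
  ultimately have "?F (a', \<one>\<^bsub>?G\<^esub> <#\<^bsub>?G\<^esub> psi_image X a') = ?F (a, g <#\<^bsub>?G\<^esub> psi_image X a)"
    using H.lcos_disjoint[OF sgY] by blast
  then have *: "(a', \<one>\<^bsub>?G\<^esub> <#\<^bsub>?G\<^esub> psi_image X a') = (a, g <#\<^bsub>?G\<^esub> psi_image X a)"
    using bij_betw_imp_inj_on[OF bij] D by (metis (no_types, lifting) inj_onD)
  then show "a' = a" by simp
  then have "\<one>\<^bsub>?G\<^esub> <#\<^bsub>?G\<^esub> psi_image X a = g <#\<^bsub>?G\<^esub> psi_image X a" using * by blast
  then have "g \<in> \<one>\<^bsub>?G\<^esub> <#\<^bsub>?G\<^esub> psi_image X a" using G.lcos_self[OF g sgX(1)] by blast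
  then show "g \<in> psi_image X a"
    using G.lcos_mult_one[OF subgroup.subset[OF sgX(1)]] by simp
qed

end

text \<open>Unique lifting comes from the right action of the groupoid of \<open>Y\<close> on classes of states
  \<open>(x, h)\<close>, where \<open>x\<close> starts at \<open>\<sigma>\<^sub>0\<close>, \<open>h\<close> lies over the end point of \<open>x\<close>, and \<open>(x k, h)\<close> is identified
  with \<open>(x, \<phi>(k) h)\<close>. An edge \<open>b\<close> acts by \<open>(x, h) \<cdot> b = (x a, \<phi>(a) \<psi>\<^sub>b(h))\<close>, where \<open>a\<close> is the lift of
  \<open>b\<close> at the end of \<open>x\<close>; the covering property says that this is a bijection on classes.\<close>

locale based_covering_map = covering_map X Y \<phi>
  for X :: "('v, 'e, 'g) cog" and Y :: "('w, 'd, 'h) cog" and \<phi> +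
  fixes \<sigma>\<^sub>0 :: 'v
  assumes base: "\<sigma>\<^sub>0 \<in> vts X"
begin

section \<open>The action of the target groupoid on classes of states\<close>

definition edge_lift :: "'v \<Rightarrow> 'd \<Rightarrow> 'e" where
  "edge_lift \<sigma> b = (THE a. a \<in> eds X \<and> org X a = \<sigma> \<and> fE a = b)"

lemma edge_lift:
  assumes "\<sigma> \<in> vts X" "b \<in> eds Y" "org Y b = fV \<sigma>"
  shows "edge_lift \<sigma> b \<in> eds X" "org X (edge_lift \<sigma> b) = \<sigma>" "fE (edge_lift \<sigma> b) = b"
proof -
  have bij: "bij_betw (fE) {a \<in> eds X. org X a = \<sigma>} {b \<in> eds Y. org Y b = fV \<sigma>}"
    by (rule mE_bij[OF mor assms(1)])
  have "b \<in> fE ` {a \<in> eds X. org X a = \<sigma>}"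
    using bij_betw_imp_surj_on[OF bij] assms by blast
  then have "\<exists>!a. a \<in> eds X \<and> org X a = \<sigma> \<and> fE a = b"
    using bij_betw_imp_inj_on[OF bij] by (auto dest: inj_onD)
  from theI'[OF this] show "edge_lift \<sigma> b \<in> eds X" "org X (edge_lift \<sigma> b) = \<sigma>" "fE (edge_lift \<sigma> b) = b"
    unfolding edge_lift_def by blast+
qed

lemma edge_lift_eq: "a \<in> eds X \<Longrightarrow> edge_lift (org X a) (fE a) = a"
  using mE_bij[OF mor, of "org X a"] edge_lift[of "org X a" "fE a"]
  by (auto simp: bij_betw_def dest: inj_onD)

lemma edge_lift_ter:
  assumes "\<sigma> \<in> vts X" "b \<in> eds Y" "org Y b = fV \<sigma>"
  shows "fV (trg X (edge_lift \<sigma> b)) = trg Y b"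
  using mor_simps(4)[OF mor edge_lift(1)[OF assms]] edge_lift(3)[OF assms] by simp

definition states :: "'w \<Rightarrow> (('v, 'e, 'g) cpath set \<times> 'h) set" where
  "states \<tau> = {(x, h). ar X x \<and> src x = \<sigma>\<^sub>0 \<and> fV (tgt X x) = \<tau> \<and> h \<in> Gr Y \<tau>}"

text \<open>An orbit of the local group at the end of \<open>x\<close>. The arrow
  \<open>\<phi>(x) h\<close> is constant along it: a class collects decompositions of one arrow that
  differ by a local factor, and unique lifting asserts that these are all of them.\<close>

definition state_class :: "('v, 'e, 'g) cpath set \<times> 'h \<Rightarrow> (('v, 'e, 'g) cpath set \<times> 'h) set" where
  "state_class s = (case s of (x, h) \<Rightarrow> {(x \<star>[X] lc X (tgt X x) k,
     linv Y (fV (tgt X x)) (fG (tgt X x) k) \<odot>[Y,fV (tgt X x)] h) | k. k \<in> Gr X (tgt X x)})"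

lemma state_class_eq_iff:
  assumes s: "(x, h) \<in> states \<tau>" and s': "(x', h') \<in> states \<tau>"
  shows "state_class (x, h) = state_class (x', h') \<longleftrightarrow>
    (\<exists>k\<in>Gr X (tgt X x). x' = x \<star>[X] lc X (tgt X x) k \<and> h = fG (tgt X x) k \<odot>[Y,\<tau>] h')"
    (is "?L \<longleftrightarrow> ?R")
proof
  have c: "ar X x" "src x = \<sigma>\<^sub>0" "fV (tgt X x) = \<tau>" "h \<in> Gr Y \<tau>" "ar X x'" "fV (tgt X x') = \<tau>" "h' \<in> Gr Y \<tau>"
    using s s' by (auto simp: states_def)
  have \<tau>: "\<tau> \<in> vts Y" using c by (metis X.tgt_vert mor mor_simps(1))
  interpret H: group "grp Y \<tau>" using \<tau> by (rule Y.local_group)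
  interpret G: group "grp X (tgt X x)" using c by (simp add: X.local_group)
  have G: "fG (tgt X x) k \<in> Gr Y \<tau>" if "k \<in> Gr X (tgt X x)" for k
    using mor_simps(5)[OF mor _ that] c by simp
  {
    assume ?L
    have "(x', h') \<in> state_class (x', h')"
      unfolding state_class_def using c \<tau>
      by (auto intro!: exI[of _ "lone X (tgt X x')"])
    then have "(x', h') \<in> state_class (x, h)" using \<open>?L\<close> by simp
    then obtain k where k: "k \<in> Gr X (tgt X x)" "x' = x \<star>[X] lc X (tgt X x) k" "h' = linv Y \<tau> (fG (tgt X x) k) \<odot>[Y,\<tau>] h"
      unfolding state_class_def using c by auto
    then have "h = fG (tgt X x) k \<odot>[Y,\<tau>] h'"
      using G[OF k(1)] c by (simp add: H.m_assoc[symmetric])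
    then show ?R using k by blast
  }
  {
    assume ?R
    then obtain k where k: "k \<in> Gr X (tgt X x)" and x': "x' = x \<star>[X] lc X (tgt X x) k" and h: "h = fG (tgt X x) k \<odot>[Y,\<tau>] h'"
      by blast
    have t: "tgt X x' = tgt X x" using k x' c by simp
    have f: "x' \<star>[X] lc X (tgt X x) l = x \<star>[X] lc X (tgt X x) (k \<odot>[X,tgt X x] l)"
       "linv Y \<tau> (fG (tgt X x) l) \<odot>[Y,\<tau>] h' = linv Y \<tau> (fG (tgt X x) (k \<odot>[X,tgt X x] l)) \<odot>[Y,\<tau>] h"
      if l: "l \<in> Gr X (tgt X x)" for l
    proof -
      show "x' \<star>[X] lc X (tgt X x) l = x \<star>[X] lc X (tgt X x) (k \<odot>[X,tgt X x] l)"
        using l k c x' by (simp add: X.lc_mult X.pm_assoc)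
      have "linv Y \<tau> (fG (tgt X x) (k \<odot>[X,tgt X x] l)) \<odot>[Y,\<tau>] h =
        linv Y \<tau> (fG (tgt X x) l) \<odot>[Y,\<tau>] (linv Y \<tau> (fG (tgt X x) k) \<odot>[Y,\<tau>] fG (tgt X x) k) \<odot>[Y,\<tau>] h'"
        using k l c \<tau> G[OF k] G[OF l] unfolding h by (simp add: mG_mult[OF mor] H.inv_mult_group H.m_assoc del: H.l_inv)
      then show "linv Y \<tau> (fG (tgt X x) l) \<odot>[Y,\<tau>] h' = linv Y \<tau> (fG (tgt X x) (k \<odot>[X,tgt X x] l)) \<odot>[Y,\<tau>] h"
        using k l c \<tau> G[OF k] G[OF l] by simp
    qed
    show ?L
    proof (intro subset_antisym subsetI)
      fix z assume "z \<in> state_class (x, h)"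
      then obtain l where l: "l \<in> Gr X (tgt X x)" "z = (x \<star>[X] lc X (tgt X x) l, linv Y \<tau> (fG (tgt X x) l) \<odot>[Y,\<tau>] h)"
        unfolding state_class_def using c by auto
      define m where "m = linv X (tgt X x) k \<odot>[X,tgt X x] l"
      have m: "m \<in> Gr X (tgt X x)" "k \<odot>[X,tgt X x] m = l"
        using k l(1) by (simp_all add: m_def G.m_assoc[symmetric])
      have "z = (x' \<star>[X] lc X (tgt X x') m, linv Y (fV (tgt X x')) (fG (tgt X x') m) \<odot>[Y,fV (tgt X x')] h')"
        unfolding t l(2) c(3) using f[OF m(1)] m(2) by simp
      then show "z \<in> state_class (x', h')" unfolding state_class_def using m(1) t by auto
    next
      fix z assume "z \<in> state_class (x', h')"
      then obtain l where l: "l \<in> Gr X (tgt X x)" "z = (x' \<star>[X] lc X (tgt X x) l, linv Y \<tau> (fG (tgt X x) l) \<odot>[Y,\<tau>] h')"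
        unfolding state_class_def using c t by auto
      then show "z \<in> state_class (x, h)" unfolding state_class_def using f[OF l(1)] k c(3) l(1) by auto
    qed
  }
qed

definition rmul :: "'w \<Rightarrow> 'h \<Rightarrow> ('v, 'e, 'g) cpath set \<times> 'h \<Rightarrow> ('v, 'e, 'g) cpath set \<times> 'h" where
  "rmul \<tau> g = (\<lambda>(x, h). (x, h \<odot>[Y,\<tau>] g))"

definition step :: "'d \<Rightarrow> ('v, 'e, 'g) cpath set \<times> 'h \<Rightarrow> ('v, 'e, 'g) cpath set \<times> 'h" where
  "step b = (\<lambda>(x, h). (x \<star>[X] ed X (edge_lift (tgt X x) b), fA (edge_lift (tgt X x) b) \<odot>[Y,trg Y b] psi Y b h))"

text \<open>A map on states is recorded as a relation between classes. Relations compose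
  associatively and have converses, so a backward edge can act before its action is known to be a
  map.\<close>

definition gph :: "'w \<Rightarrow> (('v, 'e, 'g) cpath set \<times> 'h \<Rightarrow> ('v, 'e, 'g) cpath set \<times> 'h)
    \<Rightarrow> ((('v, 'e, 'g) cpath set \<times> 'h) set \<times> (('v, 'e, 'g) cpath set \<times> 'h) set) set" where
  "gph \<tau> f = {(state_class s, state_class (f s)) | s. s \<in> states \<tau>}"

definition compatible :: "'w \<Rightarrow> (('v, 'e, 'g) cpath set \<times> 'h \<Rightarrow> ('v, 'e, 'g) cpath set \<times> 'h) \<Rightarrow> bool" where
  "compatible \<tau> f \<longleftrightarrow> (\<forall>s\<in>states \<tau>. \<forall>s'\<in>states \<tau>. state_class s = state_class s' \<longrightarrow> state_class (f s) = state_class (f s'))"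

lemma gphI: "s \<in> states \<tau> \<Longrightarrow> c = state_class s \<Longrightarrow> d = state_class (f s) \<Longrightarrow> (c, d) \<in> gph \<tau> f"
  unfolding gph_def by blast

text \<open>Compatibility of the second map is essential, since the class reached in the middle may
  be represented by a state outside the image of the first map.\<close>

lemma gph_comp:
  assumes "\<And>s. s \<in> states \<tau> \<Longrightarrow> f s \<in> states \<tau>'" "compatible \<tau>' f'"
  shows "gph \<tau> f O gph \<tau>' f' = gph \<tau> (\<lambda>s. f' (f s))"
proof (intro subset_antisym subrelI)
  fix c d assume "(c, d) \<in> gph \<tau> f O gph \<tau>' f'"
  then obtain s s' where "s \<in> states \<tau>" "s' \<in> states \<tau>'" "c = state_class s" "state_class (f s) = state_class s'" "d = state_class (f' s')"
    unfolding gph_def by blast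
  moreover from this have "state_class (f' (f s)) = state_class (f' s')" using assms unfolding compatible_def by blast
  ultimately show "(c, d) \<in> gph \<tau> (\<lambda>s. f' (f s))" by (intro gphI[of s]) simp_all
next
  fix c d assume "(c, d) \<in> gph \<tau> (\<lambda>s. f' (f s))"
  then show "(c, d) \<in> gph \<tau> f O gph \<tau>' f'" unfolding gph_def using assms(1) by blast
qed

lemma gph_eq: "(\<And>s. s \<in> states \<tau> \<Longrightarrow> state_class (f s) = state_class (f' s)) \<Longrightarrow> gph \<tau> f = gph \<tau> f'"
  unfolding gph_def by (intro Collect_cong) metis

text \<open>Well-definedness on classes keeps the composite inside the identity relation, and
  surjectivity on classes makes it all of it. In \<open>gph_conv_r\<close> injectivity on classes
  takes their place.\<close>

lemma gph_conv_l:
  assumes "\<And>s. s \<in> states \<tau> \<Longrightarrow> f s \<in> states \<tau>'" "compatible \<tau> f" "\<And>s'. s' \<in> states \<tau>' \<Longrightarrow> \<exists>s\<in>states \<tau>. state_class (f s) = state_class s'"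
  shows "(gph \<tau> f)\<inverse> O gph \<tau> f = gph \<tau>' (\<lambda>s. s)"
proof (intro subset_antisym subrelI)
  fix c d assume "(c, d) \<in> (gph \<tau> f)\<inverse> O gph \<tau> f"
  then obtain s s' where "s \<in> states \<tau>" "s' \<in> states \<tau>" "c = state_class (f s)" "state_class s = state_class s'" "d = state_class (f s')"
    unfolding gph_def by blast
  moreover from this have "state_class (f s) = state_class (f s')" using assms unfolding compatible_def by blast
  ultimately show "(c, d) \<in> gph \<tau>' (\<lambda>s. s)" using assms(1) by (intro gphI[of "f s"]) simp_all
next
  fix c d assume "(c, d) \<in> gph \<tau>' (\<lambda>s. s)"
  then obtain s' where "s' \<in> states \<tau>'" "c = state_class s'" "d = state_class s'" unfolding gph_def by blast
  moreover from this obtain s where "s \<in> states \<tau>" "state_class (f s) = state_class s'" using assms(3) by blast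
  ultimately have "(state_class s, c) \<in> gph \<tau> f" "(state_class s, d) \<in> gph \<tau> f" by (auto intro: gphI)
  then show "(c, d) \<in> (gph \<tau> f)\<inverse> O gph \<tau> f" by blast
qed

lemma gph_conv_r:
  assumes "\<And>s s'. s \<in> states \<tau> \<Longrightarrow> s' \<in> states \<tau> \<Longrightarrow> state_class (f s) = state_class (f s') \<Longrightarrow> state_class s = state_class s'"
  shows "gph \<tau> f O (gph \<tau> f)\<inverse> = gph \<tau> (\<lambda>s. s)"
proof (intro subset_antisym subrelI)
  fix c d assume "(c, d) \<in> gph \<tau> f O (gph \<tau> f)\<inverse>"
  then obtain s s' where "s \<in> states \<tau>" "s' \<in> states \<tau>" "c = state_class s" "state_class (f s) = state_class (f s')" "d = state_class s'"
    unfolding gph_def by blast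
  moreover from this have "state_class s = state_class s'" using assms by blast
  ultimately show "(c, d) \<in> gph \<tau> (\<lambda>s. s)" by (intro gphI[of s]) simp_all
next
  fix c d assume "(c, d) \<in> gph \<tau> (\<lambda>s. s)"
  then show "(c, d) \<in> gph \<tau> f O (gph \<tau> f)\<inverse>" unfolding gph_def by blast
qed

lemma rmul_states: "s \<in> states \<tau> \<Longrightarrow> g \<in> Gr Y \<tau> \<Longrightarrow> rmul \<tau> g s \<in> states \<tau>"
  by (auto simp: states_def rmul_def)

lemma step_states: "b \<in> eds Y \<Longrightarrow> s \<in> states (org Y b) \<Longrightarrow> step b s \<in> states (trg Y b)"
proof -
  assume b: "b \<in> eds Y" and s: "s \<in> states (org Y b)"
  obtain x h where x: "s = (x, h)" "ar X x" "src x = \<sigma>\<^sub>0" "fV (tgt X x) = org Y b" "h \<in> Gr Y (org Y b)"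
    using s by (auto simp: states_def)
  note e = edge_lift[OF X.tgt_vert[OF x(2)] b x(4)[symmetric]]
  have t: "fV (trg X (edge_lift (tgt X x) b)) = trg Y b"
    using edge_lift_ter[OF X.tgt_vert[OF x(2)] b] x by simp
  have "fA (edge_lift (tgt X x) b) \<in> Gr Y (trg Y b)" using mor_simps(6)[OF mor e(1)] t by simp
  then show ?thesis using x e t b by (simp add: states_def step_def)
qed

lemma compatible_rmul:
  assumes \<tau>: "\<tau> \<in> vts Y" and g: "g \<in> Gr Y \<tau>"
  shows "compatible \<tau> (rmul \<tau> g)"
  unfolding compatible_def
proof (intro ballI impI)
  fix s s' assume s: "s \<in> states \<tau>" "s' \<in> states \<tau>" "state_class s = state_class s'"
  obtain x h x' h' where x: "s = (x, h)" "s' = (x', h')" by (cases s; cases s')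
  obtain k where k: "k \<in> Gr X (tgt X x)" "x' = x \<star>[X] lc X (tgt X x) k" "h = fG (tgt X x) k \<odot>[Y,\<tau>] h'"
    using s state_class_eq_iff unfolding x by blast
  have c: "fG (tgt X x) k \<in> Gr Y \<tau>" "h' \<in> Gr Y \<tau>"
    using mor_simps(5)[OF mor _ k(1)] s x by (auto simp: states_def)
  have "h \<odot>[Y,\<tau>] g = fG (tgt X x) k \<odot>[Y,\<tau>] (h' \<odot>[Y,\<tau>] g)"
    using k c g \<tau> by (simp add: Y.l_assoc)
  then show "state_class (rmul \<tau> g s) = state_class (rmul \<tau> g s')"
    using rmul_states[OF s(1) g] rmul_states[OF s(2) g] k unfolding x rmul_def
    by (simp add: state_class_eq_iff) blast
qed

lemma step_eq:
  assumes b: "b \<in> eds Y" and s: "(x, h) \<in> states (org Y b)"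
  obtains a where "a \<in> eds X" "org X a = tgt X x" "fE a = b"
    "fV (trg X a) = trg Y b" "fV (org X a) = org Y b"
    "edge_lift (tgt X x) b = a"
    "step b (x, h) = (x \<star>[X] ed X a, fA a \<odot>[Y,trg Y b] psi Y b h)"
    "fA a \<in> Gr Y (trg Y b)" "psi Y b h \<in> Gr Y (trg Y b)"
proof -
  have x: "ar X x" "src x = \<sigma>\<^sub>0" "fV (tgt X x) = org Y b" "h \<in> Gr Y (org Y b)"
    using s by (auto simp: states_def)
  note e = edge_lift[OF X.tgt_vert[OF x(1)] b x(3)[symmetric]]
  have t: "fV (trg X (edge_lift (tgt X x) b)) = trg Y b"
    using edge_lift_ter[OF X.tgt_vert[OF x(1)] b] x by simp
  have "fA (edge_lift (tgt X x) b) \<in> Gr Y (trg Y b)" using mor_simps(6)[OF mor e(1)] t by simp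
  then show ?thesis using that[OF e t] x e b by (simp add: step_def)
qed

text \<open>Replacing \<open>x\<close> by \<open>x k\<close> changes the lifted arrow by the factor
  \<open>psi X a k\<close>; \<open>mA_psi\<close> moves the image of \<open>k\<close> past
  \<open>fA a\<close>, so that the second components differ by the image of exactly this
  factor.\<close>

lemma compatible_step:
  assumes b: "b \<in> eds Y"
  shows "compatible (org Y b) (step b)"
  unfolding compatible_def
proof (intro ballI impI)
  let ?i = "org Y b" and ?t = "trg Y b"
  fix s s' assume s: "s \<in> states ?i" "s' \<in> states ?i" "state_class s = state_class s'"
  obtain x h x' h' where x: "s = (x, h)" "s' = (x', h')" by (cases s; cases s')
  obtain k where k: "k \<in> Gr X (tgt X x)" "x' = x \<star>[X] lc X (tgt X x) k" "h = fG (tgt X x) k \<odot>[Y,?i] h'"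
    using s state_class_eq_iff unfolding x by blast
  have ax: "ar X x" "h' \<in> Gr Y ?i" using s x by (auto simp: states_def)
  have t: "tgt X x' = tgt X x" using k ax by simp
  obtain a where a: "a \<in> eds X" "org X a = tgt X x" "fE a = b"
    "fV (trg X a) = ?t" "fV (org X a) = ?i" "edge_lift (tgt X x) b = a"
    "step b (x, h) = (x \<star>[X] ed X a, fA a \<odot>[Y,?t] psi Y b h)"
    "fA a \<in> Gr Y ?t" "psi Y b h \<in> Gr Y ?t" using step_eq[OF b s(1)[unfolded x]] .
  obtain a' where a': "edge_lift (tgt X x') b = a'" "step b (x', h') = (x' \<star>[X] ed X a', fA a' \<odot>[Y,?t] psi Y b h')"
     "psi Y b h' \<in> Gr Y ?t"
    using step_eq[OF b s(2)[unfolded x]] by metis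
  have [simp]: "a' = a" using a' a t by simp
  have ka: "k \<in> Gr X (org X a)" using k a by simp
  have e1: "x' \<star>[X] ed X a = (x \<star>[X] ed X a) \<star>[X] lc X (trg X a) (psi X a k)"
    unfolding k(2) using X.lc_ed[OF a(1) ka] a(2) by (simp add: X.pm_assoc)
  have mk: "fG (org X a) k \<in> Gr Y ?i" "psi Y b (fG (org X a) k) \<in> Gr Y ?t"
      "fG (trg X a) (psi X a k) \<in> Gr Y ?t"
    using mor_simps(5)[OF mor _ ka] ax a b Y.psi_closed[OF b] mor_simps(5)[OF mor X.ter_vert[OF a(1)] X.psi_closed[OF a(1) ka]] by simp_all
  have "fA a \<odot>[Y,?t] psi Y b h = (fA a \<odot>[Y,?t] psi Y b (fG (org X a) k)) \<odot>[Y,?t] psi Y b h'"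
    unfolding k(3) using a ax b mk a' by (simp add: Y.psi_mult Y.l_assoc)
  also have "\<dots> = fG (trg X a) (psi X a k) \<odot>[Y,?t] (fA a \<odot>[Y,?t] psi Y b h')"
    using mA_psi[OF mor a(1) ka] a a' b mk by (simp add: Y.l_assoc)
  finally have e2: "fA a \<odot>[Y,?t] psi Y b h = fG (trg X a) (psi X a k) \<odot>[Y,?t] (fA a \<odot>[Y,?t] psi Y b h')" .
  have tg: "tgt X (x \<star>[X] ed X a) = trg X a" using ax a(1,2) by simp
  have m: "step b (x', h') = (x' \<star>[X] ed X a, fA a \<odot>[Y,?t] psi Y b h')" using a'(2) by simp
  show "state_class (step b s) = state_class (step b s')"
    using state_class_eq_iff[OF step_states[OF b s(1), unfolded x a(7)] step_states[OF b s(2), unfolded x m], unfolded tg]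
      e1 e2 X.psi_closed[OF a(1) ka] unfolding x a(7) m by blast
qed

text \<open>Equality of the resulting classes gives a local \<open>k\<close> at the end of the
  lifted edge. By \<open>edge_lift_unique\<close> the two lifted edges coincide and \<open>k\<close>
  comes from an \<open>l\<close> before the edge, and this \<open>l\<close> identifies the original
  states.\<close>

lemma inj_step:
  assumes b: "b \<in> eds Y" and s: "s \<in> states (org Y b)" "s' \<in> states (org Y b)"
    and eq: "state_class (step b s) = state_class (step b s')"
  shows "state_class s = state_class s'"
proof -
  let ?i = "org Y b" and ?t = "trg Y b"
  obtain x h x' h' where x: "s = (x, h)" "s' = (x', h')" by (cases s; cases s')
  have ax: "ar X x" "h \<in> Gr Y ?i" "ar X x'" "h' \<in> Gr Y ?i" using s x by (auto simp: states_def)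
  obtain a where a: "a \<in> eds X" "org X a = tgt X x" "fE a = b"
    "fV (trg X a) = ?t" "fV (org X a) = ?i" "edge_lift (tgt X x) b = a"
    "step b (x, h) = (x \<star>[X] ed X a, fA a \<odot>[Y,?t] psi Y b h)"
    "fA a \<in> Gr Y ?t" "psi Y b h \<in> Gr Y ?t" using step_eq[OF b s(1)[unfolded x]] .
  obtain a' where a': "a' \<in> eds X" "org X a' = tgt X x'" "fE a' = b"
    "fV (trg X a') = ?t" "fV (org X a') = ?i" "edge_lift (tgt X x') b = a'"
    "step b (x', h') = (x' \<star>[X] ed X a', fA a' \<odot>[Y,?t] psi Y b h')"
    "fA a' \<in> Gr Y ?t" "psi Y b h' \<in> Gr Y ?t" using step_eq[OF b s(2)[unfolded x]] .
  have "tgt X (x \<star>[X] ed X a) = trg X a" using ax a by simp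
  moreover have "state_class (x \<star>[X] ed X a, fA a \<odot>[Y,?t] psi Y b h) = state_class (x' \<star>[X] ed X a', fA a' \<odot>[Y,?t] psi Y b h')"
    using eq unfolding x a(7) a'(7) .
  ultimately obtain k where k: "k \<in> Gr X (trg X a)" "x' \<star>[X] ed X a' = (x \<star>[X] ed X a) \<star>[X] lc X (trg X a) k"
    "fA a \<odot>[Y,?t] psi Y b h = fG (trg X a) k \<odot>[Y,?t] (fA a' \<odot>[Y,?t] psi Y b h')"
    using state_class_eq_iff[OF step_states[OF b s(1), unfolded x a(7)] step_states[OF b s(2), unfolded x a'(7)]] by auto
  have tt: "trg X a' = trg X a"
  proof -
    have "tgt X (x' \<star>[X] ed X a') = tgt X ((x \<star>[X] ed X a) \<star>[X] lc X (trg X a) k)" using k(2) by simp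
    then show ?thesis using ax a(1,2) a'(1,2) k(1) by simp
  qed
  have mk: "fG (trg X a) k \<in> Gr Y ?t" using mor_simps(5)[OF mor X.ter_vert[OF a(1)] k(1)] a(4) by simp
  have t: "?t \<in> vts Y" using b by simp
  have a'b: "fV (trg X a') = ?t" "fE a' = b" by (rule a'(4), rule a'(3))
  have eq1: "fA a \<odot>[Y,fV (trg X a')] psi Y (fE a') h =
     fG (trg X a') k \<odot>[Y,fV (trg X a')] fA a' \<odot>[Y,fV (trg X a')] psi Y (fE a') h'"
    unfolding a'b k(3) using mk t a' tt by (simp add: Y.l_assoc)
  have pr: "fE a = fE a'" "trg X a = trg X a'" "k \<in> Gr X (trg X a')"
    "h' \<in> Gr Y (org Y (fE a'))" "h \<in> Gr Y (org Y (fE a'))"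
    unfolding a'(3) a(3) tt by (simp, simp, rule k(1), rule ax(4), rule ax(2))
  have aa: "a = a'" and "k \<in> psi_image X a'"
    using edge_lift_unique[OF a'(1) a(1) pr eq1] by blast+
  then obtain l where l: "l \<in> Gr X (org X a)" "k = psi X a l" by (auto simp: psi_image_def)
  have ml: "fG (org X a) l \<in> Gr Y ?i" using mor_simps(5)[OF mor _ l(1)] ax a by simp
  then have pl: "psi Y b (fG (org X a) l) \<in> Gr Y ?t" using b by simp
  have "fA a \<odot>[Y,?t] psi Y b h = fG (trg X a) (psi X a l) \<odot>[Y,?t] fA a \<odot>[Y,?t] psi Y b h'"
    using k(3) mk t a' unfolding l(2) aa by (simp add: Y.l_assoc)
  also have "\<dots> = fA a \<odot>[Y,?t] psi Y b (fG (org X a) l) \<odot>[Y,?t] psi Y b h'"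
    using mA_psi[OF mor a(1) l(1)] a by simp
  also have "\<dots> = fA a \<odot>[Y,?t] psi Y b (fG (org X a) l \<odot>[Y,?i] h')"
    using t a a' pl ml ax b by (simp add: Y.psi_mult Y.l_assoc)
  finally have "linv Y ?t (fA a) \<odot>[Y,?t] (fA a \<odot>[Y,?t] psi Y b h) = linv Y ?t (fA a) \<odot>[Y,?t] (fA a \<odot>[Y,?t] psi Y b (fG (org X a) l \<odot>[Y,?i] h'))"
    by (rule arg_cong)
  \<comment> \<open>The equation has been moved to the start of the edge; injectivity of the edge
    homomorphism then removes \<open>psi\<close>.\<close>
  then have "psi Y b h = psi Y b (fG (org X a) l \<odot>[Y,?i] h')"
    using t a(8) b ax ml by simp
  then have hh: "h = fG (tgt X x) l \<odot>[Y,?i] h'"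
    using Y.psi_inj[OF b] ax ml b a(2) by (auto dest!: inj_onD)
  have "x' \<star>[X] ed X a = x \<star>[X] lc X (tgt X x) l \<star>[X] ed X a"
    using k(2) X.lc_ed[OF a(1) l(1)] unfolding l(2) aa[symmetric] a(2) by (simp add: X.pm_assoc)
  then have "x' = x \<star>[X] lc X (tgt X x) l"
    by (rule X.pm_right_cancel[rotated -1]) (use ax a a' aa l in simp_all)
  then show ?thesis using s hh l a(2) unfolding x by (simp add: state_class_eq_iff) blast
qed

text \<open>\<open>back_lifting\<close> factors \<open>h\<close> through some edge \<open>a\<close>
  over \<open>b\<close>. Walking back along the first factor and along \<open>a\<close> gives a
  preimage whose second component is the last factor.\<close>

lemma surj_step:
  assumes b: "b \<in> eds Y" and s: "s \<in> states (trg Y b)"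
  shows "\<exists>s'\<in>states (org Y b). state_class (step b s') = state_class s"
proof -
  let ?i = "org Y b" and ?t = "trg Y b"
  obtain x h where x: "s = (x, h)" "ar X x" "src x = \<sigma>\<^sub>0" "fV (tgt X x) = ?t" "h \<in> Gr Y ?t"
    using s by (auto simp: states_def)
  obtain a g l where a: "a \<in> eds X" "fE a = b" "trg X a = tgt X x" "g \<in> Gr X (tgt X x)" "l \<in> Gr Y ?i"
     "h = fG (tgt X x) g \<odot>[Y,?t] fA a \<odot>[Y,?t] psi Y b l"
    using back_lifting x b X.tgt_vert[OF x(2)] unfolding back_lifting_def by (metis (no_types, lifting))
  let ?y = "x \<star>[X] lc X (tgt X x) g \<star>[X] bd X a"
  have y: "ar X ?y" "src ?y = \<sigma>\<^sub>0" "tgt X ?y = org X a" using a x by simp_all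
  have i: "fV (org X a) = ?i" using mor_simps(3)[OF mor a(1)] a(2) by simp
  have s': "(?y, l) \<in> states ?i" unfolding states_def using y i a(5) by simp
  have edge_lift: "edge_lift (org X a) b = a" using edge_lift_eq[OF a(1)] a(2) by simp
  have xx: "?y \<star>[X] ed X a = x \<star>[X] lc X (tgt X x) g"
    using a(1,3,4) x by (simp add: X.pm_assoc X.bd_ed)
  have step: "step b (?y, l) = (x \<star>[X] lc X (tgt X x) g, fA a \<odot>[Y,?t] psi Y b l)"
    unfolding step_def by (simp add: y(3) edge_lift xx)
  have cl: "fG (tgt X x) g \<in> Gr Y ?t" "fA a \<in> Gr Y ?t" "psi Y b l \<in> Gr Y ?t"
    using mor_simps(5)[OF mor _ a(4)] mor_simps(6)[OF mor a(1)] x a b by simp_all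
  have h: "h = fG (tgt X x) g \<odot>[Y,?t] (fA a \<odot>[Y,?t] psi Y b l)"
    unfolding a(6) using cl b by (simp add: Y.l_assoc)
  have "state_class (x, h) = state_class (step b (?y, l))"
    using state_class_eq_iff[OF s[unfolded x(1)] step_states[OF b s', unfolded step]] a(4) h unfolding step by blast
  then show ?thesis using s' x(1) by metis
qed

text \<open>The covering property supplies the invertibility relations through
  \<open>inj_step\<close> and \<open>surj_step\<close>; the slide and composition relations hold by
  the algebra of \<open>psi\<close> and of the twists.\<close>

lemma action_valuation:
  "path_valuation Y (O) (\<lambda>\<tau> g. gph \<tau> (rmul \<tau> g)) (\<lambda>b. gph (org Y b) (step b)) (\<lambda>b. (gph (org Y b) (step b))\<inverse>)"
proof (unfold_locales, goal_cases)
  case 1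
  then show ?case by (rule O_assoc)
next
  case (2 \<tau> g h)
  then have "gph \<tau> (rmul \<tau> g) O gph \<tau> (rmul \<tau> h) = gph \<tau> (\<lambda>s. rmul \<tau> h (rmul \<tau> g s))"
    by (intro gph_comp compatible_rmul rmul_states)
  also have "\<dots> = gph \<tau> (rmul \<tau> (g \<odot>[Y,\<tau>] h))"
    using 2 by (intro gph_eq arg_cong[of _ _ state_class]) (auto simp: rmul_def states_def Y.l_assoc)
  finally show ?case by simp
next
  case (3 b g)
  let ?i = "org Y b" and ?t = "trg Y b"
  have "gph ?i (rmul ?i g) O gph ?i (step b) = gph ?i (\<lambda>s. step b (rmul ?i g s))"
    using 3 by (intro gph_comp compatible_step rmul_states)
  also have "\<dots> = gph ?i (\<lambda>s. rmul ?t (psi Y b g) (step b s))"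
  proof (intro gph_eq arg_cong[of _ _ state_class])
    fix s assume s: "s \<in> states ?i"
    obtain x h where x: "s = (x, h)" by (cases s)
    then have "h \<in> Gr Y ?i" using s by (simp add: states_def)
    moreover obtain a where "edge_lift (tgt X x) b = a" "fA a \<in> Gr Y ?t" using step_eq[OF 3(1) s[unfolded x]] by metis
    ultimately show "step b (rmul ?i g s) = rmul ?t (psi Y b g) (step b s)"
      using 3 unfolding x by (simp add: rmul_def step_def Y.psi_mult Y.l_assoc)
  qed
  also have "\<dots> = gph ?i (step b) O gph ?t (rmul ?t (psi Y b g))"
    using 3 by (intro gph_comp[symmetric] compatible_rmul step_states) auto
  finally show ?case .
next
  case (4 b)
  let ?i = "org Y b" and ?t = "trg Y b"
  have "gph ?i (step b) O gph ?t (rmul ?t (lone Y ?t)) = gph ?i (\<lambda>s. rmul ?t (lone Y ?t) (step b s))"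
    using 4 by (intro gph_comp compatible_rmul step_states) auto
  also have "\<dots> = gph ?i (step b)"
    using step_states[OF 4] 4 by (intro gph_eq arg_cong[of _ _ state_class]) (fastforce simp: rmul_def states_def)
  finally show ?case .
next
  case (5 b)
  let ?i = "org Y b"
  have "gph ?i (rmul ?i (lone Y ?i)) = gph ?i (\<lambda>s. s)"
    using 5 by (intro gph_eq arg_cong[of _ _ state_class]) (auto simp: rmul_def states_def)
  moreover have "(gph ?i (step b))\<inverse> O gph ?i (\<lambda>s. s) = (gph ?i (step b))\<inverse>"
    unfolding gph_def by auto
  ultimately show ?case by simp
next
  case (6 b)
  let ?i = "org Y b"
  have "gph ?i (rmul ?i (lone Y ?i)) = gph ?i (\<lambda>s. s)"
    using 6 by (intro gph_eq arg_cong[of _ _ state_class]) (auto simp: rmul_def states_def)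
  then show ?case using gph_conv_r[OF inj_step[OF 6]] by simp
next
  case (7 b)
  let ?t = "trg Y b"
  have "gph ?t (rmul ?t (lone Y ?t)) = gph ?t (\<lambda>s. s)"
    using 7 by (intro gph_eq arg_cong[of _ _ state_class]) (auto simp: rmul_def states_def)
  then show ?case using gph_conv_l[OF step_states[OF 7] compatible_step[OF 7] surj_step[OF 7]] by simp
next
  case (8 a b)
  let ?c = "cpo Y a b" and ?i = "org Y b" and ?t = "trg Y a"
  let ?g = "twist Y a b"
  have c: "?c \<in> eds Y" "org Y ?c = ?i" "trg Y ?c = ?t" "?g \<in> Gr Y ?t"
    using 8 by (simp_all add: Y.cmp_closed Y.ini_cmp Y.ter_cmp Y.twist_closed)
  have t: "?t \<in> vts Y" using 8 by simp
  have bs: "step b s \<in> states (org Y a)" if "s \<in> states ?i" for s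
    using step_states[OF 8(2) that] 8(3) by simp
  have "gph ?i (step b) O gph (org Y a) (step a) = gph ?i (\<lambda>s. step a (step b s))"
    by (intro gph_comp compatible_step 8 bs)
  also have "\<dots> = gph ?i (\<lambda>s. rmul ?t (linv Y ?t ?g) (step ?c s))"
  proof (rule gph_eq)
    fix s assume s: "s \<in> states ?i"
    obtain x h where x: "s = (x, h)" "ar X x" "src x = \<sigma>\<^sub>0" "fV (tgt X x) = ?i" "h \<in> Gr Y ?i"
      using s by (auto simp: states_def)
    obtain b' where b': "b' \<in> eds X" "org X b' = tgt X x" "fE b' = b"
      "fV (trg X b') = trg Y b" "fV (org X b') = ?i" "edge_lift (tgt X x) b = b'"
      "step b (x, h) = (x \<star>[X] ed X b', fA b' \<odot>[Y,trg Y b] psi Y b h)"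
      "fA b' \<in> Gr Y (trg Y b)" "psi Y b h \<in> Gr Y (trg Y b)" using step_eq[OF 8(2) s[unfolded x(1)]] .
    have tb: "tgt X (x \<star>[X] ed X b') = trg X b'" using x b' by simp
    obtain a' where a': "a' \<in> eds X" "org X a' = trg X b'" "fE a' = a"
      "fV (trg X a') = ?t" "edge_lift (trg X b') a = a'"
      "step a (step b s) = (x \<star>[X] ed X b' \<star>[X] ed X a', fA a' \<odot>[Y,?t] psi Y a (fA b' \<odot>[Y,trg Y b] psi Y b h))"
      "fA a' \<in> Gr Y ?t"
      using step_eq[OF 8(1) bs[OF s, unfolded x(1) b'(7)]] tb unfolding x(1) b'(7) by metis
    let ?c' = "cpo X a' b'" and ?g' = "twist X a' b'"
    have c': "?c' \<in> eds X" "org X ?c' = tgt X x" "trg X ?c' = trg X a'" "?g' \<in> Gr X (trg X a')"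
      "fE ?c' = ?c"
      using a' b' by (simp_all add: X.cmp_closed X.ini_cmp X.ter_cmp X.twist_closed mE_cmp)
    \<comment> \<open>The composite of the lifts starts at the right vertex and lies over
      \<open>?c\<close>, so it is the lift of \<open>?c\<close>.\<close>
    have elc: "edge_lift (tgt X x) ?c = ?c'" using edge_lift_eq[OF c'(1)] c' by simp
    have R: "rmul ?t (linv Y ?t ?g) (step ?c s) = (x \<star>[X] ed X ?c', fA ?c' \<odot>[Y,?t] psi Y ?c h \<odot>[Y,?t] linv Y ?t ?g)"
      unfolding x(1) rmul_def step_def by (simp add: elc c(3))
    have cl: "psi Y ?c h \<in> Gr Y ?t" "fA ?c' \<in> Gr Y ?t" "fG (trg X a') ?g' \<in> Gr Y ?t"
       "psi Y a (fA b') \<in> Gr Y ?t" "psi Y a (psi Y b h) \<in> Gr Y ?t"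
      using Y.psi_closed[OF c(1)] c x mor_simps(6)[OF mor c'(1)] c' a' b' mor_simps(5)[OF mor X.ter_vert[OF a'(1)] c'(4)]
        Y.psi_closed[OF 8(1)] 8 by simp_all
    have tgt: "tgt X (x \<star>[X] ed X b' \<star>[X] ed X a') = trg X a'" using x b' a' by simp
    have xx: "x \<star>[X] ed X ?c' = (x \<star>[X] ed X b' \<star>[X] ed X a') \<star>[X] lc X (trg X a') ?g'"
    proof -
      have "ed X b' \<star>[X] ed X a' \<star>[X] lc X (trg X a') ?g' = ed X ?c'"
        using X.ed_ed[OF a'(1) b'(1) a'(2)] a' c' by (simp add: X.pm_assoc X.lc_mult[symmetric])
      then show ?thesis by (metis X.pm_assoc)
    qed
    have tw: "?g \<odot>[Y,?t] psi Y ?c h \<odot>[Y,?t] linv Y ?t ?g = psi Y a (psi Y b h)"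
      using Y.twist_psi[OF 8 x(5)] by (simp add: conj_by_def)
    have "fG (trg X a') ?g' \<odot>[Y,?t] (fA ?c' \<odot>[Y,?t] psi Y ?c h \<odot>[Y,?t] linv Y ?t ?g) =
       (fG (trg X a') ?g' \<odot>[Y,?t] fA ?c') \<odot>[Y,?t] (psi Y ?c h \<odot>[Y,?t] linv Y ?t ?g)"
      using cl c t by (simp add: Y.l_assoc)
    also have "\<dots> = (fA a' \<odot>[Y,?t] psi Y a (fA b') \<odot>[Y,?t] ?g) \<odot>[Y,?t] (psi Y ?c h \<odot>[Y,?t] linv Y ?t ?g)"
      using mA_twist[OF mor a'(1) b'(1) a'(2)] a' b' by simp
    also have "\<dots> = fA a' \<odot>[Y,?t] psi Y a (fA b') \<odot>[Y,?t] psi Y a (psi Y b h)"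
      unfolding tw[symmetric] using cl c t a' by (simp add: Y.l_assoc)
    also have "\<dots> = fA a' \<odot>[Y,?t] psi Y a (fA b' \<odot>[Y,trg Y b] psi Y b h)"
      using Y.psi_mult[OF 8(1), of "fA b'" "psi Y b h"] 8 b' a' cl t by (simp add: Y.l_assoc)
    finally have hh: "fA a' \<odot>[Y,?t] psi Y a (fA b' \<odot>[Y,trg Y b] psi Y b h) =
       fG (trg X a') ?g' \<odot>[Y,?t] (fA ?c' \<odot>[Y,?t] psi Y ?c h \<odot>[Y,?t] linv Y ?t ?g)" ..
    have sa: "step a (step b s) \<in> states ?t" by (rule step_states[OF 8(1) bs[OF s]])
    have sc: "rmul ?t (linv Y ?t ?g) (step ?c s) \<in> states ?t"
      using rmul_states[of "step ?c s" ?t] step_states[OF c(1)] c s t by simp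
    \<comment> \<open>The two states differ by the source twist \<open>?g'\<close>, which appears
      when the lifted edges are composed; \<open>hh\<close> says that its image accounts for the
      target twist.\<close>
    show "state_class (step a (step b s)) = state_class (rmul ?t (linv Y ?t ?g) (step ?c s))"
      using state_class_eq_iff[OF sa[unfolded a'(6)] sc[unfolded R], unfolded tgt] c'(4) xx hh unfolding a'(6) R by blast
  qed
  also have "\<dots> = gph ?i (step ?c) O gph ?t (rmul ?t (linv Y ?t ?g))"
  proof (rule gph_comp[symmetric])
    show "compatible ?t (rmul ?t (linv Y ?t ?g))" using t c(4) by (intro compatible_rmul) auto
    show "step ?c s \<in> states ?t" if "s \<in> states ?i" for s using step_states[OF c(1)] that c(2,3) by simp
  qed
  finally show ?case using c by simp
qed

interpretation act: path_valuation Y "(O)" "\<lambda>\<tau> g. gph \<tau> (rmul \<tau> g)" "\<lambda>b. gph (org Y b) (step b)"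
  "\<lambda>b. (gph (org Y b) (step b))\<inverse>"
  by (rule action_valuation)

lemma gph_single_valued:
  assumes "compatible \<tau> f"
  shows "single_valued (gph \<tau> f)"
proof (rule single_valuedI)
  fix c d e assume "(c, d) \<in> gph \<tau> f" "(c, e) \<in> gph \<tau> f"
  then obtain s s' where s: "s \<in> states \<tau>" "s' \<in> states \<tau>" "state_class s = state_class s'" and de: "d = state_class (f s)" "e = state_class (f s')"
    unfolding gph_def by blast
  show "d = e" unfolding de using assms s unfolding compatible_def by blast
qed

text \<open>A backward edge acts by a converse relation, which is single-valued because
  \<open>step\<close> is injective on classes.\<close>

lemma act_single_valued: "ar Y y \<Longrightarrow> single_valued (act.evc y)"
proof (induction rule: Y.arr_induct)
  case (lc \<tau> g)
  then show ?case by (simp add: act.evc_lc gph_single_valued compatible_rmul)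
next
  case (ed b)
  then show ?case by (simp add: act.evc_ed gph_single_valued compatible_step)
next
  case (bd b)
  show ?case unfolding act.evc_bd[OF bd]
  proof (rule single_valuedI)
    fix c d e assume "(c, d) \<in> (gph (org Y b) (step b))\<inverse>" "(c, e) \<in> (gph (org Y b) (step b))\<inverse>"
    then obtain s s' where s: "s \<in> states (org Y b)" "s' \<in> states (org Y b)" "state_class (step b s) = state_class (step b s')"
      and de: "d = state_class s" "e = state_class s'"
      unfolding gph_def by blast
    show "d = e" unfolding de by (rule inj_step[OF bd s])
  qed
next
  case (mult y z)
  then show ?case by (simp add: act.evc_pm single_valued_relcomp)
qed

text \<open>On states with trivial second component, the action of \<open>fP z\<close> should be
  right multiplication by \<open>z\<close> in the groupoid of the source.\<close>

definition carries :: "('v, 'e, 'g) cpath set \<Rightarrow> ('v, 'e, 'g) cpath set \<Rightarrow> bool" where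
  "carries x z \<longleftrightarrow> (state_class (x, lone Y (fV (src z))), state_class (x \<star>[X] z, lone Y (fV (tgt X z)))) \<in> act.evc (fP z)"

text \<open>For a local element, the state with second component \<open>fG \<sigma> g\<close> is
  identified with the one whose arrow is extended by \<open>g\<close>. For an edge, the element
  \<open>fA a\<close> produced by \<open>step\<close> cancels the inverse in \<open>im_ed\<close>,
  and dually for \<open>im_bd\<close>.\<close>

lemma act_im:
  assumes "ar X z"
  shows "\<forall>x. ar X x \<and> src x = \<sigma>\<^sub>0 \<and> tgt X x = src z \<longrightarrow>
    carries x z"
  using assms
proof (induction rule: X.arr_induct)
  case (lc \<sigma> g)
  show ?case
  proof (intro allI impI)
    fix x assume x: "ar X x \<and> src x = \<sigma>\<^sub>0 \<and> tgt X x = src (lc X \<sigma> g)"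
    let ?\<tau> = "fV \<sigma>"
    have v: "?\<tau> \<in> vts Y" and g: "fG \<sigma> g \<in> Gr Y ?\<tau>" using lc by simp_all
    have e: "act.evc (fP (lc X \<sigma> g)) = gph ?\<tau> (rmul ?\<tau> (fG \<sigma> g))"
      using lc v g by (simp add: im_lc[OF mor] act.evc_lc)
    have 1: "(x, lone Y ?\<tau>) \<in> states ?\<tau>" and 2: "(x, fG \<sigma> g) \<in> states ?\<tau>"
      and 3: "(x \<star>[X] lc X \<sigma> g, lone Y ?\<tau>) \<in> states ?\<tau>" and t: "tgt X x = \<sigma>"
      using x lc v g by (auto simp: states_def)
    have "state_class (x, fG \<sigma> g) = state_class (x \<star>[X] lc X \<sigma> g, lone Y ?\<tau>)"
      using state_class_eq_iff[OF 2 3] lc v g t by auto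
    then show "carries x (lc X \<sigma> g)"
      unfolding carries_def e using lc 1 v g by (intro gphI[of "(x, lone Y ?\<tau>)"]) (simp_all add: rmul_def)
  qed
next
  case (ed a)
  show ?case
  proof (intro allI impI)
    fix x assume x: "ar X x \<and> src x = \<sigma>\<^sub>0 \<and> tgt X x = src (ed X a)"
    let ?i = "fV (org X a)" and ?t = "fV (trg X a)"
    have v: "?i \<in> vts Y" "?t \<in> vts Y" "fA a \<in> Gr Y ?t" "fE a \<in> eds Y" using ed by simp_all
    have 1: "(x, lone Y ?i) \<in> states ?i" and t: "tgt X x = org X a"
      using x ed v by (auto simp: states_def)
    have step: "step (fE a) (x, lone Y ?i) = (x \<star>[X] ed X a, fA a)"
      unfolding step_def using t edge_lift_eq[OF ed] Y.psi_one[OF v(4)] v ed by simp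
    have e: "act.evc (fP (ed X a)) = gph ?i (step (fE a)) O gph ?t (rmul ?t (linv Y ?t (fA a)))"
      using ed v by (simp add: im_ed[OF mor] act.evc_pm act.evc_lc act.evc_ed)
    have "(state_class (x, lone Y ?i), state_class (x \<star>[X] ed X a, fA a)) \<in> gph ?i (step (fE a))"
      by (rule gphI[OF 1]) (simp_all add: step)
    moreover have "(state_class (x \<star>[X] ed X a, fA a), state_class (x \<star>[X] ed X a, lone Y ?t)) \<in> gph ?t (rmul ?t (linv Y ?t (fA a)))"
      using step_states[OF v(4), of "(x, lone Y ?i)"] 1 ed v by (intro gphI[of "(x \<star>[X] ed X a, fA a)"]) (simp_all add: step rmul_def)
    ultimately show "carries x (ed X a)"
      unfolding carries_def e using ed by auto
  qed
next
  case (bd a)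
  show ?case
  proof (intro allI impI)
    fix x assume x: "ar X x \<and> src x = \<sigma>\<^sub>0 \<and> tgt X x = src (bd X a)"
    let ?i = "fV (org X a)" and ?t = "fV (trg X a)"
    have v: "?i \<in> vts Y" "?t \<in> vts Y" "fA a \<in> Gr Y ?t" "fE a \<in> eds Y" using bd by simp_all
    let ?y = "x \<star>[X] bd X a"
    have 1: "(x, lone Y ?t) \<in> states ?t" "(?y, lone Y ?i) \<in> states ?i" and t: "tgt X ?y = org X a"
      using x bd v by (auto simp: states_def)
    have step: "step (fE a) (?y, lone Y ?i) = (x, fA a)"
      unfolding step_def using t x edge_lift_eq[OF bd] Y.psi_one[OF v(4)] v bd by (simp add: X.pm_assoc X.bd_ed)
    have e: "act.evc (fP (bd X a)) = gph ?t (rmul ?t (fA a)) O (gph ?i (step (fE a)))\<inverse>"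
      using bd v by (simp add: im_bd[OF mor] act.evc_pm act.evc_lc act.evc_bd)
    have "(state_class (?y, lone Y ?i), state_class (x, fA a)) \<in> gph ?i (step (fE a))"
      by (rule gphI[OF 1(2)]) (simp_all add: step)
    moreover have "(state_class (x, lone Y ?t), state_class (x, fA a)) \<in> gph ?t (rmul ?t (fA a))"
      using v by (intro gphI[OF 1(1)]) (simp_all add: rmul_def)
    ultimately show "carries x (bd X a)"
      unfolding carries_def e using bd by auto
  qed
next
  case (mult y z)
  show ?case
  proof (intro allI impI)
    fix x assume x: "ar X x \<and> src x = \<sigma>\<^sub>0 \<and> tgt X x = src (y \<star>[X] z)"
    then have "carries x y"
      using mult by simp
    moreover have "carries (x \<star>[X] y) z"
      using mult x by simp
    ultimately show "carries x (y \<star>[X] z)"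
      using mult by (simp add: carries_def im_pm[OF mor] act.evc_pm X.pm_assoc) blast
  qed
qed

text \<open>Acting by \<open>\<phi>(x) h\<close> on the class of the trivial state gives the class
  of \<open>(x, h)\<close>. As the action is single-valued on homotopy classes, equal arrows give
  equal state classes.\<close>

lemma lift_unique_base:
  assumes x: "ar X x" "src x = \<sigma>\<^sub>0" "fV (tgt X x) = \<tau>" "h \<in> Gr Y \<tau>"
    and x': "ar X x'" "src x' = \<sigma>\<^sub>0" "fV (tgt X x') = \<tau>" "h' \<in> Gr Y \<tau>"
    and eq: "fP x \<star>[Y] lc Y \<tau> h = fP x' \<star>[Y] lc Y \<tau> h'"
  shows "\<exists>k\<in>Gr X (tgt X x). x' = x \<star>[X] lc X (tgt X x) k \<and> h = fG (tgt X x) k \<odot>[Y,\<tau>] h'"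
proof -
  let ?e = "lc X \<sigma>\<^sub>0 (lone X \<sigma>\<^sub>0)"
  have \<tau>: "\<tau> \<in> vts Y" using x by (metis X.tgt_vert mor mor_simps(1))
  have a: "(state_class (?e, lone Y (fV \<sigma>\<^sub>0)), state_class (z, l)) \<in> act.evc (fP z \<star>[Y] lc Y \<tau> l)"
    if z: "ar X z" "src z = \<sigma>\<^sub>0" "fV (tgt X z) = \<tau>" "l \<in> Gr Y \<tau>" for z l
  proof -
    have "(state_class (?e, lone Y (fV \<sigma>\<^sub>0)), state_class (z, lone Y \<tau>)) \<in> act.evc (fP z)"
      using act_im[OF z(1)] z base by (auto simp: carries_def dest!: spec[of _ ?e])
    moreover have "(state_class (z, lone Y \<tau>), state_class (z, l)) \<in> act.evc (lc Y \<tau> l)"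
      unfolding act.evc_lc[OF \<tau> z(4)]
      by (rule gphI[of "(z, lone Y \<tau>)"]) (use z \<tau> in \<open>simp_all add: states_def rmul_def\<close>)
    ultimately show ?thesis using z \<tau> by (simp add: act.evc_pm) blast
  qed
  have "ar Y (fP x \<star>[Y] lc Y \<tau> h)" using x \<tau> by simp
  then have "state_class (x, h) = state_class (x', h')"
    using act_single_valued a[OF x] a[OF x'] eq by (auto dest: single_valuedD)
  then show ?thesis using x x' by (subst (asm) state_class_eq_iff) (auto simp: states_def)
qed

end

section \<open>Uniqueness of lifts\<close>

text \<open>The states are built over the source of \<open>x\<close>, which removes the dependence
  on a base vertex.\<close>

lemma (in covering_map) lift_unique:
  assumes "ar X x" "ar X x'" "src x' = src x" "fV (tgt X x) = \<tau>" "fV (tgt X x') = \<tau>"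
    "h \<in> Gr Y \<tau>" "h' \<in> Gr Y \<tau>" "fP x \<star>[Y] lc Y \<tau> h = fP x' \<star>[Y] lc Y \<tau> h'"
  shows "\<exists>k\<in>Gr X (tgt X x). tgt X x' = tgt X x \<and> x' = x \<star>[X] lc X (tgt X x) k \<and> h = fG (tgt X x) k \<odot>[Y,\<tau>] h'"
proof -
  interpret based_covering_map X Y \<phi> "src x"
    by unfold_locales (use assms in simp)
  obtain k where "k\<in>Gr X (tgt X x)" "x' = x \<star>[X] lc X (tgt X x) k \<and> h = fG (tgt X x) k \<odot>[Y,\<tau>] h'"
    using lift_unique_base[OF assms(1) _ assms(4,6,2,3,5,7,8)] by blast
  then show ?thesis using assms(1) by (intro bexI[of _ k]) auto
qed

text \<open>With trivial remainders, the local factor separating the two lifts has trivial image,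
  hence is trivial by injectivity of the local homomorphism.\<close>

lemma (in covering_map) lift_faithful:
  assumes "ar X x" "ar X x'" "src x' = src x" "tgt X x' = tgt X x" "fP x = fP x'"
  shows "x = x'"
proof -
  let ?\<tau> = "fV (tgt X x)"
  have "\<exists>k\<in>Gr X (tgt X x). tgt X x' = tgt X x \<and> x' = x \<star>[X] lc X (tgt X x) k \<and> lone Y ?\<tau> = fG (tgt X x) k \<odot>[Y,?\<tau>] lone Y ?\<tau>"
    using assms by (intro lift_unique) simp_all
  then obtain k where k: "k\<in>Gr X (tgt X x)" "x' = x \<star>[X] lc X (tgt X x) k" "lone Y ?\<tau> = fG (tgt X x) k \<odot>[Y,?\<tau>] lone Y ?\<tau>"
    by blast
  have "fG (tgt X x) k = fG (tgt X x) (lone X (tgt X x))" using k assms by simp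
  then have "k = lone X (tgt X x)" using k assms(1) by (intro mG_inj[of "tgt X x"]) simp_all
  then show ?thesis using k assms by simp
qed

section \<open>Composition and homotopy of morphisms\<close>

text \<open>The composite of the two functors takes on generators the values prescribed by the
  formula for the composition, so \<open>morphismI\<close> yields the axioms and
  \<open>im_eqI\<close> identifies the functor.\<close>

lemma cog_comp:
  assumes cU: "complex_of_groups U" and cX: "complex_of_groups X" and cY: "complex_of_groups Y" and dev: "developable Y"
    and \<phi>: "cog_morphism U X \<phi>" and \<eta>: "cog_morphism X Y \<eta>"
  shows "cog_morphism U Y (cog_comp U Y \<eta> \<phi>)"
    and "ar U x \<Longrightarrow> induced_hom U Y (cog_comp U Y \<eta> \<phi>) x = induced_hom X Y \<eta> (induced_hom U X \<phi> x)"
proof -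
  interpret U: complex_of_groups U by fact
  interpret X: complex_of_groups X by fact
  interpret Y: complex_of_groups Y by fact
  interpret UX: cog_pair U X by unfold_locales
  interpret XY: cog_pair X Y by unfold_locales
  interpret UY: cog_pair U Y by unfold_locales
  let ?c = "cog_comp U Y \<eta> \<phi>"
  have f: "scwol_morphism (shape U) (shape Y) (mV ?c) (mE ?c)"
    unfolding scwol_morphism_def
  proof (intro conjI ballI impI)
    fix \<sigma> assume \<sigma>: "\<sigma> \<in> vts U"
    show "bij_betw (mE ?c) {a \<in> eds U. org U a = \<sigma>} {a' \<in> eds Y. org Y a' = mV ?c \<sigma>}"
      using bij_betw_trans[OF UX.mE_bij[OF \<phi> \<sigma>] XY.mE_bij[OF \<eta>, of "mV \<phi> \<sigma>"]] \<phi> \<sigma> by (simp add: cog_comp_def)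
  qed (use \<phi> \<eta> in \<open>simp_all add: cog_comp_def UX.mE_cmp XY.mE_cmp\<close>)
  have A: "mA ?c a \<in> Gr Y (mV ?c (trg U a))" if "a \<in> eds U" for a
  proof -
    have "mA \<eta> (mE \<phi> a) \<in> Gr Y (mV \<eta> (mV \<phi> (trg U a)))"
      using XY.mor_simps(6)[OF \<eta> UX.mor_simps(2)[OF \<phi> that]] \<phi> that by simp
    then show ?thesis using that \<phi> \<eta> by (simp add: cog_comp_def Let_def)
  qed
  have e: "XY.im \<eta> (UX.im \<phi> (ed U a)) = ed Y (mE ?c a) \<star>[Y]
      lc Y (mV ?c (trg U a)) (linv Y (mV ?c (trg U a)) (mA ?c a))"
    if a: "a \<in> eds U" for a
  proof -
    let ?t = "mV \<phi> (trg U a)"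
    have 1: "mA \<phi> a \<in> Gr X ?t" "mA \<eta> (mE \<phi> a) \<in> Gr Y (mV \<eta> ?t)" "trg X (mE \<phi> a) = ?t" "mE \<phi> a \<in> eds X"
      "?t \<in> vts X"
      using XY.mor_simps(6)[OF \<eta> UX.mor_simps(2)[OF \<phi> a]] \<phi> a by simp_all
    interpret H: group "grp Y (mV \<eta> ?t)" using Y.local_group 1 \<eta> by simp
    have "linv Y (mV \<eta> ?t) (mA ?c a) = linv Y (mV \<eta> ?t) (mA \<eta> (mE \<phi> a)) \<odot>[Y,mV \<eta> ?t] mG \<eta> ?t (linv X ?t (mA \<phi> a))"
      using 1 \<eta> by (simp add: cog_comp_def Let_def H.inv_mult_group XY.mG_inv)
    moreover have "mV ?c (trg U a) = mV \<eta> ?t" "mE ?c a = mE \<eta> (mE \<phi> a)" by (simp_all add: cog_comp_def)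
    ultimately show ?thesis using 1 \<phi> \<eta> a
      by (simp add: UX.im_ed XY.im_pm XY.im_ed XY.im_lc Y.lc_mult Y.pm_assoc)
  qed
  show m: "cog_morphism U Y ?c"
  proof (rule UY.morphismI[OF dev f, where F = "\<lambda>x. XY.im \<eta> (UX.im \<phi> x)"])
    show "XY.im \<eta> (UX.im \<phi> (x \<star>[U] y)) = XY.im \<eta> (UX.im \<phi> x) \<star>[Y] XY.im \<eta> (UX.im \<phi> y)"
      if "ar U x" "ar U y" "tgt U x = src y" for x y
      using that \<phi> \<eta> by (simp add: UX.im_pm XY.im_pm)
    show "mG ?c \<sigma> g \<in> Gr Y (mV ?c \<sigma>)" if "\<sigma> \<in> vts U" "g \<in> Gr U \<sigma>" for \<sigma> g
      using that \<phi> \<eta> by (simp add: cog_comp_def)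
    show "XY.im \<eta> (UX.im \<phi> (lc U \<sigma> g)) = lc Y (mV ?c \<sigma>) (mG ?c \<sigma> g)" if "\<sigma> \<in> vts U" "g \<in> Gr U \<sigma>" for \<sigma> g
      using that \<phi> \<eta> by (simp add: cog_comp_def UX.im_lc XY.im_lc)
  qed (use A e in blast)+
  show "UY.im ?c x = XY.im \<eta> (UX.im \<phi> x)" if "ar U x"
  proof (rule UY.im_eqI[OF m _ _ _ _ _ that])
    show "XY.im \<eta> (UX.im \<phi> (lc U \<sigma> g)) = UY.im ?c (lc U \<sigma> g)" if "\<sigma> \<in> vts U" "g \<in> Gr U \<sigma>" for \<sigma> g
      using that m \<phi> \<eta> by (simp add: UX.im_lc XY.im_lc UY.im_lc) (simp add: cog_comp_def)
    show "XY.im \<eta> (UX.im \<phi> (ed U a)) = UY.im ?c (ed U a)" if "a \<in> eds U" for a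
      unfolding e[OF that] UY.im_ed[OF m that] by (rule HOL.refl)
  qed (use \<phi> \<eta> in \<open>simp_all add: UX.im_pm XY.im_pm, simp_all add: cog_comp_def\<close>)
qed

context cog_pair
begin

lemma mor_htpy_by_refl:
  assumes "developable Y" "cog_morphism X Y \<phi>"
  shows "mor_htpy_by X Y (\<lambda>\<sigma>. lone Y (mV \<phi> \<sigma>)) \<phi> \<phi>"
  by (rule htpyI) (use assms in simp_all)

lemma mor_htpy_by_same:
  assumes "developable Y" "cog_morphism X Y \<phi>" "cog_morphism X Y \<eta>"
    "\<And>\<sigma>. \<sigma> \<in> vts X \<Longrightarrow> mV \<eta> \<sigma> = mV \<phi> \<sigma>" "\<And>a. a \<in> eds X \<Longrightarrow> mE \<eta> a = mE \<phi> a"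
    "\<And>x. ar X x \<Longrightarrow> im \<eta> x = im \<phi> x"
  shows "mor_htpy_by X Y (\<lambda>\<sigma>. lone Y (mV \<phi> \<sigma>)) \<phi> \<eta>"
  by (rule htpyI) (use assms in simp_all)

lemma mor_htpy_by_sym:
  assumes dev: "developable Y" and h: "mor_htpy_by X Y k \<phi> \<eta>"
  shows "mor_htpy_by X Y (\<lambda>\<sigma>. linv Y (mV \<phi> \<sigma>) (k \<sigma>)) \<eta> \<phi>"
proof (rule htpyI[OF dev])
  note D = mor_htpyD[OF h]
  show "cog_morphism X Y \<eta>" "cog_morphism X Y \<phi>" using D by simp_all
  show "mV \<phi> \<sigma> = mV \<eta> \<sigma>" "linv Y (mV \<phi> \<sigma>) (k \<sigma>) \<in> Gr Y (mV \<eta> \<sigma>)" if "\<sigma> \<in> vts X" for \<sigma>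
    using D that by simp_all
  show "mE \<phi> a = mE \<eta> a" if "a \<in> eds X" for a using D that by simp
  fix x assume x: "ar X x"
  let ?s = "mV \<phi> (src x)" and ?t = "mV \<phi> (tgt X x)" and ?k = "k (src x)" and ?l = "k (tgt X x)"
  have c: "?k \<in> Gr Y ?s" "?l \<in> Gr Y ?t" "?s \<in> vts Y" "?t \<in> vts Y" using D x by simp_all
  have e: "mV \<eta> (src x) = ?s" "mV \<eta> (tgt X x) = ?t" using D x by simp_all
  have 1: "ar Y (im \<eta> x)" "src (im \<eta> x) = ?s" "tgt Y (im \<eta> x) = ?t" using D(2) x e by simp_all
  have "im \<eta> x = im \<eta> x \<star>[Y] lc Y ?t ?l \<star>[Y] lc Y ?t (linv Y ?t ?l)"
    using c 1 by (simp add: Y.pm_assoc Y.lc_mult[symmetric])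
  also have "\<dots> = lc Y ?s ?k \<star>[Y] im \<phi> x \<star>[Y] lc Y ?t (linv Y ?t ?l)"
    using htpy_natural[OF h x] by simp
  finally have "lc Y ?s (linv Y ?s ?k) \<star>[Y] im \<eta> x = lc Y ?s (linv Y ?s ?k) \<star>[Y] lc Y ?s ?k \<star>[Y] im \<phi> x \<star>[Y] lc Y ?t (linv Y ?t ?l)"
    by (metis Y.pm_assoc)
  also have "\<dots> = im \<phi> x \<star>[Y] lc Y ?t (linv Y ?t ?l)"
    using c D(1) x by (simp add: Y.lc_mult[symmetric])
  finally show "lc Y (mV \<eta> (src x)) (linv Y ?s ?k) \<star>[Y] im \<eta> x = im \<phi> x \<star>[Y] lc Y (mV \<eta> (tgt X x)) (linv Y ?t ?l)"
    unfolding e .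
qed

lemma mor_htpy_by_trans:
  assumes dev: "developable Y" and h: "mor_htpy_by X Y k \<phi> \<eta>" and h': "mor_htpy_by X Y l \<eta> \<theta>"
  shows "mor_htpy_by X Y (\<lambda>\<sigma>. l \<sigma> \<odot>[Y,mV \<phi> \<sigma>] k \<sigma>) \<phi> \<theta>"
proof (rule htpyI[OF dev])
  note D = mor_htpyD[OF h] and D' = mor_htpyD[OF h']
  show "cog_morphism X Y \<phi>" "cog_morphism X Y \<theta>" using D D' by simp_all
  have l: "l \<sigma> \<in> Gr Y (mV \<phi> \<sigma>)" if "\<sigma> \<in> vts X" for \<sigma> using D'(5)[OF that] D(3)[OF that] by simp
  show "mV \<theta> \<sigma> = mV \<phi> \<sigma>" "l \<sigma> \<odot>[Y,mV \<phi> \<sigma>] k \<sigma> \<in> Gr Y (mV \<phi> \<sigma>)" if "\<sigma> \<in> vts X" for \<sigma>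
    using D D' l that by simp_all
  show "mE \<theta> a = mE \<phi> a" if "a \<in> eds X" for a using D D' that by simp
  fix x assume x: "ar X x"
  have e: "mV \<eta> (src x) = mV \<phi> (src x)" "mV \<eta> (tgt X x) = mV \<phi> (tgt X x)" using D x by simp_all
  show "lc Y (mV \<phi> (src x)) (l (src x) \<odot>[Y,mV \<phi> (src x)] k (src x)) \<star>[Y] im \<phi> x =
      im \<theta> x \<star>[Y] lc Y (mV \<phi> (tgt X x)) (l (tgt X x) \<odot>[Y,mV \<phi> (tgt X x)] k (tgt X x))"
    using htpy_natural[OF h x] htpy_natural[OF h' x] D l x unfolding e
    by (simp add: Y.lc_mult) (metis Y.pm_assoc)
qed

lemma mor_htpy_refl: "developable Y \<Longrightarrow> cog_morphism X Y \<phi> \<Longrightarrow> mor_htpy X Y \<phi> \<phi>"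
  and mor_htpy_sym: "developable Y \<Longrightarrow> mor_htpy X Y \<phi> \<eta> \<Longrightarrow> mor_htpy X Y \<eta> \<phi>"
  and mor_htpy_trans: "developable Y \<Longrightarrow> mor_htpy X Y \<phi> \<eta> \<Longrightarrow> mor_htpy X Y \<eta> \<theta> \<Longrightarrow> mor_htpy X Y \<phi> \<theta>"
  unfolding mor_htpy_def using mor_htpy_by_refl mor_htpy_by_sym mor_htpy_by_trans by blast+

lemma mor_class_eq_iff:
  assumes "developable Y" "cog_morphism X Y \<eta>"
  shows "mor_class X Y \<phi> = mor_class X Y \<eta> \<longleftrightarrow> mor_htpy X Y \<phi> \<eta>"
proof
  assume "mor_class X Y \<phi> = mor_class X Y \<eta>"
  then show "mor_htpy X Y \<phi> \<eta>" unfolding mor_class_def using mor_htpy_refl[OF assms] by blast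
next
  assume "mor_htpy X Y \<phi> \<eta>"
  then show "mor_class X Y \<phi> = mor_class X Y \<eta>" unfolding mor_class_def
    using mor_htpy_sym[OF assms(1)] mor_htpy_trans[OF assms(1)] by blast
qed

end

text \<open>The functor of \<open>\<psi>\<close> is applied to the naturality squares.\<close>

lemma mor_htpy_postcomp:
  assumes cU: "complex_of_groups U" and cX: "complex_of_groups X" and cY: "complex_of_groups Y" and dev: "developable Y"
    and h: "mor_htpy_by U X g \<eta> \<eta>'" and \<psi>: "cog_morphism X Y \<psi>"
  shows "mor_htpy_by U Y (\<lambda>\<sigma>. mG \<psi> (mV \<eta> \<sigma>) (g \<sigma>)) (cog_comp U Y \<psi> \<eta>) (cog_comp U Y \<psi> \<eta>')"
proof -
  interpret U: complex_of_groups U by fact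
  interpret X: complex_of_groups X by fact
  interpret Y: complex_of_groups Y by fact
  interpret UX: cog_pair U X by unfold_locales
  interpret XY: cog_pair X Y by unfold_locales
  interpret UY: cog_pair U Y by unfold_locales
  note D = UX.mor_htpyD[OF h]
  show ?thesis
  proof (rule UY.htpyI[OF dev])
    show "cog_morphism U Y (cog_comp U Y \<psi> \<eta>)" "cog_morphism U Y (cog_comp U Y \<psi> \<eta>')"
      using cog_comp(1)[OF cU cX cY dev _ \<psi>] D by blast+
    fix x assume x: "ar U x"
    have e: "mV (cog_comp U Y \<psi> \<eta>) \<sigma> = mV \<psi> (mV \<eta> \<sigma>)" for \<sigma> by (simp add: cog_comp_def)
    have g: "g (src x) \<in> Gr X (mV \<eta> (src x))" "g (tgt U x) \<in> Gr X (mV \<eta> (tgt U x))" using D x by simp_all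
    have v: "mV \<eta> (src x) \<in> vts X" "mV \<eta> (tgt U x) \<in> vts X" using D(1) x by simp_all
    have s: "mV \<eta>' (tgt U x) = mV \<eta> (tgt U x)" using D x by simp
    have "XY.im \<psi> (lc X (mV \<eta> (src x)) (g (src x)) \<star>[X] UX.im \<eta> x) = XY.im \<psi> (UX.im \<eta>' x \<star>[X] lc X (mV \<eta> (tgt U x)) (g (tgt U x)))"
      using UX.htpy_natural[OF h x] by simp
    then show "lc Y (mV (cog_comp U Y \<psi> \<eta>) (src x)) (mG \<psi> (mV \<eta> (src x)) (g (src x))) \<star>[Y] UY.im (cog_comp U Y \<psi> \<eta>) x =
      UY.im (cog_comp U Y \<psi> \<eta>') x \<star>[Y] lc Y (mV (cog_comp U Y \<psi> \<eta>) (tgt U x)) (mG \<psi> (mV \<eta> (tgt U x)) (g (tgt U x)))"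
      unfolding e cog_comp(2)[OF cU cX cY dev D(1) \<psi> x] cog_comp(2)[OF cU cX cY dev D(2) \<psi> x]
      using x g v s D(1,2) \<psi> by (simp add: XY.im_pm XY.im_lc)
  qed (use D(3-5) \<psi> UX.mor_simps(1)[OF D(1)] in \<open>simp_all add: cog_comp_def\<close>)
qed

text \<open>The naturality squares are evaluated on the arrows in the image of
  \<open>\<eta>\<close>.\<close>

lemma mor_htpy_precomp:
  assumes cU: "complex_of_groups U" and cX: "complex_of_groups X" and cY: "complex_of_groups Y" and dev: "developable Y"
    and h: "mor_htpy_by X Y k \<alpha> \<beta>" and \<eta>: "cog_morphism U X \<eta>"
  shows "mor_htpy_by U Y (\<lambda>\<sigma>. k (mV \<eta> \<sigma>)) (cog_comp U Y \<alpha> \<eta>) (cog_comp U Y \<beta> \<eta>)"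
proof -
  interpret U: complex_of_groups U by fact
  interpret X: complex_of_groups X by fact
  interpret Y: complex_of_groups Y by fact
  interpret UX: cog_pair U X by unfold_locales
  interpret XY: cog_pair X Y by unfold_locales
  interpret UY: cog_pair U Y by unfold_locales
  note D = XY.mor_htpyD[OF h]
  show ?thesis
  proof (rule UY.htpyI[OF dev])
    show "cog_morphism U Y (cog_comp U Y \<alpha> \<eta>)" "cog_morphism U Y (cog_comp U Y \<beta> \<eta>)"
      using cog_comp(1)[OF cU cX cY dev \<eta>] D by blast+
    fix x assume x: "ar U x"
    have e: "mV (cog_comp U Y \<alpha> \<eta>) \<sigma> = mV \<alpha> (mV \<eta> \<sigma>)" for \<sigma> by (simp add: cog_comp_def)
    show "lc Y (mV (cog_comp U Y \<alpha> \<eta>) (src x)) (k (mV \<eta> (src x))) \<star>[Y] UY.im (cog_comp U Y \<alpha> \<eta>) x =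
      UY.im (cog_comp U Y \<beta> \<eta>) x \<star>[Y] lc Y (mV (cog_comp U Y \<alpha> \<eta>) (tgt U x)) (k (mV \<eta> (tgt U x)))"
      unfolding e cog_comp(2)[OF cU cX cY dev \<eta> D(1) x] cog_comp(2)[OF cU cX cY dev \<eta> D(2) x]
      using XY.htpy_natural[OF h, of "UX.im \<eta> x"] \<eta> x by simp
  qed (use D(3-5) UX.mor_simps[OF \<eta>] in \<open>simp_all add: cog_comp_def\<close>)
qed

section \<open>The fundamental group\<close>

context complex_of_groups
begin

lemma pi1_carrier: "carrier (pi1 X \<sigma>) = arr X \<sigma> \<sigma>"
proof (intro subset_antisym subsetI)
  fix x assume "x \<in> carrier (pi1 X \<sigma>)"
  then obtain p where "is_cpath X p" "pini p = \<sigma>" "pter X p = \<sigma>" "x = hclass X p"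
    by (auto simp: pi1_def cloops_def cpaths_from_def)
  then show "x \<in> arr X \<sigma> \<sigma>" by (simp add: arr_def)
next
  fix x assume x: "x \<in> arr X \<sigma> \<sigma>"
  then have "ar X x" by (simp add: arr_def)
  then obtain p where p: "is_cpath X p" "x = hclass X p" by (rule arE)
  then show "x \<in> carrier (pi1 X \<sigma>)" using x
    by (simp add: pi1_def cloops_def cpaths_from_def arr_def)
qed

lemma pi1_mult:
  assumes "ar X x" "ar X y" "tgt X x = src y"
  shows "x \<otimes>\<^bsub>pi1 X \<sigma>\<^esub> y = x \<star>[X] y"
proof -
  obtain p q where p: "is_cpath X p" "x = hclass X p" and q: "is_cpath X q" "y = hclass X q"
    using assms by (metis arE)
  have e: "pter X p = pini q" using assms p q by simp
  have "hclass X (pcat X p' q') = hclass X (pcat X p q)" if "cpath_htpy X p p'" "cpath_htpy X q q'" for p' q'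
    using htpy_cong[OF that e] p q e by (subst eq_commute) (simp add: hclass_eq_iff)
  moreover have "cpath_htpy X p p" "cpath_htpy X q q" using p q by (simp_all add: cpath_htpy.refl)
  ultimately have "(\<Union>p\<in>hclass X p. \<Union>q\<in>hclass X q. hclass X (pcat X p q)) = hclass X (pcat X p q)"
    unfolding hclass_def[of X p] hclass_def[of X q] by blast
  then show ?thesis using p q e by (simp add: pi1_def hclass_pcat)
qed

lemma pi1_one: "\<one>\<^bsub>pi1 X \<sigma>\<^esub> = lc X \<sigma> (lone X \<sigma>)"
  by (simp add: pi1_def lc_def)

lemma pi1_group: "\<sigma> \<in> vts X \<Longrightarrow> group (pi1 X \<sigma>)"
proof (rule groupI)
  fix x y z assume "x \<in> carrier (pi1 X \<sigma>)" "y \<in> carrier (pi1 X \<sigma>)" "z \<in> carrier (pi1 X \<sigma>)"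
  then show "x \<otimes>\<^bsub>pi1 X \<sigma>\<^esub> y \<otimes>\<^bsub>pi1 X \<sigma>\<^esub> z = x \<otimes>\<^bsub>pi1 X \<sigma>\<^esub> (y \<otimes>\<^bsub>pi1 X \<sigma>\<^esub> z)"
    by (simp add: pi1_carrier arr_def pi1_mult pm_assoc)
next
  fix x assume v: "\<sigma> \<in> vts X" and x: "x \<in> carrier (pi1 X \<sigma>)"
  then show "\<exists>y\<in>carrier (pi1 X \<sigma>). y \<otimes>\<^bsub>pi1 X \<sigma>\<^esub> x = \<one>\<^bsub>pi1 X \<sigma>\<^esub>"
    by (intro bexI[of _ "iv X x"]) (auto simp: pi1_carrier arr_def pi1_mult pi1_one)
qed (simp_all add: pi1_carrier arr_def pi1_mult pi1_one)

lemma pi1_inv: "\<sigma> \<in> vts X \<Longrightarrow> x \<in> arr X \<sigma> \<sigma> \<Longrightarrow> inv\<^bsub>pi1 X \<sigma>\<^esub> x = iv X x"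
  by (rule group.inv_equality[OF pi1_group]) (auto simp: pi1_carrier arr_def pi1_mult pi1_one)

lemma connecting_arrow:
  assumes "scwol_connected (shape X)" "\<sigma> \<in> vts X" "\<tau> \<in> vts X"
  obtains x where "x \<in> arr X \<sigma> \<tau>"
proof -
  have "\<exists>x. x \<in> arr X \<sigma> \<tau>" if "edge_path (shape X) \<sigma> es \<tau>" for es \<sigma>
    using that
  proof (induction es arbitrary: \<sigma>)
    case Nil
    then show ?case by (intro exI[of _ "lc X \<sigma> (lone X \<sigma>)"]) (auto simp: arr_def)
  next
    case (Cons e es)
    then obtain x where x: "x \<in> arr X (oter (shape X) e) \<tau>" by auto
    have "eo e \<star>[X] x \<in> arr X \<sigma> \<tau>" using x Cons.prems by (cases e) (auto simp: arr_def eo_def)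
    then show ?case ..
  qed
  then show ?thesis using assms that unfolding scwol_connected_def by blast
qed

end

section \<open>Deck transformations\<close>

context cog_pair
begin

text \<open>The functor of \<open>\<phi>\<close> conjugated by the family \<open>k\<close> is again
  multiplicative and has the required values on generators, so \<open>morphismI\<close> replaces a
  direct check of the axioms.\<close>

lemma mor_shift:
  assumes dev: "developable Y" and \<phi>: "cog_morphism X Y \<phi>"
    and k: "\<And>\<sigma>. \<sigma> \<in> vts X \<Longrightarrow> k \<sigma> \<in> Gr Y (mV \<phi> \<sigma>)"
  shows "mor_htpy_by X Y k \<phi> (mor_shift X Y k \<phi>)"
proof -
  let ?s = "mor_shift X Y k \<phi>"
  have s: "mV ?s = mV \<phi>" "mE ?s = mE \<phi>" by (simp_all add: mor_shift_def)
  have f: "scwol_morphism (shape X) (shape Y) (mV ?s) (mE ?s)"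
    using \<phi> unfolding s cog_morphism_def by blast
  let ?k = "\<lambda>\<sigma>. lc Y (mV \<phi> \<sigma>) (k \<sigma>)" and ?l = "\<lambda>\<sigma>. lc Y (mV \<phi> \<sigma>) (linv Y (mV \<phi> \<sigma>) (k \<sigma>))"
  have "cog_morphism X Y ?s"
  proof (rule morphismI[OF dev f, where F = "\<lambda>x. ?k (src x) \<star>[Y] im \<phi> x \<star>[Y] ?l (tgt X x)"])
    fix x y assume xy: "ar X x" "ar X y" "tgt X x = src y"
    have "?l (src y) \<star>[Y] (?k (src y) \<star>[Y] (im \<phi> y \<star>[Y] ?l (tgt X y))) = im \<phi> y \<star>[Y] ?l (tgt X y)"
      using xy k \<phi> by (simp add: Y.pm_assoc[symmetric] Y.lc_mult[symmetric])
    then show "?k (src (x \<star>[X] y)) \<star>[Y] im \<phi> (x \<star>[X] y) \<star>[Y] ?l (tgt X (x \<star>[X] y)) =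
       ?k (src x) \<star>[Y] im \<phi> x \<star>[Y] ?l (tgt X x) \<star>[Y] (?k (src y) \<star>[Y] im \<phi> y \<star>[Y] ?l (tgt X y))"
      using xy \<phi> by (simp add: im_pm Y.pm_assoc)
  next
    fix \<sigma> g assume a: "\<sigma> \<in> vts X" "g \<in> Gr X \<sigma>"
    then show "mG ?s \<sigma> g \<in> Gr Y (mV ?s \<sigma>)"
      using \<phi> k[OF a(1)] by (simp add: mor_shift_def conj_by_def)
    show "?k (src (lc X \<sigma> g)) \<star>[Y] im \<phi> (lc X \<sigma> g) \<star>[Y] ?l (tgt X (lc X \<sigma> g)) = lc Y (mV ?s \<sigma>) (mG ?s \<sigma> g)"
      using \<phi> k[OF a(1)] a by (simp add: mor_shift_def conj_by_def im_lc Y.lc_mult Y.pm_assoc)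
  next
    fix a assume a: "a \<in> eds X"
    let ?t = "mV \<phi> (trg X a)" and ?i = "mV \<phi> (org X a)"
    have c: "k (trg X a) \<in> Gr Y ?t" "k (org X a) \<in> Gr Y ?i" "mA \<phi> a \<in> Gr Y ?t" "?t \<in> vts Y"
      "psi Y (mE \<phi> a) (k (org X a)) \<in> Gr Y ?t" "mE \<phi> a \<in> eds Y"
      using a k \<phi> by simp_all
    then show "mA ?s a \<in> Gr Y (mV ?s (trg X a))"
      using Y_psi_closed[OF \<phi> a] a \<phi> by (simp add: mor_shift_def Let_def)
    interpret H: group "grp Y ?t" using c Y.local_group by simp
    have q: "psi Y (mE \<phi> a) (linv Y ?i (k (org X a))) = linv Y ?t (psi Y (mE \<phi> a) (k (org X a)))"
      using Y.psi_inv[of "mE \<phi> a" "k (org X a)"] a c \<phi> by simp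
    have "linv Y ?t (mA ?s a) = psi Y (mE \<phi> a) (k (org X a)) \<odot>[Y,?t] linv Y ?t (mA \<phi> a) \<odot>[Y,?t] linv Y ?t (k (trg X a))"
      using c by (simp add: mor_shift_def Let_def q H.inv_mult_group H.m_assoc)
    then have "ed Y (mE \<phi> a) \<star>[Y] lc Y ?t (linv Y ?t (mA ?s a)) =
      (ed Y (mE \<phi> a) \<star>[Y] lc Y ?t (psi Y (mE \<phi> a) (k (org X a)))) \<star>[Y] lc Y ?t (linv Y ?t (mA \<phi> a)) \<star>[Y] ?l (trg X a)"
      using c by (simp add: Y.lc_mult Y.pm_assoc)
    then show "?k (src (ed X a)) \<star>[Y] im \<phi> (ed X a) \<star>[Y] ?l (tgt X (ed X a)) = ed Y (mE ?s a) \<star>[Y]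
       lc Y (mV ?s (trg X a)) (linv Y (mV ?s (trg X a)) (mA ?s a))"
      using a \<phi> Y_lc_ed[OF \<phi> a c(2)] unfolding s by (simp add: im_ed Y.pm_assoc[symmetric])
  qed
  then show ?thesis using \<phi> k unfolding mor_htpy_by_def by (simp add: mor_shift_def Let_def)
qed

end

locale deck_setting = based_covering_map X Y \<phi> \<sigma>\<^sub>0
  for X :: "('v, 'e, 'g) cog" and Y :: "('w, 'd, 'h) cog" and \<phi> and \<sigma>\<^sub>0 :: 'v +
  assumes devX: "developable X" and devY: "developable Y"
    and conn: "scwol_connected (shape X)"
begin

sublocale XX: cog_pair X X
  by unfold_locales

abbreviation \<tau>\<^sub>0 :: 'w where "\<tau>\<^sub>0 \<equiv> fV \<sigma>\<^sub>0"

lemma \<tau>\<^sub>0_vert [simp]: "\<tau>\<^sub>0 \<in> vts Y"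
  using base by simp

lemmas cogs = X.complex_of_groups_axioms Y.complex_of_groups_axioms

lemma comp_mor: "cog_morphism X X \<eta> \<Longrightarrow> cog_morphism X Y (cog_comp X Y \<phi> \<eta>)"
  by (rule cog_comp(1)[OF cogs(1,1,2) devY _ mor])

lemma comp_im: "cog_morphism X X \<eta> \<Longrightarrow> ar X x \<Longrightarrow> im (cog_comp X Y \<phi> \<eta>) x = fP (XX.im \<eta> x)"
  by (rule cog_comp(2)[OF cogs(1,1,2) devY _ mor])

lemma AutD:
  assumes "\<eta> \<in> cog_Aut X"
  shows "cog_morphism X X \<eta>" "bij_betw (mV \<eta>) (vts X) (vts X)"
    "bij_betw (mE \<eta>) (eds X) (eds X)"
    "\<sigma> \<in> vts X \<Longrightarrow> bij_betw (mG \<eta> \<sigma>) (Gr X \<sigma>) (Gr X (mV \<eta> \<sigma>))"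
  using assms by (auto simp: cog_Aut_def cog_iso_def scwol_iso_def iso_def)

lemma AutI:
  assumes "cog_morphism X X \<eta>" "bij_betw (mV \<eta>) (vts X) (vts X)"
    "bij_betw (mE \<eta>) (eds X) (eds X)"
    "\<And>\<sigma>. \<sigma> \<in> vts X \<Longrightarrow> bij_betw (mG \<eta> \<sigma>) (Gr X \<sigma>) (Gr X (mV \<eta> \<sigma>))"
  shows "\<eta> \<in> cog_Aut X"
  using assms XX.mG_hom[OF assms(1)] assms(1)
  by (auto simp: cog_Aut_def cog_iso_def scwol_iso_def iso_def cog_morphism_def)

lemma Aut_comp:
  assumes "\<eta> \<in> cog_Aut X" "\<theta> \<in> cog_Aut X"
  shows "cog_comp X X \<eta> \<theta> \<in> cog_Aut X"
proof (rule AutI)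
  show "cog_morphism X X (cog_comp X X \<eta> \<theta>)"
    by (rule cog_comp(1)[OF cogs(1,1,1) devX AutD(1)[OF assms(2)] AutD(1)[OF assms(1)]])
  show "bij_betw (mV (cog_comp X X \<eta> \<theta>)) (vts X) (vts X)"
    "bij_betw (mE (cog_comp X X \<eta> \<theta>)) (eds X) (eds X)"
    using bij_betw_trans[OF AutD(2)[OF assms(2)] AutD(2)[OF assms(1)]]
      bij_betw_trans[OF AutD(3)[OF assms(2)] AutD(3)[OF assms(1)]] by (simp_all add: cog_comp_def)
  show "bij_betw (mG (cog_comp X X \<eta> \<theta>) \<sigma>) (Gr X \<sigma>) (Gr X (mV (cog_comp X X \<eta> \<theta>) \<sigma>))" if "\<sigma> \<in> vts X" for \<sigma>
    using bij_betw_trans[OF AutD(4)[OF assms(2) that] AutD(4)[OF assms(1), of "mV \<theta> \<sigma>"]] that AutD(1)[OF assms(2)]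
    by (simp add: cog_comp_def)
qed

text \<open>Homotopic morphisms have the same underlying map of scwols, and their local
  homomorphisms differ by conjugation, which is bijective.\<close>

lemma Aut_htpy:
  assumes \<eta>: "\<eta> \<in> cog_Aut X" and h: "mor_htpy_by X X g \<eta> \<eta>'"
  shows "\<eta>' \<in> cog_Aut X"
proof (rule AutI)
  note D = XX.mor_htpyD[OF h]
  show "cog_morphism X X \<eta>'" by (rule D(2))
  show "bij_betw (mV \<eta>') (vts X) (vts X)"
    using AutD(2)[OF \<eta>] bij_betw_cong[of "vts X" "mV \<eta>" "mV \<eta>'"] D(3) by simp
  show "bij_betw (mE \<eta>') (eds X) (eds X)"
    using AutD(3)[OF \<eta>] bij_betw_cong[of "eds X" "mE \<eta>" "mE \<eta>'"] D(4) by simp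
  fix \<sigma> assume \<sigma>: "\<sigma> \<in> vts X"
  let ?\<tau> = "mV \<eta> \<sigma>"
  have \<tau>: "?\<tau> \<in> vts X" and g: "g \<sigma> \<in> Gr X ?\<tau>" using D(1,5) \<sigma> by simp_all
  have c: "bij_betw (conj_by (grp X ?\<tau>) (g \<sigma>)) (Gr X ?\<tau>) (Gr X ?\<tau>)"
    by (rule bij_betw_byWitness[where f' = "conj_by (grp X ?\<tau>) (linv X ?\<tau> (g \<sigma>))"])
      (use \<tau> g in \<open>auto simp: conj_by_def X.l_assoc\<close>)
  have "bij_betw (conj_by (grp X ?\<tau>) (g \<sigma>) \<circ> mG \<eta> \<sigma>) (Gr X \<sigma>) (Gr X ?\<tau>)"
    by (rule bij_betw_trans[OF AutD(4)[OF \<eta> \<sigma>] c])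
  moreover have "mG \<eta>' \<sigma> x = (conj_by (grp X ?\<tau>) (g \<sigma>) \<circ> mG \<eta> \<sigma>) x" if "x \<in> Gr X \<sigma>" for x
    using h \<sigma> that unfolding mor_htpy_by_def by simp
  ultimately show "bij_betw (mG \<eta>' \<sigma>) (Gr X \<sigma>) (Gr X (mV \<eta>' \<sigma>))"
    using bij_betw_cong[of "Gr X \<sigma>" "mG \<eta>' \<sigma>" "conj_by (grp X ?\<tau>) (g \<sigma>) \<circ> mG \<eta> \<sigma>"] D(3)[OF \<sigma>] by simp
qed

text \<open>The edge and the local element are found by inverting the bijections of
  \<open>\<eta>\<close>; the last factor of the decomposition can be taken trivial.\<close>

lemma Aut_back_lifting:
  assumes \<eta>: "\<eta> \<in> cog_Aut X"
  shows "XX.back_lifting \<eta>"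
  unfolding XX.back_lifting_def
proof (intro ballI impI)
  note m = AutD(1)[OF \<eta>]
  fix \<sigma> b y assume a: "\<sigma> \<in> vts X" "b \<in> eds X" "trg X b = mV \<eta> \<sigma>" "y \<in> Gr X (mV \<eta> \<sigma>)"
  obtain e where e: "e \<in> eds X" "mE \<eta> e = b"
    using AutD(3)[OF \<eta>] a(2) unfolding bij_betw_def by (metis imageE)
  have "mV \<eta> (trg X e) = mV \<eta> \<sigma>" using XX.mor_simps(4)[OF m e(1)] e(2) a(3) by simp
  then have t: "trg X e = \<sigma>"
    using AutD(2)[OF \<eta>] a(1) X.ter_vert[OF e(1)] by (auto simp: bij_betw_def dest: inj_onD)
  have A: "mA \<eta> e \<in> Gr X (mV \<eta> \<sigma>)" using XX.mor_simps(6)[OF m e(1)] t by simp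
  have v: "mV \<eta> \<sigma> \<in> vts X" using m a(1) by simp
  have "y \<odot>[X,mV \<eta> \<sigma>] linv X (mV \<eta> \<sigma>) (mA \<eta> e) \<in> mG \<eta> \<sigma> ` Gr X \<sigma>"
    using AutD(4)[OF \<eta> a(1)] a(4) A v by (simp add: bij_betw_def)
  then obtain g where g: "g \<in> Gr X \<sigma>" "mG \<eta> \<sigma> g = y \<odot>[X,mV \<eta> \<sigma>] linv X (mV \<eta> \<sigma>) (mA \<eta> e)" by (auto elim!: imageE)
  have "y = mG \<eta> \<sigma> g \<odot>[X,mV \<eta> \<sigma>] mA \<eta> e \<odot>[X,mV \<eta> \<sigma>] psi X b (lone X (org X b))"
    using g A v a X.psi_one[OF a(2)] by (simp add: X.l_assoc)
  then show "\<exists>a\<in>eds X. mE \<eta> a = b \<and> trg X a = \<sigma> \<and>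
      (\<exists>g\<in>Gr X \<sigma>. \<exists>h\<in>Gr X (org X b). y = mG \<eta> \<sigma> g \<odot>[X,mV \<eta> \<sigma>] mA \<eta> a \<odot>[X,mV \<eta> \<sigma>] psi X b h)"
    using e t g(1) a(2) X.l_one_closed X.ini_vert by blast
qed

text \<open>Lift \<open>y\<close> along \<open>\<eta>\<close> itself. The remainder lies in the
  image of a bijective local homomorphism, so it can be absorbed into the lift.\<close>

lemma Aut_full:
  assumes \<eta>: "\<eta> \<in> cog_Aut X" and \<sigma>: "\<sigma> \<in> vts X" "\<tau> \<in> vts X"
    and y: "ar X y" "src y = mV \<eta> \<sigma>" "tgt X y = mV \<eta> \<tau>"
  obtains x where "ar X x" "src x = \<sigma>" "tgt X x = \<tau>" "XX.im \<eta> x = y"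
proof -
  note m = AutD(1)[OF \<eta>]
  obtain x h where x: "ar X x" "src x = \<sigma>" "mV \<eta> (tgt X x) = tgt X y" "h \<in> Gr X (tgt X y)" "y = XX.im \<eta> x \<star>[X] lc X (tgt X y) h"
    using XX.lift_exists[OF m Aut_back_lifting[OF \<eta>] y(1) \<sigma>(1) y(2)] by blast
  have t: "tgt X x = \<tau>"
    using AutD(2)[OF \<eta>] x(1,3) y(3) \<sigma>(2) X.tgt_vert by (auto simp: bij_betw_def dest: inj_onD)
  obtain g where g: "g \<in> Gr X \<tau>" "mG \<eta> \<tau> g = h"
    using AutD(4)[OF \<eta> \<sigma>(2)] x(4) y(3) unfolding bij_betw_def by (metis imageE)
  have "XX.im \<eta> (x \<star>[X] lc X \<tau> g) = y"
    using x(1,5) t g \<sigma>(2) m y(3) by (simp add: XX.im_pm XX.im_lc)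
  then show ?thesis using that[of "x \<star>[X] lc X \<tau> g"] x t g(1) \<sigma>(2) by simp
qed

text \<open>The group element \<open>h\<close> and the automorphism \<open>\<eta>\<close> are related when translation by \<open>h\<close> is
  realised by \<open>\<eta>\<close>: along \<open>x\<close> one has \<open>h \<phi>(x) = \<phi>(p \<eta>(x)) k\<close>.\<close>

definition realises :: "('w, 'd, 'h) cpath set \<Rightarrow> ('v, 'e, 'g, 'v, 'e, 'g) cog_map \<Rightarrow> ('v \<Rightarrow> 'h)
    \<Rightarrow> ('v, 'e, 'g) cpath set \<Rightarrow> bool" where
  "realises h \<eta> k p \<longleftrightarrow> \<eta> \<in> cog_Aut X \<and> mor_htpy_by X Y k \<phi> (cog_comp X Y \<phi> \<eta>) \<and>
     p \<in> arr X \<sigma>\<^sub>0 (mV \<eta> \<sigma>\<^sub>0) \<and> h = fP p \<star>[Y] lc Y \<tau>\<^sub>0 (k \<sigma>\<^sub>0)"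

lemma realisesD:
  assumes "realises h \<eta> k p"
  shows "\<eta> \<in> cog_Aut X" "cog_morphism X X \<eta>" "mor_htpy_by X Y k \<phi> (cog_comp X Y \<phi> \<eta>)"
    "ar X p" "src p = \<sigma>\<^sub>0" "tgt X p = mV \<eta> \<sigma>\<^sub>0" "h = fP p \<star>[Y] lc Y \<tau>\<^sub>0 (k \<sigma>\<^sub>0)"
    "\<sigma> \<in> vts X \<Longrightarrow> fV (mV \<eta> \<sigma>) = fV \<sigma>"
    "\<sigma> \<in> vts X \<Longrightarrow> k \<sigma> \<in> Gr Y (fV \<sigma>)"
    "a \<in> eds X \<Longrightarrow> fE (mE \<eta> a) = fE a"
  using assms AutD(1)[of \<eta>] mor_htpyD(3,4,5)[of k \<phi> "cog_comp X Y \<phi> \<eta>"]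
  by (auto simp: realises_def arr_def) (auto simp: cog_comp_def)

lemma realises_nat:
  assumes r: "realises h \<eta> k p" and x: "ar X x"
  shows "lc Y (fV (src x)) (k (src x)) \<star>[Y] fP x = fP (XX.im \<eta> x) \<star>[Y] lc Y (fV (tgt X x)) (k (tgt X x))"
  using htpy_natural[OF realisesD(3)[OF r] x] comp_im[OF realisesD(2)[OF r] x] by simp

lemma realises_ends:
  assumes r: "realises h \<eta> k p"
  shows "ar Y h" "src h = \<tau>\<^sub>0" "tgt Y h = \<tau>\<^sub>0"
  using realisesD[OF r] base by simp_all

text \<open>Naturality carries the factor of \<open>k\<close> at the base vertex to the end of
  \<open>x\<close>.\<close>

lemma realises_shift:
  assumes r: "realises h \<eta> k p" and x: "ar X x" "src x = \<sigma>\<^sub>0"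
  shows "h \<star>[Y] fP x = fP (p \<star>[X] XX.im \<eta> x) \<star>[Y] lc Y (fV (tgt X x)) (k (tgt X x))"
proof -
  note D = realisesD[OF r]
  have "h \<star>[Y] fP x = fP p \<star>[Y] (lc Y (fV (src x)) (k (src x)) \<star>[Y] fP x)"
    using D(7) x(2) by (simp add: Y.pm_assoc)
  also have "\<dots> = fP p \<star>[Y] fP (XX.im \<eta> x) \<star>[Y] lc Y (fV (tgt X x)) (k (tgt X x))"
    unfolding realises_nat[OF r x(1)] by (simp add: Y.pm_assoc)
  finally show ?thesis using D(2,4-6) x by (simp add: im_pm)
qed

text \<open>Being homotopic relative to the base vertex to \<open>\<phi>\<close> shifted by
  \<open>g\<close> is the same as admitting a homotopy from \<open>\<phi>\<close> to
  \<open>\<phi>\<close> after \<open>\<eta>\<close> with value \<open>g\<close> at the base, because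
  the shift is such a homotopy from \<open>\<phi>\<close>.\<close>

lemma is_eps_iff:
  "is_eps X Y \<phi> \<sigma>\<^sub>0 h D \<longleftrightarrow> (\<exists>\<eta> k p. realises h \<eta> k p \<and> D = mor_class X X \<eta>)"
proof
  assume "is_eps X Y \<phi> \<sigma>\<^sub>0 h D"
  then obtain p g \<eta> l where *: "is_cpath X p" "pini p = \<sigma>\<^sub>0" "fV (pter X p) = \<tau>\<^sub>0" "g \<in> Gr Y \<tau>\<^sub>0"
    "h = hclass Y (pcat Y (pmap X Y \<phi> p) (pconst \<tau>\<^sub>0 g))" "\<eta> \<in> cog_Aut X" "mV \<eta> \<sigma>\<^sub>0 = pter X p"
    "mor_htpy_by X Y l (cog_comp X Y \<phi> \<eta>) (mor_shift_at X Y \<sigma>\<^sub>0 g \<phi>)" "l \<sigma>\<^sub>0 = lone Y (mV (cog_comp X Y \<phi> \<eta>) \<sigma>\<^sub>0)"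
    "D = mor_class X X \<eta>"
    unfolding is_eps_def cpaths_from_def mor_htpy_rel_def by blast
  let ?c = "cog_comp X Y \<phi> \<eta>"
  define k0 where "k0 = ((\<lambda>\<sigma>. lone Y (fV \<sigma>))(\<sigma>\<^sub>0 := g))"
  have k0: "k0 \<sigma> \<in> Gr Y (fV \<sigma>)" if "\<sigma> \<in> vts X" for \<sigma>
    using *(4) that by (simp add: k0_def)
  have 1: "mor_htpy_by X Y k0 \<phi> (mor_shift_at X Y \<sigma>\<^sub>0 g \<phi>)"
    unfolding mor_shift_at_def k0_def[symmetric] by (rule mor_shift[OF devY mor k0])
  \<comment> \<open>The shift from \<open>\<phi>\<close> followed by the inverse of
    \<open>l\<close>; since \<open>l\<close> is trivial at the base vertex, the value there is
    \<open>g\<close>.\<close>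
  define k where "k = (\<lambda>\<sigma>. linv Y (mV ?c \<sigma>) (l \<sigma>) \<odot>[Y,fV \<sigma>] k0 \<sigma>)"
  have 2: "mor_htpy_by X Y k \<phi> ?c"
    unfolding k_def by (rule mor_htpy_by_trans[OF devY 1 mor_htpy_by_sym[OF devY *(8)]])
  have "mV ?c \<sigma>\<^sub>0 = \<tau>\<^sub>0" using mor_htpyD(3)[OF 2 base] .
  then have k: "k \<sigma>\<^sub>0 = g" using *(4,9) by (simp add: k_def k0_def)
  have pm: "is_cpath Y (pmap X Y \<phi> p)" "pter Y (pmap X Y \<phi> p) = \<tau>\<^sub>0"
    using pmap_rep[OF mor *(1)] *(3) by simp_all
  have "h = fP (hclass X p) \<star>[Y] lc Y \<tau>\<^sub>0 (k \<sigma>\<^sub>0)"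
    unfolding *(5) k lc_def using pm *(4) im_hclass[OF mor *(1)] by (simp add: Y.hclass_pcat)
  then have "realises h \<eta> k (hclass X p)"
    using *(1,2,6,7) 2 by (simp add: realises_def arr_def)
  then show "\<exists>\<eta> k p. realises h \<eta> k p \<and> D = mor_class X X \<eta>" using *(10) by blast
next
  assume "\<exists>\<eta> k p. realises h \<eta> k p \<and> D = mor_class X X \<eta>"
  then obtain \<eta> k x where r: "realises h \<eta> k x" and D: "D = mor_class X X \<eta>" by blast
  note R = realisesD[OF r]
  let ?c = "cog_comp X Y \<phi> \<eta>"
  obtain p where p: "is_cpath X p" "x = hclass X p" using R(4) by (rule X.arE)
  have pe: "pini p = \<sigma>\<^sub>0" "pter X p = mV \<eta> \<sigma>\<^sub>0" using R(5,6) p by simp_all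
  define g where "g = k \<sigma>\<^sub>0"
  have g: "g \<in> Gr Y \<tau>\<^sub>0" using R(9)[OF base] by (simp add: g_def)
  have pm: "is_cpath Y (pmap X Y \<phi> p)" "pter Y (pmap X Y \<phi> p) = \<tau>\<^sub>0"
    using pmap_rep[OF mor p(1)] pe R(8)[OF base] by simp_all
  have h: "h = hclass Y (pcat Y (pmap X Y \<phi> p) (pconst \<tau>\<^sub>0 g))"
    using R(7) pm g im_hclass[OF mor p(1)] p unfolding g_def[symmetric] by (simp add: Y.hclass_pcat lc_def)
  define k0 where "k0 = ((\<lambda>\<sigma>. lone Y (fV \<sigma>))(\<sigma>\<^sub>0 := g))"
  have k0: "k0 \<sigma> \<in> Gr Y (fV \<sigma>)" if "\<sigma> \<in> vts X" for \<sigma>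
    using g that by (simp add: k0_def)
  have 1: "mor_htpy_by X Y k0 \<phi> (mor_shift_at X Y \<sigma>\<^sub>0 g \<phi>)"
    unfolding mor_shift_at_def k0_def[symmetric] by (rule mor_shift[OF devY mor k0])
  have c0: "mV ?c \<sigma>\<^sub>0 = \<tau>\<^sub>0" using mor_htpyD(3)[OF R(3) base] .
  \<comment> \<open>The inverse of \<open>k\<close> followed by the shift is trivial at the base
    vertex, because both have the value \<open>g\<close> there.\<close>
  have "k0 \<sigma>\<^sub>0 \<odot>[Y,mV ?c \<sigma>\<^sub>0] linv Y (fV \<sigma>\<^sub>0) (k \<sigma>\<^sub>0) = lone Y (mV ?c \<sigma>\<^sub>0)"
    unfolding c0 using g by (simp add: k0_def g_def)
  then have "mor_htpy_rel X Y \<sigma>\<^sub>0 ?c (mor_shift_at X Y \<sigma>\<^sub>0 g \<phi>)"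
    unfolding mor_htpy_rel_def
    by (intro exI[of _ "\<lambda>\<sigma>. k0 \<sigma> \<odot>[Y,mV ?c \<sigma>] linv Y (fV \<sigma>) (k \<sigma>)"] conjI)
      (rule mor_htpy_by_trans[OF devY mor_htpy_by_sym[OF devY R(3)] 1])
  then show "is_eps X Y \<phi> \<sigma>\<^sub>0 h D"
    unfolding is_eps_def cpaths_from_def
    using p(1) pe g h R(1) R(8)[OF base] D by (intro exI[of _ p] exI[of _ g] exI[of _ \<eta>]) simp
qed

text \<open>Both realisations lift the same translated arrow, so by unique lifting their ends agree
  and \<open>k\<close> and \<open>k'\<close> differ by the image of a local \<open>g\<close> at each
  vertex. These \<open>g\<close> come from one chosen arrow per vertex; they still form a natural
  transformation, because \<open>k\<close> and \<open>k'\<close> do and \<open>\<phi>\<close> is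
  faithful.\<close>

lemma realises_unique:
  assumes r: "realises h \<eta> k p" and r': "realises h \<eta>' k' p'"
  shows "mor_htpy X X \<eta> \<eta>'"
proof -
  note D = realisesD[OF r] and D' = realisesD[OF r']
  have ex: "\<exists>g\<in>Gr X (mV \<eta> \<sigma>). mV \<eta>' \<sigma> = mV \<eta> \<sigma> \<and> k \<sigma> = fG (mV \<eta> \<sigma>) g \<odot>[Y,fV \<sigma>] k' \<sigma>"
    if \<sigma>: "\<sigma> \<in> vts X" for \<sigma>
  proof -
    obtain x where "x \<in> arr X \<sigma>\<^sub>0 \<sigma>" using X.connecting_arrow[OF conn base \<sigma>] .
    then have x: "ar X x" "src x = \<sigma>\<^sub>0" "tgt X x = \<sigma>" by (simp_all add: arr_def)
    let ?z = "p \<star>[X] XX.im \<eta> x" and ?z' = "p' \<star>[X] XX.im \<eta>' x"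
    have z: "ar X ?z" "src ?z = \<sigma>\<^sub>0" "tgt X ?z = mV \<eta> \<sigma>" using D(2,4-6) x by simp_all
    have z': "ar X ?z'" "src ?z' = \<sigma>\<^sub>0" "tgt X ?z' = mV \<eta>' \<sigma>" using D'(2,4-6) x by simp_all
    have "fP ?z \<star>[Y] lc Y (fV \<sigma>) (k \<sigma>) = fP ?z' \<star>[Y] lc Y (fV \<sigma>) (k' \<sigma>)"
      using realises_shift[OF r x(1,2)] realises_shift[OF r' x(1,2)] x(3) by simp
    then show ?thesis
      using lift_unique[OF z(1) z'(1), of "fV \<sigma>" "k \<sigma>" "k' \<sigma>"] z z' D(8,9)[OF \<sigma>] D'(8,9)[OF \<sigma>] by auto
  qed
  then obtain g where g: "\<And>\<sigma>. \<sigma> \<in> vts X \<Longrightarrow> g \<sigma> \<in> Gr X (mV \<eta> \<sigma>)"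
      "\<And>\<sigma>. \<sigma> \<in> vts X \<Longrightarrow> mV \<eta>' \<sigma> = mV \<eta> \<sigma>"
      "\<And>\<sigma>. \<sigma> \<in> vts X \<Longrightarrow> k \<sigma> = fG (mV \<eta> \<sigma>) (g \<sigma>) \<odot>[Y,fV \<sigma>] k' \<sigma>"
    by metis
  have mE: "mE \<eta>' a = mE \<eta> a" if a: "a \<in> eds X" for a
  proof -
    have e: "mE \<eta> a \<in> eds X" "mE \<eta>' a \<in> eds X" "org X (mE \<eta>' a) = org X (mE \<eta> a)"
      "fE (mE \<eta>' a) = fE (mE \<eta> a)"
      using D(2) D'(2) D(10)[OF a] D'(10)[OF a] a g(2)[of "org X a"] by simp_all
    then show ?thesis using mE_bij[OF mor, of "org X (mE \<eta> a)"]
      by (auto simp: bij_betw_def dest: inj_onD)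
  qed
  have G: "fG (mV \<eta> \<sigma>) (g \<sigma>) \<in> Gr Y (fV \<sigma>)" if "\<sigma> \<in> vts X" for \<sigma>
    using mor_simps(5)[OF mor _ g(1)[OF that]] D(2,8) that by simp
  have G2: "fP (lc X (mV \<eta> \<sigma>) (g \<sigma>)) = lc Y (fV \<sigma>) (fG (mV \<eta> \<sigma>) (g \<sigma>))" if "\<sigma> \<in> vts X" for \<sigma>
    using im_lc[OF mor _ g(1)[OF that]] D(2,8) that by simp
  have "mor_htpy_by X X g \<eta>' \<eta>"
  proof (rule XX.htpyI[OF devX D'(2) D(2)])
    show "mV \<eta> \<sigma> = mV \<eta>' \<sigma>" "g \<sigma> \<in> Gr X (mV \<eta>' \<sigma>)" if "\<sigma> \<in> vts X" for \<sigma> using g that by simp_all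
    show "mE \<eta> a = mE \<eta>' a" if "a \<in> eds X" for a using mE that by simp
    fix x assume x: "ar X x"
    let ?s = "src x" and ?t = "tgt X x"
    have s: "?s \<in> vts X" and t: "?t \<in> vts X" using x by simp_all
    have e: "ar X (XX.im \<eta> x)" "src (XX.im \<eta> x) = mV \<eta> ?s" "tgt X (XX.im \<eta> x) = mV \<eta> ?t"
      "ar X (XX.im \<eta>' x)" "src (XX.im \<eta>' x) = mV \<eta> ?s" "tgt X (XX.im \<eta>' x) = mV \<eta> ?t"
      using D(2) D'(2) x g(2) s t by simp_all
    have v: "mV \<eta> ?s \<in> vts X" "mV \<eta> ?t \<in> vts X" "fV ?s \<in> vts Y" "fV ?t \<in> vts Y"
      using D(2) s t by simp_all
    have "fP (lc X (mV \<eta> ?s) (g ?s) \<star>[X] XX.im \<eta>' x) \<star>[Y] lc Y (fV ?t) (k' ?t) =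
       lc Y (fV ?s) (fG (mV \<eta> ?s) (g ?s)) \<star>[Y] (fP (XX.im \<eta>' x) \<star>[Y] lc Y (fV ?t) (k' ?t))"
      using e v g(1)[OF s] by (simp add: im_pm G2[OF s] Y.pm_assoc)
    also have "\<dots> = lc Y (fV ?s) (k ?s) \<star>[Y] fP x"
      unfolding realises_nat[OF r' x, symmetric] g(3)[OF s] using G[OF s] D'(9)[OF s] v by (simp add: Y.lc_mult Y.pm_assoc)
    also have "\<dots> = fP (XX.im \<eta> x) \<star>[Y] lc Y (fV ?t) (k ?t)"
      by (rule realises_nat[OF r x])
    also have "\<dots> = fP (XX.im \<eta> x \<star>[X] lc X (mV \<eta> ?t) (g ?t)) \<star>[Y] lc Y (fV ?t) (k' ?t)"
      unfolding g(3)[OF t] using G[OF t] D'(9)[OF t] v e g(1)[OF t] by (simp add: im_pm G2[OF t] Y.lc_mult Y.pm_assoc)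
    \<comment> \<open>Cancelling \<open>k'\<close> leaves the image under \<open>\<phi>\<close> of
      the naturality square for \<open>g\<close>.\<close>
    finally have "fP (lc X (mV \<eta> ?s) (g ?s) \<star>[X] XX.im \<eta>' x) = fP (XX.im \<eta> x \<star>[X] lc X (mV \<eta> ?t) (g ?t))"
      by (rule Y.pm_right_cancel[rotated -1]) (use e v g(1)[OF s] g(1)[OF t] D'(9)[OF t] D(8)[OF t] in simp_all)
    then have "lc X (mV \<eta> ?s) (g ?s) \<star>[X] XX.im \<eta>' x = XX.im \<eta> x \<star>[X] lc X (mV \<eta> ?t) (g ?t)"
      by (rule lift_faithful[rotated -1]) (use e v g(1)[OF s] g(1)[OF t] in simp_all)
    then show "lc X (mV \<eta>' ?s) (g ?s) \<star>[X] XX.im \<eta>' x = XX.im \<eta> x \<star>[X] lc X (mV \<eta>' ?t) (g ?t)"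
      using g(2) s t by simp
  qed
  then show ?thesis using XX.mor_htpy_sym[OF devX] unfolding mor_htpy_def by blast
qed

end

section \<open>Normalizers and the kernel of the action on the universal scwol\<close>

text \<open>The normalizer is a stabilizer, so it demands equality of the conjugate with
  \<open>U\<close>. The second inclusion is conjugation by the inverse, which for infinite
  \<open>U\<close> does not follow from the first.\<close>

lemma (in group) normalizer_iff:
  assumes U: "subgroup U G"
  shows "h \<in> normalizer G U \<longleftrightarrow>
    h \<in> carrier G \<and> (\<forall>u\<in>U. h \<otimes> u \<otimes> inv h \<in> U) \<and> (\<forall>u\<in>U. inv h \<otimes> u \<otimes> h \<in> U)"
proof -
  have sub: "U \<subseteq> carrier G" by (rule subgroup.subset[OF U])
  have eq: "h <# U #> inv h = (\<lambda>u. h \<otimes> u \<otimes> inv h) ` U" for h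
    by (auto simp: l_coset_def r_coset_def)
  have "(\<lambda>u. h \<otimes> u \<otimes> inv h) ` U = U \<longleftrightarrow> (\<forall>u\<in>U. h \<otimes> u \<otimes> inv h \<in> U) \<and> (\<forall>u\<in>U. inv h \<otimes> u \<otimes> h \<in> U)"
    if h: "h \<in> carrier G"
  proof -
    have 1: "h \<otimes> (inv h \<otimes> u \<otimes> h) \<otimes> inv h = u" "inv h \<otimes> (h \<otimes> u \<otimes> inv h) \<otimes> h = u" if "u \<in> U" for u
    proof -
      have u: "u \<in> carrier G" using that sub by blast
      have "h \<otimes> (inv h \<otimes> u) = u" "inv h \<otimes> (h \<otimes> u) = u"
        using h u by (simp_all add: m_assoc[symmetric])
      then show "h \<otimes> (inv h \<otimes> u \<otimes> h) \<otimes> inv h = u" "inv h \<otimes> (h \<otimes> u \<otimes> inv h) \<otimes> h = u"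
        using h u by (simp_all add: m_assoc)
    qed
    show ?thesis
    proof
      assume e: "(\<lambda>u. h \<otimes> u \<otimes> inv h) ` U = U"
      have "inv h \<otimes> u \<otimes> h \<in> U" if "u \<in> U" for u
      proof -
        have "u \<in> (\<lambda>u. h \<otimes> u \<otimes> inv h) ` U" using that by (simp only: e)
        then obtain w where w: "u = h \<otimes> w \<otimes> inv h" "w \<in> U" by (rule imageE)
        show ?thesis unfolding w(1) 1(2)[OF w(2)] by (rule w(2))
      qed
      then show "(\<forall>u\<in>U. h \<otimes> u \<otimes> inv h \<in> U) \<and> (\<forall>u\<in>U. inv h \<otimes> u \<otimes> h \<in> U)" using e by blast
    next
      assume a: "(\<forall>u\<in>U. h \<otimes> u \<otimes> inv h \<in> U) \<and> (\<forall>u\<in>U. inv h \<otimes> u \<otimes> h \<in> U)"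
      have "u \<in> (\<lambda>u. h \<otimes> u \<otimes> inv h) ` U" if "u \<in> U" for u
        by (rule image_eqI[where x = "inv h \<otimes> u \<otimes> h"], rule 1(1)[OF that, symmetric]) (use a that in blast)
      then show "(\<lambda>u. h \<otimes> u \<otimes> inv h) ` U = U" using a by blast
    qed
  qed
  then show ?thesis unfolding normalizer_def stabilizer_def using sub by (auto simp: eq)
qed

context complex_of_groups
begin

text \<open>Vertices of the universal scwol become arrows from the base vertex modulo right
  multiplication by the local group at the end.\<close>

lemma uclass_eq_iff:
  assumes p: "p \<in> cpaths_from X \<sigma>" and q: "q \<in> cpaths_from X \<sigma>"
  shows "uclass X \<sigma> q = uclass X \<sigma> p \<longleftrightarrow>
    (\<exists>g\<in>Gr X (pter X p). hclass X q = hclass X p \<star>[X] lc X (pter X p) g)"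
proof -
  have u: "uclass X \<sigma> p = {q \<in> cpaths_from X \<sigma>. \<exists>g\<in>Gr X (pter X p). hclass X q = hclass X p \<star>[X] lc X (pter X p) g}"
    if "p \<in> cpaths_from X \<sigma>" for p
    using that by (auto simp: uclass_def cpaths_from_def hclass_pcat lc_def)
  have c: "is_cpath X p" "is_cpath X q" using p q by (simp_all add: cpaths_from_def)
  show ?thesis
  proof
    assume "uclass X \<sigma> q = uclass X \<sigma> p"
    moreover have "q \<in> uclass X \<sigma> q" unfolding u[OF q] using q c
      by (auto intro!: bexI[of _ "lone X (pter X q)"])
    ultimately show "\<exists>g\<in>Gr X (pter X p). hclass X q = hclass X p \<star>[X] lc X (pter X p) g" unfolding u[OF p] by blast
  next
    assume "\<exists>g\<in>Gr X (pter X p). hclass X q = hclass X p \<star>[X] lc X (pter X p) g"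
    then obtain g where g: "g \<in> Gr X (pter X p)" "hclass X q = hclass X p \<star>[X] lc X (pter X p) g" by blast
    let ?t = "pter X p"
    have t: "?t \<in> vts X" using c by simp
    interpret G: group "grp X ?t" using t by (rule local_group)
    have "tgt X (hclass X q) = ?t" using g(1) c t unfolding g(2) by simp
    then have qt: "pter X q = ?t" using c by simp
    have p': "hclass X p = hclass X q \<star>[X] lc X ?t (linv X ?t g)"
      unfolding g(2) using g(1) t c by (simp add: pm_assoc lc_mult[symmetric])
    have "(\<exists>k\<in>Gr X ?t. hclass X r = hclass X q \<star>[X] lc X ?t k) \<longleftrightarrow> (\<exists>k\<in>Gr X ?t. hclass X r = hclass X p \<star>[X] lc X ?t k)" for r
    proof
      assume "\<exists>k\<in>Gr X ?t. hclass X r = hclass X q \<star>[X] lc X ?t k"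
      then obtain k where "k \<in> Gr X ?t" "hclass X r = hclass X q \<star>[X] lc X ?t k" by blast
      then show "\<exists>k\<in>Gr X ?t. hclass X r = hclass X p \<star>[X] lc X ?t k"
        using g t by (intro bexI[of _ "g \<odot>[X,?t] k"]) (simp_all add: lc_mult pm_assoc)
    next
      assume "\<exists>k\<in>Gr X ?t. hclass X r = hclass X p \<star>[X] lc X ?t k"
      then obtain k where "k \<in> Gr X ?t" "hclass X r = hclass X p \<star>[X] lc X ?t k" by blast
      then show "\<exists>k\<in>Gr X ?t. hclass X r = hclass X q \<star>[X] lc X ?t k"
        using g(1) t by (intro bexI[of _ "linv X ?t g \<odot>[X,?t] k"]) (simp_all add: p' lc_mult pm_assoc)
    qed
    then show "uclass X \<sigma> q = uclass X \<sigma> p" unfolding u[OF p] u[OF q] qt by blast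
  qed
qed

lemma act_vert_uclass:
  assumes r: "is_cpath X r" "pini r = \<sigma>" "pter X r = \<sigma>" and p: "p \<in> cpaths_from X \<sigma>"
  shows "act_vert X \<sigma> (hclass X r) (uclass X \<sigma> p) = uclass X \<sigma> (pcat X r p)"
proof -
  have c: "is_cpath X p" "pini p = \<sigma>" using p by (simp_all add: cpaths_from_def)
  have rp: "pcat X r p \<in> cpaths_from X \<sigma>" using r c by (simp add: cpaths_from_def)
  have eq: "uclass X \<sigma> (pcat X r' p') = uclass X \<sigma> (pcat X r p)" if r': "cpath_htpy X r r'" and p': "p' \<in> uclass X \<sigma> p" for r' p'
  proof -
    note e = htpy_ends[OF r']
    obtain g where g: "g \<in> Gr X (pter X p)" "hclass X p' = hclass X p \<star>[X] lc X (pter X p) g" and p'c: "is_cpath X p'" "pini p' = \<sigma>"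
      using p' c by (auto simp: uclass_def cpaths_from_def hclass_pcat lc_def)
    have h: "hclass X r' = hclass X r" using hclass_eq_iff[OF r(1)] r' by blast
    have "pcat X r' p' \<in> cpaths_from X \<sigma>" using e r p'c by (simp add: cpaths_from_def)
    moreover have "hclass X (pcat X r' p') = hclass X (pcat X r p) \<star>[X] lc X (pter X (pcat X r p)) g"
      using e r c p'c by (simp add: hclass_pcat h g(2) pm_assoc)
    ultimately show ?thesis using uclass_eq_iff[OF rp] g(1) r c by auto
  qed
  have "r \<in> hclass X r" using r by (simp add: cpath_htpy.refl)
  moreover have "p \<in> uclass X \<sigma> p" using p c
    by (auto simp: uclass_def intro!: bexI[of _ "lone X (pter X p)"])
  moreover have "act_vert X \<sigma> (hclass X r) (uclass X \<sigma> p) = (\<Union>r'\<in>hclass X r. \<Union>p'\<in>uclass X \<sigma> p. uclass X \<sigma> (pcat X r p))"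
    unfolding act_vert_def by (intro SUP_cong) (simp_all only: in_hclass_iff eq)
  ultimately show ?thesis by blast
qed

text \<open>By \<open>uclass_eq_iff\<close>, an element fixes the vertex of \<open>y\<close> when
  left multiplication by it only changes \<open>y\<close> by a local factor at the end. Fixing all
  vertices suffices.\<close>

lemma act_kernel_iff:
  "c \<in> act_kernel X \<sigma> \<longleftrightarrow> c \<in> arr X \<sigma> \<sigma> \<and>
    (\<forall>y. ar X y \<and> src y = \<sigma> \<longrightarrow> (\<exists>g\<in>Gr X (tgt X y). c \<star>[X] y = y \<star>[X] lc X (tgt X y) g))"
proof (cases "c \<in> arr X \<sigma> \<sigma>")
  case True
  then obtain r where r: "is_cpath X r" "c = hclass X r" by (auto simp: arr_def elim: arE)
  have re: "pini r = \<sigma>" "pter X r = \<sigma>" using True r by (simp_all add: arr_def)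
  have fix_iff: "act_vert X \<sigma> c (uclass X \<sigma> p) = uclass X \<sigma> p \<longleftrightarrow>
     (\<exists>g\<in>Gr X (pter X p). c \<star>[X] hclass X p = hclass X p \<star>[X] lc X (pter X p) g)"
    if p: "p \<in> cpaths_from X \<sigma>" for p
  proof -
    have c: "is_cpath X p" "pini p = \<sigma>" using p by (simp_all add: cpaths_from_def)
    have "pcat X r p \<in> cpaths_from X \<sigma>" using r re c by (simp add: cpaths_from_def)
    then show ?thesis using uclass_eq_iff[OF p] r re c
      by (simp add: act_vert_uclass[OF r(1) re p] hclass_pcat)
  qed
  have "(\<forall>A\<in>verts (universal_scwol X \<sigma>). act_vert X \<sigma> c A = A) \<longleftrightarrow>
    (\<forall>p\<in>cpaths_from X \<sigma>. \<exists>g\<in>Gr X (pter X p). c \<star>[X] hclass X p = hclass X p \<star>[X] lc X (pter X p) g)"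
    by (simp add: universal_scwol_def fix_iff)
  also have "\<dots> \<longleftrightarrow> (\<forall>y. ar X y \<and> src y = \<sigma> \<longrightarrow> (\<exists>g\<in>Gr X (tgt X y). c \<star>[X] y = y \<star>[X] lc X (tgt X y) g))"
    (is "?L = ?R")
  proof
    assume L: ?L
    show ?R
    proof (intro allI impI)
      fix y assume y: "ar X y \<and> src y = \<sigma>"
      then obtain p where p: "is_cpath X p" "y = hclass X p" by (auto elim: arE)
      then have "p \<in> cpaths_from X \<sigma>" using y by (simp add: cpaths_from_def)
      then show "\<exists>g\<in>Gr X (tgt X y). c \<star>[X] y = y \<star>[X] lc X (tgt X y) g" using L p by simp
    qed
  next
    assume R: ?R
    show ?L
    proof
      fix p assume "p \<in> cpaths_from X \<sigma>"
      then have p: "is_cpath X p" "pini p = \<sigma>" by (simp_all add: cpaths_from_def)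
      then show "\<exists>g\<in>Gr X (pter X p). c \<star>[X] hclass X p = hclass X p \<star>[X] lc X (pter X p) g"
        using R[rule_format, of "hclass X p"] by simp
    qed
  qed
  finally have v: "(\<forall>A\<in>verts (universal_scwol X \<sigma>). act_vert X \<sigma> c A = A) \<longleftrightarrow> ?R" .
  \<comment> \<open>An edge consists of its two end vertices and a label, and the action leaves the
    label alone.\<close>
  have "act_edge X \<sigma> c x = x" if V: "\<forall>A\<in>verts (universal_scwol X \<sigma>). act_vert X \<sigma> c A = A"
    and x: "x \<in> edges (universal_scwol X \<sigma>)" for x
  proof -
    obtain p a where pa: "x = uedge X \<sigma> p a" "p \<in> cpaths_from X \<sigma>" "a \<in> eds X" "org X a = pter X p"
      using x by (auto simp: universal_scwol_def)
    have "pcat X p (pfwd X a) \<in> cpaths_from X \<sigma>" using pa by (simp add: cpaths_from_def)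
    then have "uclass X \<sigma> p \<in> verts (universal_scwol X \<sigma>)" "uclass X \<sigma> (pcat X p (pfwd X a)) \<in> verts (universal_scwol X \<sigma>)"
      using pa(2) by (simp_all add: universal_scwol_def)
    then show ?thesis using V unfolding pa(1) uedge_def act_edge_def by simp
  qed
  then have E: "(\<forall>A\<in>verts (universal_scwol X \<sigma>). act_vert X \<sigma> c A = A) \<Longrightarrow>
     (\<forall>x\<in>edges (universal_scwol X \<sigma>). act_edge X \<sigma> c x = x)" by blast
  have K: "c \<in> act_kernel X \<sigma> \<longleftrightarrow> c \<in> arr X \<sigma> \<sigma> \<and> (\<forall>A\<in>verts (universal_scwol X \<sigma>). act_vert X \<sigma> c A = A) \<and>
     (\<forall>x\<in>edges (universal_scwol X \<sigma>). act_edge X \<sigma> c x = x)"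
    by (simp only: act_kernel_def pi1_carrier mem_Collect_eq)
  show ?thesis unfolding K v[symmetric] using True E by blast
next
  case False
  then show ?thesis by (simp add: act_kernel_def pi1_carrier)
qed

end

section \<open>Realised elements: normality, homotopy and products\<close>

context deck_setting
begin

text \<open>Conjugation is written without inverses of images, in the form used for computing with
  arrows; both \<open>h\<close> and its inverse appear in order to express equality of
  \<open>U\<close> with its conjugate.\<close>

definition normalises :: "('w, 'd, 'h) cpath set \<Rightarrow> bool" where
  "normalises h \<longleftrightarrow> h \<in> arr Y \<tau>\<^sub>0 \<tau>\<^sub>0 \<and>
     (\<forall>v\<in>arr X \<sigma>\<^sub>0 \<sigma>\<^sub>0. \<exists>v'\<in>arr X \<sigma>\<^sub>0 \<sigma>\<^sub>0. h \<star>[Y] fP v = fP v' \<star>[Y] h) \<and>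
     (\<forall>v\<in>arr X \<sigma>\<^sub>0 \<sigma>\<^sub>0. \<exists>v'\<in>arr X \<sigma>\<^sub>0 \<sigma>\<^sub>0. iv Y h \<star>[Y] fP v = fP v' \<star>[Y] iv Y h)"

lemma normalises_iv: "normalises h \<Longrightarrow> normalises (iv Y h)"
  by (auto simp: normalises_def arr_def)

lemma induced_group_hom: "group_hom (pi1 X \<sigma>\<^sub>0) (pi1 Y \<tau>\<^sub>0) (fP)"
proof (intro group_hom.intro group_hom_axioms.intro homI)
  show "group (pi1 X \<sigma>\<^sub>0)" "group (pi1 Y \<tau>\<^sub>0)" using base by (simp_all add: X.pi1_group Y.pi1_group)
qed (simp_all add: X.pi1_carrier Y.pi1_carrier arr_def X.pi1_mult Y.pi1_mult im_pm)

lemma U_subgroup: "subgroup (fP ` carrier (pi1 X \<sigma>\<^sub>0)) (pi1 Y \<tau>\<^sub>0)"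
  by (rule group_hom.img_is_subgroup[OF induced_group_hom])

lemma normalizer_eq: "normalizer (pi1 Y \<tau>\<^sub>0) (fP ` carrier (pi1 X \<sigma>\<^sub>0)) = {h. normalises h}"
proof (rule Set.set_eqI)
  fix h
  interpret G: group "pi1 Y \<tau>\<^sub>0" using Y.pi1_group by simp
  have conj: "h \<star>[Y] fP v = fP v' \<star>[Y] h \<longleftrightarrow> h \<otimes>\<^bsub>pi1 Y \<tau>\<^sub>0\<^esub> fP v \<otimes>\<^bsub>pi1 Y \<tau>\<^sub>0\<^esub> inv\<^bsub>pi1 Y \<tau>\<^sub>0\<^esub> h = fP v'"
    if h: "h \<in> arr Y \<tau>\<^sub>0 \<tau>\<^sub>0" and v: "v \<in> arr X \<sigma>\<^sub>0 \<sigma>\<^sub>0" "v' \<in> arr X \<sigma>\<^sub>0 \<sigma>\<^sub>0" for h v v'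
  proof -
    have c: "h \<in> carrier (pi1 Y \<tau>\<^sub>0)" "fP v \<in> carrier (pi1 Y \<tau>\<^sub>0)" "fP v' \<in> carrier (pi1 Y \<tau>\<^sub>0)"
      using h v by (simp_all add: Y.pi1_carrier arr_def)
    have "h \<star>[Y] fP v = h \<otimes>\<^bsub>pi1 Y \<tau>\<^sub>0\<^esub> fP v" "fP v' \<star>[Y] h = fP v' \<otimes>\<^bsub>pi1 Y \<tau>\<^sub>0\<^esub> h"
      using h v by (simp_all add: Y.pi1_mult arr_def)
    then show ?thesis using c by (metis G.inv_solve_right G.m_closed)
  qed
  have e: "(\<forall>u\<in>fP ` carrier (pi1 X \<sigma>\<^sub>0). h \<otimes>\<^bsub>pi1 Y \<tau>\<^sub>0\<^esub> u \<otimes>\<^bsub>pi1 Y \<tau>\<^sub>0\<^esub> inv\<^bsub>pi1 Y \<tau>\<^sub>0\<^esub> h \<in> fP ` carrier (pi1 X \<sigma>\<^sub>0)) \<longleftrightarrow>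
     (\<forall>v\<in>arr X \<sigma>\<^sub>0 \<sigma>\<^sub>0. \<exists>v'\<in>arr X \<sigma>\<^sub>0 \<sigma>\<^sub>0. h \<star>[Y] fP v = fP v' \<star>[Y] h)" if h: "h \<in> arr Y \<tau>\<^sub>0 \<tau>\<^sub>0" for h
    unfolding X.pi1_carrier using conj[OF h] by (auto simp: image_iff)
  have i: "iv Y h \<in> arr Y \<tau>\<^sub>0 \<tau>\<^sub>0" "inv\<^bsub>pi1 Y \<tau>\<^sub>0\<^esub> h = iv Y h" "inv\<^bsub>pi1 Y \<tau>\<^sub>0\<^esub> (iv Y h) = h" if "h \<in> arr Y \<tau>\<^sub>0 \<tau>\<^sub>0"
    using that by (simp_all add: Y.pi1_inv) (simp_all add: arr_def Y.pi1_inv)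
  show "h \<in> normalizer (pi1 Y \<tau>\<^sub>0) (fP ` carrier (pi1 X \<sigma>\<^sub>0)) \<longleftrightarrow> h \<in> {h. normalises h}"
  proof (cases "h \<in> arr Y \<tau>\<^sub>0 \<tau>\<^sub>0")
    case True
    show ?thesis unfolding G.normalizer_iff[OF U_subgroup] normalises_def mem_Collect_eq
      using True e[OF True] e[OF i(1)[OF True]] i(2,3)[OF True] by (simp add: Y.pi1_carrier)
  next
    case False
    then show ?thesis unfolding G.normalizer_iff[OF U_subgroup] normalises_def by (simp add: Y.pi1_carrier)
  qed
qed

text \<open>Conjugating the image of a loop \<open>v\<close> by \<open>h\<close> gives the image of
  the loop running along \<open>p\<close>, \<open>\<eta>(v)\<close> and back along \<open>p\<close>.
  For the inverse of \<open>h\<close>, the loop is found by solving for \<open>v\<close>, which is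
  possible since \<open>\<eta>\<close> is full.\<close>

lemma realises_normalises:
  assumes r: "realises h \<eta> k p"
  shows "normalises h"
proof -
  note D = realisesD[OF r] and e = realises_ends[OF r]
  let ?l = "mV \<eta> \<sigma>\<^sub>0"
  have key: "h \<star>[Y] fP v = fP (p \<star>[X] XX.im \<eta> v \<star>[X] iv X p) \<star>[Y] h" if v: "v \<in> arr X \<sigma>\<^sub>0 \<sigma>\<^sub>0" for v
  proof -
    have v': "ar X v" "src v = \<sigma>\<^sub>0" "tgt X v = \<sigma>\<^sub>0" using v by (simp_all add: arr_def)
    have m: "ar X (XX.im \<eta> v)" "src (XX.im \<eta> v) = ?l" "tgt X (XX.im \<eta> v) = ?l" using D(2) v' by simp_all
    have "fP (p \<star>[X] XX.im \<eta> v \<star>[X] iv X p) \<star>[Y] h =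
        fP (p \<star>[X] XX.im \<eta> v) \<star>[Y] (fP (iv X p) \<star>[Y] (fP p \<star>[Y] lc Y \<tau>\<^sub>0 (k \<sigma>\<^sub>0)))"
      using D(4-7) m by (simp add: im_pm Y.pm_assoc)
    also have "\<dots> = fP (p \<star>[X] XX.im \<eta> v) \<star>[Y] lc Y \<tau>\<^sub>0 (k \<sigma>\<^sub>0)"
      using D(4-6) D(8,9)[OF base] m by (simp add: im_iv)
    finally show ?thesis using realises_shift[OF r v'(1,2)] v'(3) by simp
  qed
  have 1: "\<exists>v'\<in>arr X \<sigma>\<^sub>0 \<sigma>\<^sub>0. h \<star>[Y] fP v = fP v' \<star>[Y] h" if v: "v \<in> arr X \<sigma>\<^sub>0 \<sigma>\<^sub>0" for v
  proof -
    have "p \<star>[X] XX.im \<eta> v \<star>[X] iv X p \<in> arr X \<sigma>\<^sub>0 \<sigma>\<^sub>0" using D(2,4-6) v by (simp add: arr_def)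
    then show ?thesis using key[OF v] by blast
  qed
  have 2: "\<exists>v'\<in>arr X \<sigma>\<^sub>0 \<sigma>\<^sub>0. iv Y h \<star>[Y] fP v = fP v' \<star>[Y] iv Y h" if v: "v \<in> arr X \<sigma>\<^sub>0 \<sigma>\<^sub>0" for v
  proof -
    have v': "ar X v" "src v = \<sigma>\<^sub>0" "tgt X v = \<sigma>\<^sub>0" using v by (simp_all add: arr_def)
    have y: "ar X (iv X p \<star>[X] v \<star>[X] p)" "src (iv X p \<star>[X] v \<star>[X] p) = ?l" "tgt X (iv X p \<star>[X] v \<star>[X] p) = ?l"
      using D(4-6) v' by simp_all
    \<comment> \<open>The loop \<open>z\<close> is chosen so that transporting its image under
      \<open>\<eta>\<close> along \<open>p\<close> gives back \<open>v\<close>.\<close>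
    obtain z where z: "ar X z" "src z = \<sigma>\<^sub>0" "tgt X z = \<sigma>\<^sub>0" "XX.im \<eta> z = iv X p \<star>[X] v \<star>[X] p"
      using Aut_full[OF D(1) base base y] .
    have za: "z \<in> arr X \<sigma>\<^sub>0 \<sigma>\<^sub>0" using z by (simp add: arr_def)
    have "p \<star>[X] XX.im \<eta> z \<star>[X] iv X p = v"
      unfolding z(4) using D(4-6) v' by (simp add: X.pm_assoc)
    then have k: "h \<star>[Y] fP z = fP v \<star>[Y] h" using key[OF za] by simp
    have "iv Y h \<star>[Y] fP v = iv Y h \<star>[Y] (fP v \<star>[Y] h) \<star>[Y] iv Y h"
      using e v' by (simp add: Y.pm_assoc)
    also have "\<dots> = fP z \<star>[Y] iv Y h"
      unfolding k[symmetric] using e z by simp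
    finally show ?thesis using za by blast
  qed
  show ?thesis unfolding normalises_def using e 1 2 by (simp add: arr_def)
qed

text \<open>A homotopy \<open>g\<close> from \<open>\<eta>\<close> to \<open>\<eta>'\<close>
  multiplies \<open>k\<close> on the left by the image of \<open>g\<close>; appending the inverse of
  \<open>g\<close> to \<open>p\<close> compensates at the base vertex, so \<open>h\<close> is
  unchanged.\<close>

lemma realises_htpy:
  assumes r: "realises h \<eta> k p" and m: "mor_htpy X X \<eta> \<eta>'"
  shows "\<exists>k' p'. realises h \<eta>' k' p'"
proof -
  note D = realisesD[OF r]
  obtain g where g: "mor_htpy_by X X g \<eta> \<eta>'" using m unfolding mor_htpy_def by blast
  note E = XX.mor_htpyD[OF g]
  let ?l = "mV \<eta> \<sigma>\<^sub>0"
  let ?k = "\<lambda>\<sigma>. fG (mV \<eta> \<sigma>) (g \<sigma>) \<odot>[Y,fV \<sigma>] k \<sigma>"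
  have h: "mor_htpy_by X Y ?k \<phi> (cog_comp X Y \<phi> \<eta>')"
    by (rule mor_htpy_by_trans[OF devY D(3) mor_htpy_postcomp[OF cogs(1,1,2) devY g mor]])
  have v: "?l \<in> vts X" using D(2) base by simp
  have gl: "g \<sigma>\<^sub>0 \<in> Gr X ?l" using E(5)[OF base] .
  have mg: "fG ?l (g \<sigma>\<^sub>0) \<in> Gr Y \<tau>\<^sub>0" using mor_simps(5)[OF mor v gl] D(8)[OF base] by simp
  let ?p = "p \<star>[X] lc X ?l (linv X ?l (g \<sigma>\<^sub>0))"
  have p: "?p \<in> arr X \<sigma>\<^sub>0 (mV \<eta>' \<sigma>\<^sub>0)" using D(4-6) v gl E(3)[OF base] by (simp add: arr_def)
  have "fP ?p \<star>[Y] lc Y \<tau>\<^sub>0 (?k \<sigma>\<^sub>0) = fP p \<star>[Y] lc Y \<tau>\<^sub>0 (linv Y \<tau>\<^sub>0 (fG ?l (g \<sigma>\<^sub>0)) \<odot>[Y,\<tau>\<^sub>0] (fG ?l (g \<sigma>\<^sub>0) \<odot>[Y,\<tau>\<^sub>0] k \<sigma>\<^sub>0))"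
    using D(4-6) v gl mg D(8,9)[OF base] by (simp only: im_pm[OF mor] im_lc[OF mor] Y.lc_mult mG_inv[OF mor] X.lc_ends X.l_inv_closed Y.l_inv_closed Y.l_closed \<tau>\<^sub>0_vert Y.pm_assoc)
  then have "h = fP ?p \<star>[Y] lc Y \<tau>\<^sub>0 (?k \<sigma>\<^sub>0)" using D(7) mg D(9)[OF base] by simp
  then have "realises h \<eta>' ?k ?p" unfolding realises_def using Aut_htpy[OF D(1) g] h p by blast
  then show ?thesis by blast
qed

text \<open>The homotopy for \<open>\<eta>'\<close> is followed by the one for \<open>\<eta>\<close>
  evaluated at the vertices moved by \<open>\<eta>'\<close>. The new arrow is \<open>p\<close>
  followed by \<open>\<eta>(p')\<close>, as one sees by translating \<open>p'\<close> with
  \<open>h\<close>.\<close>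

lemma realises_mult:
  assumes r: "realises h \<eta> k p" and r': "realises h' \<eta>' k' p'"
  shows "\<exists>l q. realises (h \<star>[Y] h') (cog_comp X X \<eta> \<eta>') l q"
proof -
  note D = realisesD[OF r] and D' = realisesD[OF r']
  let ?c = "cog_comp X X \<eta> \<eta>'" and ?f = "cog_comp X Y \<phi> \<eta>"
  have A: "?c \<in> cog_Aut X" by (rule Aut_comp[OF D(1) D'(1)])
  have f: "cog_morphism X Y ?f" by (rule comp_mor[OF D(2)])
  let ?k = "\<lambda>\<sigma>. k (mV \<eta>' \<sigma>) \<odot>[Y,fV \<sigma>] k' \<sigma>"
  have 1: "mor_htpy_by X Y ?k \<phi> (cog_comp X Y ?f \<eta>')"
    by (rule mor_htpy_by_trans[OF devY D'(3) mor_htpy_precomp[OF cogs(1,1,2) devY D(3) D'(2)]])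
  \<comment> \<open>The two bracketings of the triple composite have the same functor but need not
    be equal as records. The trivial homotopy between them is the source of the extra identity
    factor in \<open>?l\<close>.\<close>
  have 2: "mor_htpy_by X Y (\<lambda>\<sigma>. lone Y (mV (cog_comp X Y ?f \<eta>') \<sigma>)) (cog_comp X Y ?f \<eta>') (cog_comp X Y \<phi> ?c)"
  proof (rule mor_htpy_by_same[OF devY])
    show "cog_morphism X Y (cog_comp X Y ?f \<eta>')" by (rule cog_comp(1)[OF cogs(1,1,2) devY D'(2) f])
    show "cog_morphism X Y (cog_comp X Y \<phi> ?c)" by (rule comp_mor[OF AutD(1)[OF A]])
    show "im (cog_comp X Y \<phi> ?c) x = im (cog_comp X Y ?f \<eta>') x" if "ar X x" for x
      using that D'(2) by (simp add: comp_im[OF AutD(1)[OF A]] cog_comp(2)[OF cogs(1,1,2) devY D'(2) f]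
          cog_comp(2)[OF cogs(1,1,1) devX D'(2) D(2)] comp_im[OF D(2)])
  qed (simp_all add: cog_comp_def)
  have k: "k (mV \<eta>' \<sigma>) \<in> Gr Y (fV \<sigma>)" if "\<sigma> \<in> vts X" for \<sigma>
    using D(9)[of "mV \<eta>' \<sigma>"] D'(2) D'(8)[OF that] that by simp
  let ?l = "\<lambda>\<sigma>. lone Y (mV (cog_comp X Y ?f \<eta>') \<sigma>) \<odot>[Y,fV \<sigma>] ?k \<sigma>"
  have 3: "mor_htpy_by X Y ?l \<phi> (cog_comp X Y \<phi> ?c)" by (rule mor_htpy_by_trans[OF devY 1 2])
  have l0: "?l \<sigma>\<^sub>0 = ?k \<sigma>\<^sub>0"
    using mor_htpyD(3)[OF 1 base] k[OF base] D'(9)[OF base] by simp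
  let ?q = "p \<star>[X] XX.im \<eta> p'"
  have q: "?q \<in> arr X \<sigma>\<^sub>0 (mV ?c \<sigma>\<^sub>0)" using D(2,4-6) D'(4-6) by (simp add: arr_def cog_comp_def)
  have "h \<star>[Y] h' = (h \<star>[Y] fP p') \<star>[Y] lc Y \<tau>\<^sub>0 (k' \<sigma>\<^sub>0)" unfolding D'(7) by (simp add: Y.pm_assoc)
  also have "\<dots> = fP ?q \<star>[Y] lc Y \<tau>\<^sub>0 (?k \<sigma>\<^sub>0)"
    unfolding realises_shift[OF r D'(4,5)] D'(6) using D'(8,9)[OF base] k[OF base] by (simp add: Y.lc_mult Y.pm_assoc)
  finally have "h \<star>[Y] h' = fP ?q \<star>[Y] lc Y \<tau>\<^sub>0 (?l \<sigma>\<^sub>0)" unfolding l0 .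
  then have "realises (h \<star>[Y] h') ?c ?l ?q" unfolding realises_def using A 3 q by blast
  then show ?thesis by blast
qed

section \<open>Lifting translated arrows\<close>

definition trans_by :: "('w, 'd, 'h) cpath set \<Rightarrow> ('v, 'e, 'g) cpath set \<Rightarrow> ('v, 'e, 'g) cpath set \<Rightarrow> 'h \<Rightarrow> bool" where
  "trans_by h x q k \<longleftrightarrow> ar X x \<and> src x = \<sigma>\<^sub>0 \<and> ar X q \<and> src q = \<sigma>\<^sub>0 \<and> fV (tgt X q) = fV (tgt X x) \<and>
     k \<in> Gr Y (fV (tgt X x)) \<and> h \<star>[Y] fP x = fP q \<star>[Y] lc Y (fV (tgt X x)) k"

lemma trans_byD:
  assumes "trans_by h x q k"
  shows "ar X x" "src x = \<sigma>\<^sub>0" "ar X q" "src q = \<sigma>\<^sub>0" "fV (tgt X q) = fV (tgt X x)"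
    "k \<in> Gr Y (fV (tgt X x))" "h \<star>[Y] fP x = fP q \<star>[Y] lc Y (fV (tgt X x)) k"
  using assms by (auto simp: trans_by_def)

lemma trans_by_ex:
  assumes "h \<in> arr Y \<tau>\<^sub>0 \<tau>\<^sub>0" "ar X x" "src x = \<sigma>\<^sub>0"
  shows "\<exists>q k. trans_by h x q k"
proof -
  have "ar Y (h \<star>[Y] fP x)" "src (h \<star>[Y] fP x) = \<tau>\<^sub>0" "tgt Y (h \<star>[Y] fP x) = fV (tgt X x)"
    using assms by (simp_all add: arr_def)
  then show ?thesis
    using lift_exists[OF mor back_lifting, of "h \<star>[Y] fP x" \<sigma>\<^sub>0] base assms unfolding trans_by_def by metis
qed

text \<open>Lifts of translates can be read backwards; this provides the inverses needed for showing
  that the constructed map is an automorphism.\<close>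

lemma trans_by_iv:
  assumes h: "h \<in> arr Y \<tau>\<^sub>0 \<tau>\<^sub>0" and t: "trans_by h x q k"
  shows "trans_by (iv Y h) q x (linv Y (fV (tgt X x)) k)"
proof -
  let ?v = "fV (tgt X x)"
  note T = trans_byD[OF t]
  have v: "?v \<in> vts Y" using T by simp
  have "fP x = iv Y h \<star>[Y] (h \<star>[Y] fP x)" using h T(1-5) by (simp add: arr_def)
  also have "\<dots> = iv Y h \<star>[Y] fP q \<star>[Y] lc Y ?v k" using T by (simp add: Y.pm_assoc)
  finally have "fP x \<star>[Y] lc Y ?v (linv Y ?v k) = iv Y h \<star>[Y] (fP q \<star>[Y] lc Y ?v (k \<odot>[Y,?v] linv Y ?v k))"
    using T(1-6) v by (simp only: Y.lc_mult Y.pm_assoc Y.l_inv_closed)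
  then show ?thesis using T(1-6) v unfolding trans_by_def by simp
qed

text \<open>Here the normalizing property is used. Closing \<open>z\<close> up to a loop at the base
  vertex and conjugating by \<open>h\<close> gives a loop \<open>v\<close> of the source; rerouting
  \<open>v\<close> along \<open>q\<close> and \<open>q'\<close> gives the arrow
  \<open>y\<close>.\<close>

lemma trans_by_arrow:
  assumes n: "normalises h" and t: "trans_by h x q k" and t': "trans_by h x' q' k'"
    and z: "ar X z" "src z = tgt X x" "tgt X z = tgt X x'"
  obtains y where "ar X y" "src y = tgt X q" "tgt X y = tgt X q'"
    "lc Y (fV (tgt X x)) k \<star>[Y] fP z = fP y \<star>[Y] lc Y (fV (tgt X x')) k'"
proof -
  note T = trans_byD[OF t] and T' = trans_byD[OF t']
  have h: "ar Y h" "src h = \<tau>\<^sub>0" "tgt Y h = \<tau>\<^sub>0" using n by (simp_all add: normalises_def arr_def)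
  let ?u = "x \<star>[X] z \<star>[X] iv X x'"
  have u: "?u \<in> arr X \<sigma>\<^sub>0 \<sigma>\<^sub>0" using T T' z by (simp add: arr_def)
  obtain v where "v \<in> arr X \<sigma>\<^sub>0 \<sigma>\<^sub>0" and vh: "h \<star>[Y] fP ?u = fP v \<star>[Y] h"
    using n u unfolding normalises_def by blast
  then have v: "ar X v" "src v = \<sigma>\<^sub>0" "tgt X v = \<sigma>\<^sub>0" by (simp_all add: arr_def)
  have xz: "x \<star>[X] z = ?u \<star>[X] x'" using T T' z by (simp add: X.pm_assoc)
  let ?y = "iv X q \<star>[X] v \<star>[X] q'"
  have c: "fV (tgt X x) \<in> vts Y" "fV (tgt X x') \<in> vts Y" using T T' by simp_all
  have "fP q \<star>[Y] (lc Y (fV (tgt X x)) k \<star>[Y] fP z) = (h \<star>[Y] fP x) \<star>[Y] fP z"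
    unfolding T(7) by (simp only: Y.pm_assoc)
  also have "\<dots> = h \<star>[Y] fP (?u \<star>[X] x')"
    using T(1-5) z by (simp add: xz[symmetric] im_pm Y.pm_assoc)
  also have "\<dots> = (h \<star>[Y] fP ?u) \<star>[Y] fP x'"
    using T(1-5) T'(1-5) u by (simp add: arr_def im_pm[of \<phi> ?u] Y.pm_assoc)
  also have "\<dots> = fP v \<star>[Y] (h \<star>[Y] fP x')" unfolding vh by (simp add: Y.pm_assoc)
  also have "\<dots> = fP v \<star>[Y] (fP q' \<star>[Y] lc Y (fV (tgt X x')) k')" unfolding T'(7) by (rule HOL.refl)
  finally have "iv Y (fP q) \<star>[Y] (fP q \<star>[Y] (lc Y (fV (tgt X x)) k \<star>[Y] fP z)) =
      iv Y (fP q) \<star>[Y] (fP v \<star>[Y] (fP q' \<star>[Y] lc Y (fV (tgt X x')) k'))"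
    by (rule arg_cong)
  then have "lc Y (fV (tgt X x)) k \<star>[Y] fP z = iv Y (fP q) \<star>[Y] (fP v \<star>[Y] (fP q' \<star>[Y] lc Y (fV (tgt X x')) k'))"
    using T(1-6) z c by simp
  also have "\<dots> = fP ?y \<star>[Y] lc Y (fV (tgt X x')) k'"
    using T(1-5) T'(1-5) v by (simp add: im_pm im_iv Y.pm_assoc)
  finally show ?thesis using that[of ?y] T(1-5) T'(1-5) v by simp
qed

text \<open>The case of a trivial \<open>z\<close>: its transported arrow is compared with a trivial
  arrow by unique lifting, so the vertex map of a translation does not depend on the arrow chosen to
  reach a vertex.\<close>

lemma trans_by_tgt:
  assumes n: "normalises h" and t: "trans_by h x q k" and t': "trans_by h x' q' k'" and e: "tgt X x' = tgt X x"
  shows "tgt X q' = tgt X q"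
proof -
  note T = trans_byD[OF t] and T' = trans_byD[OF t']
  let ?v = "fV (tgt X x)"
  let ?o = "\<lambda>\<sigma>. lc X \<sigma> (lone X \<sigma>)"
  obtain y where y: "ar X y" "src y = tgt X q" "tgt X y = tgt X q'"
    "lc Y ?v k \<star>[Y] fP (?o (tgt X x)) = fP y \<star>[Y] lc Y (fV (tgt X x')) k'"
    by (rule trans_by_arrow[OF n t t', of "?o (tgt X x)"]) (use T e in simp_all)
  have v: "?v \<in> vts Y" "tgt X q \<in> vts X" using T by simp_all
  have "fP (?o (tgt X q)) \<star>[Y] lc Y ?v k = lc Y ?v k \<star>[Y] fP (?o (tgt X x))"
    using T(1-6) v by simp
  also have "\<dots> = fP y \<star>[Y] lc Y ?v k'" unfolding y(4) e by (rule HOL.refl)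
  finally have "fP (?o (tgt X q)) \<star>[Y] lc Y ?v k = fP y \<star>[Y] lc Y ?v k'" .
  then have "\<exists>g\<in>Gr X (tgt X (?o (tgt X q))). tgt X y = tgt X (?o (tgt X q)) \<and> y = ?o (tgt X q) \<star>[X] lc X (tgt X (?o (tgt X q))) g \<and>
     k = fG (tgt X (?o (tgt X q))) g \<odot>[Y,?v] k'"
    by (intro lift_unique) (use y(1-3) T(1-6) T'(1-6) v e in simp_all)
  then show ?thesis using y v by auto
qed

text \<open>Compare \<open>y\<close> with the trivial arrow at its source: both lift the same local
  element.\<close>

lemma lift_local:
  assumes y: "ar X y" "src y = \<sigma>" "tgt X y = \<sigma>" and g: "g \<in> Gr Y (fV \<sigma>)" and eq: "fP y = lc Y (fV \<sigma>) g"
  obtains g' where "g' \<in> Gr X \<sigma>" "y = lc X \<sigma> g'" "fG \<sigma> g' = g"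
proof -
  have \<sigma>: "\<sigma> \<in> vts X" using y by auto
  let ?o = "lc X \<sigma> (lone X \<sigma>)"
  have "\<exists>k\<in>Gr X (tgt X ?o). tgt X y = tgt X ?o \<and> y = ?o \<star>[X] lc X (tgt X ?o) k \<and> g = fG (tgt X ?o) k \<odot>[Y,fV \<sigma>] lone Y (fV \<sigma>)"
    by (rule lift_unique) (use y g eq \<sigma> in simp_all)
  then show ?thesis using that \<sigma> by auto
qed

text \<open>Compare \<open>y\<close> with the edge \<open>a\<close>, using the factor
  \<open>fA a\<close> to cancel the inverse that \<open>im_ed\<close> attaches to the image of
  \<open>a\<close>.\<close>

lemma lift_edge:
  assumes y: "ar X y" and a: "a \<in> eds X" "org X a = src y"
    and g: "g \<in> Gr Y (fV (tgt X y))" and e: "trg Y (fE a) = fV (tgt X y)"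
    and eq: "fP y = ed Y (fE a) \<star>[Y] lc Y (fV (tgt X y)) g"
  obtains g' where "trg X a = tgt X y" "g' \<in> Gr X (tgt X y)" "y = ed X a \<star>[X] lc X (tgt X y) g'"
proof -
  let ?t = "fV (tgt X y)"
  have t: "fV (trg X a) = ?t" "?t \<in> vts Y" using a e y by simp_all
  have A: "fA a \<in> Gr Y ?t" using mor_simps(6)[OF mor a(1)] t by simp
  have "fP (ed X a) \<star>[Y] lc Y ?t (fA a \<odot>[Y,?t] g) = fP y \<star>[Y] lc Y ?t (lone Y ?t)"
  proof -
    have "fP (ed X a) \<star>[Y] lc Y ?t (fA a \<odot>[Y,?t] g) = ed Y (fE a) \<star>[Y] lc Y ?t (linv Y ?t (fA a) \<odot>[Y,?t] (fA a \<odot>[Y,?t] g))"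
      unfolding im_ed[OF mor a(1)] t(1) Y.pm_assoc using A g t(2) by (simp only: Y.lc_mult Y.l_inv_closed Y.l_closed)
    moreover have "fP y \<star>[Y] lc Y ?t (lone Y ?t) = fP y" using y by simp
    ultimately show ?thesis using A g t(2) unfolding eq by simp
  qed
  then have "\<exists>k\<in>Gr X (tgt X (ed X a)). tgt X y = tgt X (ed X a) \<and> y = ed X a \<star>[X] lc X (tgt X (ed X a)) k \<and>
    fA a \<odot>[Y,?t] g = fG (tgt X (ed X a)) k \<odot>[Y,?t] lone Y ?t"
    by (intro lift_unique) (use y a g t A in simp_all)
  then show ?thesis using that a(1) by auto
qed

text \<open>The choice at the base vertex is trivial so that translating it returns \<open>h\<close>
  itself.\<close>

lemma based_arrows:
  "\<exists>P. (\<forall>\<sigma>\<in>vts X. P \<sigma> \<in> arr X \<sigma>\<^sub>0 \<sigma>) \<and> P \<sigma>\<^sub>0 = lc X \<sigma>\<^sub>0 (lone X \<sigma>\<^sub>0)"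
proof -
  have "\<forall>\<sigma>\<in>vts X. \<exists>x. x \<in> arr X \<sigma>\<^sub>0 \<sigma>" using X.connecting_arrow[OF conn base] by blast
  then obtain P where P: "\<forall>\<sigma>\<in>vts X. P \<sigma> \<in> arr X \<sigma>\<^sub>0 \<sigma>" by metis
  have "lc X \<sigma>\<^sub>0 (lone X \<sigma>\<^sub>0) \<in> arr X \<sigma>\<^sub>0 \<sigma>\<^sub>0" using base by (simp add: arr_def)
  then show ?thesis using P by (intro exI[of _ "P(\<sigma>\<^sub>0 := lc X \<sigma>\<^sub>0 (lone X \<sigma>\<^sub>0))"]) auto
qed

end

text \<open>Translation by \<open>h\<close>, in terms of chosen arrows \<open>P \<sigma>\<close> from \<open>\<sigma>\<^sub>0\<close> to \<open>\<sigma>\<close>: lifting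
  \<open>h \<phi>(P \<sigma>) = \<phi>(Q \<sigma>) k\<^sub>\<sigma>\<close> yields the vertex map \<open>l\<close> and the family \<open>k\<close>, and \<open>F\<close> is the functor
  with \<open>\<phi>(F z) = k \<phi>(z) k\<^sup>-\<^sup>1\<close>, from which the automorphism is read off.\<close>

locale translation = deck_setting X Y \<phi> \<sigma>\<^sub>0
  for X :: "('v, 'e, 'g) cog" and Y :: "('w, 'd, 'h) cog" and \<phi> and \<sigma>\<^sub>0 :: 'v +
  fixes h :: "('w, 'd, 'h) cpath set" and P Q :: "'v \<Rightarrow> ('v, 'e, 'g) cpath set" and k :: "'v \<Rightarrow> 'h"
  assumes n: "normalises h"
    and P: "\<sigma> \<in> vts X \<Longrightarrow> P \<sigma> \<in> arr X \<sigma>\<^sub>0 \<sigma>" "P \<sigma>\<^sub>0 = lc X \<sigma>\<^sub>0 (lone X \<sigma>\<^sub>0)"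
    and Qk: "\<sigma> \<in> vts X \<Longrightarrow> trans_by h (P \<sigma>) (Q \<sigma>) (k \<sigma>)"
begin

lemma h: "h \<in> arr Y \<tau>\<^sub>0 \<tau>\<^sub>0"
  using n by (simp add: normalises_def)

lemma h': "iv Y h \<in> arr Y \<tau>\<^sub>0 \<tau>\<^sub>0" "iv Y (iv Y h) = h"
  using h by (simp_all add: arr_def)

lemmas n' = normalises_iv[OF n]

abbreviation "kf \<sigma> \<equiv> lc Y (fV \<sigma>) (k \<sigma>)"

definition l :: "'v \<Rightarrow> 'v" where "l \<sigma> = tgt X (Q \<sigma>)"

lemma tP: "tgt X (P \<sigma>) = \<sigma>" if "\<sigma> \<in> vts X" for \<sigma> using P(1)[OF that] by (simp add: arr_def)

lemma Q: "ar X (Q \<sigma>)" "src (Q \<sigma>) = \<sigma>\<^sub>0" "fV (l \<sigma>) = fV \<sigma>" "l \<sigma> \<in> vts X" and k: "k \<sigma> \<in> Gr Y (fV \<sigma>)"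
  if "\<sigma> \<in> vts X" for \<sigma>
  using Qk[OF that] tP[OF that] by (simp_all add: trans_by_def l_def)

text \<open>Translation by the inverse of \<open>h\<close> undoes \<open>l\<close>: injectivity is
  \<open>trans_by_tgt\<close> for the inverse, and a preimage of a vertex is the end of the lift of
  the inversely translated arrow to it.\<close>

lemma l_bij: "bij_betw l (vts X) (vts X)"
  unfolding bij_betw_def
proof
  show "inj_on l (vts X)"
  proof (rule inj_onI)
    fix \<sigma> \<tau> assume a: "\<sigma> \<in> vts X" "\<tau> \<in> vts X" "l \<sigma> = l \<tau>"
    have "tgt X (P \<tau>) = tgt X (P \<sigma>)"
      using trans_by_tgt[OF n' trans_by_iv[OF h Qk[OF a(1)]] trans_by_iv[OF h Qk[OF a(2)]]] a(3) by (simp add: l_def)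
    then show "\<sigma> = \<tau>" using tP a by simp
  qed
  show "l ` vts X = vts X"
  proof (intro subset_antisym subsetI)
    fix \<sigma> assume "\<sigma> \<in> l ` vts X" then show "\<sigma> \<in> vts X" using Q by blast
  next
    fix \<tau> assume \<tau>: "\<tau> \<in> vts X"
    have p: "ar X (P \<tau>)" "src (P \<tau>) = \<sigma>\<^sub>0" using P(1)[OF \<tau>] by (simp_all add: arr_def)
    obtain q c where t: "trans_by (iv Y h) (P \<tau>) q c" using trans_by_ex[OF h'(1) p] by blast
    have t2: "trans_by h q (P \<tau>) (linv Y (fV (tgt X (P \<tau>))) c)"
      using trans_by_iv[OF h'(1) t] unfolding h'(2) .
    have q: "tgt X q \<in> vts X" using t by (simp add: trans_by_def)
    have "tgt X (Q (tgt X q)) = tgt X (P \<tau>)"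
      by (rule trans_by_tgt[OF n t2 Qk[OF q]]) (simp add: tP[OF q])
    then have "l (tgt X q) = \<tau>" using tP[OF \<tau>] by (simp add: l_def)
    then show "\<tau> \<in> l ` vts X" using q by blast
  qed
qed

definition F :: "('v, 'e, 'g) cpath set \<Rightarrow> ('v, 'e, 'g) cpath set" where
  "F z = (THE y. ar X y \<and> src y = l (src z) \<and> tgt X y = l (tgt X z) \<and>
     kf (src z) \<star>[Y] fP z = fP y \<star>[Y] kf (tgt X z))"

text \<open>Cancelling the homotopy factor determines the image of the arrow, and
  \<open>\<phi>\<close> is faithful. Thus any arrow satisfying the square is the value of
  \<open>F\<close>.\<close>

lemma F_eq: "F z = y" if z: "ar X z" and y: "ar X y" "src y = l (src z)" "tgt X y = l (tgt X z)"
    "kf (src z) \<star>[Y] fP z = fP y \<star>[Y] kf (tgt X z)" for z y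
  unfolding F_def
proof (rule the_equality)
  fix w assume w: "ar X w \<and> src w = l (src z) \<and> tgt X w = l (tgt X z) \<and>
    kf (src z) \<star>[Y] fP z = fP w \<star>[Y] kf (tgt X z)"
  have v: "src z \<in> vts X" "tgt X z \<in> vts X" using z by simp_all
  have "fP w \<star>[Y] kf (tgt X z) = fP y \<star>[Y] kf (tgt X z)"
    using w y(4) by simp
  then have "fP w = fP y"
    by (rule Y.pm_right_cancel[rotated -1]) (use w y v Q(3) k in simp_all)
  then show "w = y" by (rule lift_faithful[rotated -1]) (use w y in simp_all)
qed (use y in simp)

lemma F: "ar X (F z)" "src (F z) = l (src z)" "tgt X (F z) = l (tgt X z)"
    "kf (src z) \<star>[Y] fP z = fP (F z) \<star>[Y] kf (tgt X z)"
  if z: "ar X z" for z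
proof -
  have v: "src z \<in> vts X" "tgt X z \<in> vts X" using z by simp_all
  obtain y where y: "ar X y" "src y = l (src z)" "tgt X y = l (tgt X z)"
    "kf (src z) \<star>[Y] fP z = fP y \<star>[Y] kf (tgt X z)"
    by (rule trans_by_arrow[OF n Qk[OF v(1)] Qk[OF v(2)] z]) (use tP v in \<open>simp_all add: l_def\<close>)
  show "ar X (F z)" "src (F z) = l (src z)" "tgt X (F z) = l (tgt X z)"
    "kf (src z) \<star>[Y] fP z = fP (F z) \<star>[Y] kf (tgt X z)"
    unfolding F_eq[OF z y] by (rule y)+
qed

text \<open>The pasted squares of \<open>x\<close> and \<open>y\<close> form a square for the
  product, so \<open>F_eq\<close> applies.\<close>

lemma F_mult: "F (x \<star>[X] y) = F x \<star>[X] F y" if xy: "ar X x" "ar X y" "tgt X x = src y" for x y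
proof (rule F_eq)
  have "kf (src x) \<star>[Y] fP (x \<star>[X] y) =
     fP (F x) \<star>[Y] (kf (src y) \<star>[Y] fP y)"
    using F(4)[OF xy(1)] xy by (simp add: im_pm) (metis Y.pm_assoc)
  also have "\<dots> = fP (F x \<star>[X] F y) \<star>[Y] kf (tgt X y)"
    unfolding F(4)[OF xy(2)] using F(1-3)[OF xy(1)] F(1-3)[OF xy(2)] xy by (simp add: im_pm Y.pm_assoc)
  finally show "kf (src (x \<star>[X] y)) \<star>[Y] fP (x \<star>[X] y) =
    fP (F x \<star>[X] F y) \<star>[Y] kf (tgt X (x \<star>[X] y))" using xy by simp
qed (use xy F in simp_all)

section \<open>Reading the automorphism off the translation functor\<close>

text \<open>The square at a local element shows that \<open>F\<close> sends it to an arrow over the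
  conjugate of its image, and such an arrow is local by \<open>lift_local\<close>.\<close>

lemma eG_ex: "\<exists>g'\<in>Gr X (l \<sigma>). F (lc X \<sigma> g) = lc X (l \<sigma>) g' \<and> fG (l \<sigma>) g' = conj_by (grp Y (fV \<sigma>)) (k \<sigma>) (fG \<sigma> g)"
  if a: "\<sigma> \<in> vts X" "g \<in> Gr X \<sigma>" for \<sigma> g
proof -
  let ?v = "fV \<sigma>" and ?y = "F (lc X \<sigma> g)"
  have y: "ar X ?y" "src ?y = l \<sigma>" "tgt X ?y = l \<sigma>" "lc Y ?v (k \<sigma>) \<star>[Y] lc Y ?v (fG \<sigma> g) = fP ?y \<star>[Y] lc Y ?v (k \<sigma>)"
    using F[of "lc X \<sigma> g"] a by (simp_all add: im_lc)
  have c: "?v \<in> vts Y" "k \<sigma> \<in> Gr Y ?v" "fG \<sigma> g \<in> Gr Y ?v" using a k by simp_all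
  have "fP ?y = fP ?y \<star>[Y] lc Y ?v (k \<sigma>) \<star>[Y] lc Y ?v (linv Y ?v (k \<sigma>))"
    using y(1-3) Q(3)[OF a(1)] c by (simp add: Y.pm_assoc Y.lc_mult[symmetric])
  also have "\<dots> = lc Y (fV (l \<sigma>)) (conj_by (grp Y ?v) (k \<sigma>) (fG \<sigma> g))"
    unfolding y(4)[symmetric] conj_by_def Q(3)[OF a(1)] using c by (simp add: Y.lc_mult)
  finally have e: "fP ?y = lc Y (fV (l \<sigma>)) (conj_by (grp Y ?v) (k \<sigma>) (fG \<sigma> g))" .
  have "conj_by (grp Y ?v) (k \<sigma>) (fG \<sigma> g) \<in> Gr Y (fV (l \<sigma>))" using c Q(3)[OF a(1)] by (simp add: conj_by_def)
  from lift_local[OF y(1-3) this e] show ?thesis by metis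
qed

definition eG :: "'v \<Rightarrow> 'g \<Rightarrow> 'g" where
  "eG \<sigma> g = (SOME g'. g' \<in> Gr X (l \<sigma>) \<and> F (lc X \<sigma> g) = lc X (l \<sigma>) g' \<and>
     fG (l \<sigma>) g' = conj_by (grp Y (fV \<sigma>)) (k \<sigma>) (fG \<sigma> g))"

lemma eG: "eG \<sigma> g \<in> Gr X (l \<sigma>)" "F (lc X \<sigma> g) = lc X (l \<sigma>) (eG \<sigma> g)"
    "fG (l \<sigma>) (eG \<sigma> g) = conj_by (grp Y (fV \<sigma>)) (k \<sigma>) (fG \<sigma> g)"
  if "\<sigma> \<in> vts X" "g \<in> Gr X \<sigma>"
  unfolding eG_def using someI_ex[OF eG_ex[OF that, unfolded Bex_def]] by blast+

definition eE :: "'e \<Rightarrow> 'e" where "eE a = edge_lift (l (org X a)) (fE a)"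

lemma eE: "eE a \<in> eds X" "org X (eE a) = l (org X a)" "fE (eE a) = fE a"
  if a: "a \<in> eds X" for a
  using edge_lift[of "l (org X a)" "fE a"] Q(3,4)[of "org X a"] a unfolding eE_def by simp_all

text \<open>The square at an edge shows that \<open>F\<close> sends it to an arrow over the same
  target edge followed by a local factor; \<open>lift_edge\<close> then identifies the edge of the
  source and its end.\<close>

lemma eA_ex: "\<exists>c\<in>Gr X (l (trg X a)). trg X (eE a) = l (trg X a) \<and>
   F (ed X a) = ed X (eE a) \<star>[X] lc X (l (trg X a)) (linv X (l (trg X a)) c)"
  if a: "a \<in> eds X" for a
proof -
  let ?i = "org X a" and ?t = "trg X a" and ?y = "F (ed X a)"
  let ?vi = "fV ?i" and ?v = "fV ?t"
  have y: "ar X ?y" "src ?y = l ?i" "tgt X ?y = l ?t" "lc Y ?vi (k ?i) \<star>[Y] fP (ed X a) = fP ?y \<star>[Y] lc Y ?v (k ?t)"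
    using F[of "ed X a"] a by simp_all
  have lt: "fV (l ?t) = ?v" "l ?t \<in> vts X" using Q(3,4)[of ?t] a by simp_all
  have c: "?v \<in> vts Y" "k ?i \<in> Gr Y ?vi" "k ?t \<in> Gr Y ?v" "fA a \<in> Gr Y ?v" "psi Y (fE a) (k ?i) \<in> Gr Y ?v"
    using a k by simp_all
  \<comment> \<open>Obtained by solving the square for the image of \<open>?y\<close>, after sliding
    the factor of \<open>k\<close> at the start through the edge.\<close>
  let ?g = "psi Y (fE a) (k ?i) \<odot>[Y,?v] linv Y ?v (fA a) \<odot>[Y,?v] linv Y ?v (k ?t)"
  have g: "?g \<in> Gr Y (fV (tgt X ?y))" unfolding y(3) lt using c by simp
  have "fP ?y = fP ?y \<star>[Y] lc Y ?v (k ?t) \<star>[Y] lc Y ?v (linv Y ?v (k ?t))"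
    using y(1,3) lt c by (simp add: Y.pm_assoc Y.lc_mult[symmetric])
  also have "\<dots> = (lc Y ?vi (k ?i) \<star>[Y] ed Y (fE a)) \<star>[Y] lc Y ?v (linv Y ?v (fA a)) \<star>[Y] lc Y ?v (linv Y ?v (k ?t))"
    unfolding y(4)[symmetric] im_ed[OF mor a] by (simp add: Y.pm_assoc)
  also have "\<dots> = ed Y (fE (eE a)) \<star>[Y] lc Y (fV (tgt X ?y)) ?g"
    unfolding Y_lc_ed[OF mor a c(2)] eE(3)[OF a] y(3) lt using c by (simp add: Y.lc_mult Y.pm_assoc)
  finally have e: "fP ?y = ed Y (fE (eE a)) \<star>[Y] lc Y (fV (tgt X ?y)) ?g" .
  have i: "org X (eE a) = src ?y" using eE(2)[OF a] y(2) by simp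
  have tt: "trg Y (fE (eE a)) = fV (tgt X ?y)" unfolding eE(3)[OF a] y(3) lt using a by simp
  obtain g' where g': "trg X (eE a) = tgt X ?y" "g' \<in> Gr X (tgt X ?y)" "?y = ed X (eE a) \<star>[X] lc X (tgt X ?y) g'"
    by (rule lift_edge[OF y(1) eE(1)[OF a] i g tt e])
  show ?thesis
    \<comment> \<open>The witness is inverted because a morphism attaches the inverse of its element
      to an edge.\<close>
    using g' lt(2) unfolding y(3) by (intro bexI[of _ "linv X (l ?t) g'"]) simp_all
qed

definition eA :: "'e \<Rightarrow> 'g" where
  "eA a = (SOME c. c \<in> Gr X (l (trg X a)) \<and> trg X (eE a) = l (trg X a) \<and>
     F (ed X a) = ed X (eE a) \<star>[X] lc X (l (trg X a)) (linv X (l (trg X a)) c))"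

lemma eA: "eA a \<in> Gr X (l (trg X a))" "trg X (eE a) = l (trg X a)"
    "F (ed X a) = ed X (eE a) \<star>[X] lc X (l (trg X a)) (linv X (l (trg X a)) (eA a))"
  if "a \<in> eds X"
  unfolding eA_def using someI_ex[OF eA_ex[OF that, unfolded Bex_def]] by blast+

definition \<eta> :: "('v, 'e, 'g, 'v, 'e, 'g) cog_map" where
  "\<eta> = \<lparr>mV = l, mE = eE, mG = eG, mA = eA\<rparr>"

lemma \<eta>: "mV \<eta> = l" "mE \<eta> = eE" "mG \<eta> = eG" "mA \<eta> = eA" by (simp_all add: \<eta>_def)

lemma out_inj: "a = b" if "a \<in> eds X" "b \<in> eds X" "org X a = org X b" "fE a = fE b" for a b
  by (rule HOL.trans[OF HOL.sym[OF edge_lift_eq[OF that(1), unfolded that(3,4)]] edge_lift_eq[OF that(2)]])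

lemma out: "bij_betw eE {a \<in> eds X. org X a = \<sigma>} {c \<in> eds X. org X c = l \<sigma>}"
  if \<sigma>: "\<sigma> \<in> vts X" for \<sigma>
  unfolding bij_betw_def
proof
  show "inj_on eE {a \<in> eds X. org X a = \<sigma>}"
  proof (rule inj_onI)
    fix a b assume a: "a \<in> {a \<in> eds X. org X a = \<sigma>}" and b: "b \<in> {a \<in> eds X. org X a = \<sigma>}" and e: "eE a = eE b"
    have "fE a = fE b" using eE(3)[of a] eE(3)[of b] a b e by simp
    then show "a = b" using a b by (intro out_inj) simp_all
  qed
  show "eE ` {a \<in> eds X. org X a = \<sigma>} = {c \<in> eds X. org X c = l \<sigma>}"
  proof (intro subset_antisym subsetI)
    fix c assume "c \<in> eE ` {a \<in> eds X. org X a = \<sigma>}"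
    then show "c \<in> {c \<in> eds X. org X c = l \<sigma>}" using eE by auto
  next
    fix c assume "c \<in> {c \<in> eds X. org X c = l \<sigma>}"
    then have c: "c \<in> eds X" "org X c = l \<sigma>" by simp_all
    have b: "fE c \<in> eds Y" "org Y (fE c) = fV \<sigma>" using c Q(3)[OF \<sigma>] by simp_all
    note a = edge_lift[OF \<sigma> b]
    have "eE (edge_lift \<sigma> (fE c)) = c"
      using eE[OF a(1)] a c by (intro out_inj) simp_all
    then show "c \<in> eE ` {a \<in> eds X. org X a = \<sigma>}" using a by force
  qed
qed

text \<open>Outgoing edges are determined by their start and their image under \<open>f\<close>, so
  \<open>eE\<close> respects composition because \<open>f\<close> does.\<close>

lemma sm: "scwol_morphism (shape X) (shape X) (mV \<eta>) (mE \<eta>)"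
  unfolding scwol_morphism_def \<eta>
proof (intro conjI ballI impI)
  fix a b assume ab: "a \<in> eds X" "b \<in> eds X" "org X a = trg X b"
  have 1: "org X (eE a) = trg X (eE b)" using eE(2)[OF ab(1)] eA(2)[OF ab(2)] ab(3) by simp
  have c: "cpo X a b \<in> eds X" "org X (cpo X a b) = org X b"
    using ab by (simp_all add: X.cmp_closed X.ini_cmp)
  have c': "cpo X (eE a) (eE b) \<in> eds X" "org X (cpo X (eE a) (eE b)) = org X (eE b)"
    using ab eE(1) 1 by (simp_all add: X.cmp_closed X.ini_cmp)
  show "eE (cpo X a b) = cpo X (eE a) (eE b)"
  proof (rule out_inj[OF eE(1)[OF c(1)] c'(1)])
    show "org X (eE (cpo X a b)) = org X (cpo X (eE a) (eE b))"
      unfolding c'(2) eE(2)[OF c(1)] eE(2)[OF ab(2)] c(2) by (rule HOL.refl)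
    show "fE (eE (cpo X a b)) = fE (cpo X (eE a) (eE b))"
      unfolding eE(3)[OF c(1)] mE_cmp[OF mor ab] mE_cmp[OF mor eE(1)[OF ab(1)] eE(1)[OF ab(2)] 1] eE(3)[OF ab(1)] eE(3)[OF ab(2)]
      by (rule HOL.refl)
  qed
qed (use Q(4) eE eA(2) out in blast)+

lemma mor\<eta>: "cog_morphism X X \<eta>"
proof (rule XX.morphismI[OF devX sm, where F = F])
  show "F (x \<star>[X] y) = F x \<star>[X] F y" if "ar X x" "ar X y" "tgt X x = src y" for x y by (rule F_mult[OF that])
qed (use eG eA in \<open>simp_all add: \<eta>\<close>)

lemma F_im: "XX.im \<eta> z = F z" if "ar X z" for z
  by (rule XX.im_eqI[OF mor\<eta> _ _ _ _ _ that])
    (simp_all add: F F_mult eG eA XX.im_lc[OF mor\<eta>] XX.im_ed[OF mor\<eta>] \<eta>)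

lemma Aut: "\<eta> \<in> cog_Aut X"
proof (rule AutI[OF mor\<eta>])
  show "bij_betw (mV \<eta>) (vts X) (vts X)" unfolding \<eta> by (rule l_bij)
  show "bij_betw (mE \<eta>) (eds X) (eds X)"
    unfolding \<eta> bij_betw_def
  proof
    show "inj_on eE (eds X)"
    proof (rule inj_onI)
      fix a b assume ab: "a \<in> eds X" "b \<in> eds X" "eE a = eE b"
      have "l (org X a) = l (org X b)" using eE(2)[OF ab(1)] eE(2)[OF ab(2)] ab(3) by simp
      then have "org X a = org X b" using l_bij ab by (auto simp: bij_betw_def dest: inj_onD)
      moreover have "fE a = fE b" using eE(3)[OF ab(1)] eE(3)[OF ab(2)] ab(3) by simp
      ultimately show "a = b" by (rule out_inj[OF ab(1,2)])
    qed
    show "eE ` eds X = eds X"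
    proof (intro subset_antisym subsetI)
      fix c assume "c \<in> eE ` eds X" then show "c \<in> eds X" using eE(1) by blast
    next
      fix c assume c: "c \<in> eds X"
      then have "org X c \<in> l ` vts X" using l_bij by (simp add: bij_betw_def)
      then obtain \<sigma> where \<sigma>: "org X c = l \<sigma>" "\<sigma> \<in> vts X" by (rule imageE)
      have "c \<in> eE ` {a \<in> eds X. org X a = \<sigma>}"
        using out[OF \<sigma>(2)] c \<sigma>(1) by (simp add: bij_betw_def)
      then show "c \<in> eE ` eds X" by blast
    qed
  qed
  fix \<sigma> assume \<sigma>: "\<sigma> \<in> vts X"
  let ?v = "fV \<sigma>"
  have v: "?v \<in> vts Y" "k \<sigma> \<in> Gr Y ?v" using \<sigma> k by simp_all
  show "bij_betw (mG \<eta> \<sigma>) (Gr X \<sigma>) (Gr X (mV \<eta> \<sigma>))"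
    unfolding \<eta> bij_betw_def
  proof
    show "inj_on (eG \<sigma>) (Gr X \<sigma>)"
    proof (rule inj_onI)
      fix x y assume xy: "x \<in> Gr X \<sigma>" "y \<in> Gr X \<sigma>" "eG \<sigma> x = eG \<sigma> y"
      have m: "fG \<sigma> x \<in> Gr Y ?v" "fG \<sigma> y \<in> Gr Y ?v" using \<sigma> xy by simp_all
      have "k \<sigma> \<odot>[Y,?v] fG \<sigma> x \<odot>[Y,?v] linv Y ?v (k \<sigma>) = k \<sigma> \<odot>[Y,?v] fG \<sigma> y \<odot>[Y,?v] linv Y ?v (k \<sigma>)"
        using eG(3)[OF \<sigma> xy(1)] eG(3)[OF \<sigma> xy(2)] xy(3) by (simp add: conj_by_def)
      then have "linv Y ?v (k \<sigma>) \<odot>[Y,?v] (k \<sigma> \<odot>[Y,?v] fG \<sigma> x \<odot>[Y,?v] linv Y ?v (k \<sigma>)) \<odot>[Y,?v] k \<sigma> =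
          linv Y ?v (k \<sigma>) \<odot>[Y,?v] (k \<sigma> \<odot>[Y,?v] fG \<sigma> y \<odot>[Y,?v] linv Y ?v (k \<sigma>)) \<odot>[Y,?v] k \<sigma>" by simp
      then have "fG \<sigma> x = fG \<sigma> y" using v m by (simp add: Y.l_assoc)
      then show "x = y" by (rule mG_inj[OF \<sigma> xy(1,2)])
    qed
    show "eG \<sigma> ` Gr X \<sigma> = Gr X (l \<sigma>)"
    proof (intro subset_antisym subsetI)
      fix c assume "c \<in> eG \<sigma> ` Gr X \<sigma>" then show "c \<in> Gr X (l \<sigma>)" using eG(1)[OF \<sigma>] by blast
    next
      fix c assume c: "c \<in> Gr X (l \<sigma>)"
      \<comment> \<open>For surjectivity, \<open>c\<close> is transported back by the inverse
        translation; the result is local by \<open>lift_local\<close> and is the preimage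
        sought.\<close>
      have t: "trans_by (iv Y h) (Q \<sigma>) (P \<sigma>) (linv Y ?v (k \<sigma>))" using trans_by_iv[OF h Qk[OF \<sigma>]] tP[OF \<sigma>] by simp
      have mc: "fG (l \<sigma>) c \<in> Gr Y ?v" using mor_simps(5)[OF mor Q(4)[OF \<sigma>] c] Q(3)[OF \<sigma>] by simp
      obtain y where y: "ar X y" "src y = tgt X (P \<sigma>)" "tgt X y = tgt X (P \<sigma>)"
        "lc Y (fV (tgt X (Q \<sigma>))) (linv Y ?v (k \<sigma>)) \<star>[Y] fP (lc X (l \<sigma>) c) = fP y \<star>[Y] lc Y (fV (tgt X (Q \<sigma>))) (linv Y ?v (k \<sigma>))"
        by (rule trans_by_arrow[OF n' t t, of "lc X (l \<sigma>) c"]) (use c Q(4)[OF \<sigma>] in \<open>simp_all add: l_def\<close>)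
      have y4: "lc Y ?v (linv Y ?v (k \<sigma>)) \<star>[Y] lc Y ?v (fG (l \<sigma>) c) = fP y \<star>[Y] lc Y ?v (linv Y ?v (k \<sigma>))"
        using y(4) Q(3)[OF \<sigma>] im_lc[OF mor Q(4)[OF \<sigma>] c] by (simp add: l_def)
      have y': "src y = \<sigma>" "tgt X y = \<sigma>" using y tP[OF \<sigma>] by simp_all
      have "fP y = fP y \<star>[Y] lc Y ?v (linv Y ?v (k \<sigma>)) \<star>[Y] lc Y ?v (k \<sigma>)"
        using y(1) y' v by (simp add: Y.pm_assoc Y.lc_mult[symmetric])
      also have "\<dots> = lc Y ?v (linv Y ?v (k \<sigma>) \<odot>[Y,?v] fG (l \<sigma>) c \<odot>[Y,?v] k \<sigma>)"
        unfolding y4[symmetric] using v mc by (simp add: Y.lc_mult)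
      finally have e: "fP y = lc Y ?v (linv Y ?v (k \<sigma>) \<odot>[Y,?v] fG (l \<sigma>) c \<odot>[Y,?v] k \<sigma>)" .
      obtain g where g: "g \<in> Gr X \<sigma>" "fG \<sigma> g = linv Y ?v (k \<sigma>) \<odot>[Y,?v] fG (l \<sigma>) c \<odot>[Y,?v] k \<sigma>"
        by (rule lift_local[OF y(1) y' _ e]) (use v mc in auto)
      have "fG (l \<sigma>) (eG \<sigma> g) = fG (l \<sigma>) c"
        unfolding eG(3)[OF \<sigma> g(1)] g(2) conj_by_def using v mc by (simp add: Y.l_assoc)
      then have "eG \<sigma> g = c" by (rule mG_inj[OF Q(4)[OF \<sigma>] eG(1)[OF \<sigma> g(1)] c])
      then show "c \<in> eG \<sigma> ` Gr X \<sigma>" using g(1) by blast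
    qed
  qed
qed

lemma H: "mor_htpy_by X Y k \<phi> (cog_comp X Y \<phi> \<eta>)"
proof (rule htpyI[OF devY mor comp_mor[OF mor\<eta>]])
  show "kf (src x) \<star>[Y] fP x = im (cog_comp X Y \<phi> \<eta>) x \<star>[Y] kf (tgt X x)"
    if "ar X x" for x
    unfolding comp_im[OF mor\<eta> that] F_im[OF that] by (rule F(4)[OF that])
qed (use Q(3) k eE(3) in \<open>simp_all add: cog_comp_def \<eta>\<close>)

lemma realises_\<eta>: "realises h \<eta> k (Q \<sigma>\<^sub>0)"
proof -
  have "h \<star>[Y] fP (P \<sigma>\<^sub>0) = fP (Q \<sigma>\<^sub>0) \<star>[Y] kf \<sigma>\<^sub>0"
    using Qk[OF base] tP[OF base] by (simp add: trans_by_def)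
  then have "h = fP (Q \<sigma>\<^sub>0) \<star>[Y] kf \<sigma>\<^sub>0" using h base unfolding P(2) by (simp add: arr_def)
  then show ?thesis
    unfolding realises_def using Aut H Q[OF base] by (simp add: arr_def \<eta> l_def)
qed

end

section \<open>Surjectivity, multiplicativity and kernel of \<open>eps\<close>\<close>

context deck_setting
begin

lemma realises_ex:
  assumes n: "normalises h"
  shows "\<exists>\<eta> k p. realises h \<eta> k p"
proof -
  obtain P where P: "\<And>\<sigma>. \<sigma> \<in> vts X \<Longrightarrow> P \<sigma> \<in> arr X \<sigma>\<^sub>0 \<sigma>" "P \<sigma>\<^sub>0 = lc X \<sigma>\<^sub>0 (lone X \<sigma>\<^sub>0)"
    using based_arrows by metis
  have "\<forall>\<sigma>\<in>vts X. \<exists>q k. trans_by h (P \<sigma>) q k"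
    using trans_by_ex n P(1) by (simp add: normalises_def arr_def)
  then obtain Q k where "\<And>\<sigma>. \<sigma> \<in> vts X \<Longrightarrow> trans_by h (P \<sigma>) (Q \<sigma>) (k \<sigma>)" by metis
  then interpret translation X Y \<phi> \<sigma>\<^sub>0 h P Q k
    by unfold_locales (use n P in auto)
  show ?thesis using realises_\<eta> by blast
qed

lemma id_Aut: "cog_id X \<in> cog_Aut X" and id_im: "ar X x \<Longrightarrow> XX.im (cog_id X) x = x"
proof -
  have c: "mV (cog_id X) = (\<lambda>\<sigma>. \<sigma>)" "mE (cog_id X) = (\<lambda>a. a)" "mG (cog_id X) = (\<lambda>\<sigma> g. g)"
    "mA (cog_id X) = (\<lambda>a. lone X (trg X a))" by (simp_all add: cog_id_def)
  have m: "cog_morphism X X (cog_id X)"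
    by (rule XX.morphismI[OF devX, where F = "\<lambda>x. x"]) (simp_all add: c scwol_morphism_def bij_betw_def)
  show "cog_id X \<in> cog_Aut X" by (rule AutI[OF m]) (simp_all add: c bij_betw_def)
  show "XX.im (cog_id X) x = x" if "ar X x"
    using that by (rule XX.im_eqI[OF m, rotated -1]) (simp_all add: XX.im_lc[OF m] XX.im_ed[OF m] c)
qed

lemma realises_one:
  "realises (lc Y \<tau>\<^sub>0 (lone Y \<tau>\<^sub>0)) (cog_id X) (\<lambda>\<sigma>. lone Y (fV \<sigma>)) (lc X \<sigma>\<^sub>0 (lone X \<sigma>\<^sub>0))"
proof -
  note m = AutD(1)[OF id_Aut]
  have "mor_htpy_by X Y (\<lambda>\<sigma>. lone Y (fV \<sigma>)) \<phi> (cog_comp X Y \<phi> (cog_id X))"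
    by (rule mor_htpy_by_same[OF devY mor comp_mor[OF m]]) (simp_all add: comp_im[OF m] id_im, simp_all add: cog_comp_def cog_id_def)
  then show ?thesis using id_Aut base by (simp add: realises_def arr_def) (simp add: cog_id_def)
qed

text \<open>The factor \<open>c\<close> is the value of \<open>k\<close> at the base vertex, now a
  homotopy from \<open>\<phi>\<close> to itself. Naturality at loops shows that it centralises
  \<open>U\<close>, and for any arrow of the target naturality along a lift shows that it lies in
  the kernel.\<close>

lemma realises_id_D:
  assumes r: "realises h (cog_id X) k p"
  shows "\<exists>c\<in>centralizer (pi1 Y \<tau>\<^sub>0) (fP ` carrier (pi1 X \<sigma>\<^sub>0)) \<inter> act_kernel Y \<tau>\<^sub>0.
    \<exists>u\<in>fP ` carrier (pi1 X \<sigma>\<^sub>0). h = c \<otimes>\<^bsub>pi1 Y \<tau>\<^sub>0\<^esub> u"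
proof -
  note D = realisesD[OF r]
  have V: "mV (cog_id X) \<sigma> = \<sigma>" for \<sigma> by (simp add: cog_id_def)
  let ?c = "lc Y \<tau>\<^sub>0 (k \<sigma>\<^sub>0)"
  have k0: "k \<sigma>\<^sub>0 \<in> Gr Y \<tau>\<^sub>0" by (rule D(9)[OF base])
  have nat: "?c \<star>[Y] fP x = fP x \<star>[Y] lc Y (fV (tgt X x)) (k (tgt X x))" if "ar X x" "src x = \<sigma>\<^sub>0" for x
    using realises_nat[OF r that(1)] that by (simp add: id_im)
  have p: "p \<in> carrier (pi1 X \<sigma>\<^sub>0)" using D(4-6) V by (simp add: X.pi1_carrier arr_def)
  have cen: "?c \<in> centralizer (pi1 Y \<tau>\<^sub>0) (fP ` carrier (pi1 X \<sigma>\<^sub>0))"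
    unfolding centralizer_def using k0 nat base by (auto simp: Y.pi1_carrier X.pi1_carrier arr_def Y.pi1_mult)
  have "?c \<in> act_kernel Y \<tau>\<^sub>0"
    unfolding Y.act_kernel_iff
  proof (intro conjI allI impI)
    show "?c \<in> arr Y \<tau>\<^sub>0 \<tau>\<^sub>0" using k0 by (simp add: arr_def)
    fix y assume y: "ar Y y \<and> src y = \<tau>\<^sub>0"
    let ?t = "tgt Y y"
    obtain x g where x: "ar X x" "src x = \<sigma>\<^sub>0" "fV (tgt X x) = ?t" "g \<in> Gr Y ?t" "y = fP x \<star>[Y] lc Y ?t g"
      using lift_exists[OF mor back_lifting, of y \<sigma>\<^sub>0] y base by metis
    have t: "?t \<in> vts Y" using y by simp
    have kt: "k (tgt X x) \<in> Gr Y ?t" using D(9)[of "tgt X x"] x by simp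
    have "?c \<star>[Y] y = (?c \<star>[Y] fP x) \<star>[Y] lc Y ?t g" using x(5) by (simp only: Y.pm_assoc)
    \<comment> \<open>The remainder \<open>g\<close> of the lift of \<open>y\<close> is restored in
      front, which conjugates the value of \<open>k\<close> at the end by \<open>g\<close>.\<close>
    also have "\<dots> = fP x \<star>[Y] lc Y ?t (g \<odot>[Y,?t] (linv Y ?t g \<odot>[Y,?t] (k (tgt X x) \<odot>[Y,?t] g)))"
      unfolding nat[OF x(1,2)] x(3) using t kt x(4) by (simp add: Y.lc_mult Y.pm_assoc)
    also have "\<dots> = y \<star>[Y] lc Y ?t (linv Y ?t g \<odot>[Y,?t] (k (tgt X x) \<odot>[Y,?t] g))"
      using t kt x(4) x(5) by (simp only: Y.lc_mult Y.pm_assoc Y.l_closed Y.l_inv_closed) (metis Y.pm_assoc)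
    finally have "?c \<star>[Y] y = y \<star>[Y] lc Y ?t (linv Y ?t g \<odot>[Y,?t] (k (tgt X x) \<odot>[Y,?t] g))" .
    moreover have "linv Y ?t g \<odot>[Y,?t] (k (tgt X x) \<odot>[Y,?t] g) \<in> Gr Y ?t" using t kt x(4) by simp
    ultimately show "\<exists>g\<in>Gr Y ?t. ?c \<star>[Y] y = y \<star>[Y] lc Y ?t g" by blast
  qed
  moreover have "h = ?c \<otimes>\<^bsub>pi1 Y \<tau>\<^sub>0\<^esub> fP p"
    using D(4-7) V nat[OF D(4,5)] k0 by (simp add: Y.pi1_mult)
  ultimately show ?thesis using cen p by blast
qed

text \<open>Acting trivially, \<open>c\<close> can be pushed along a chosen arrow to every vertex,
  which defines \<open>k\<close>. Commuting with \<open>U\<close> makes the values consistent along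
  arbitrary arrows, so \<open>k\<close> is a homotopy from \<open>\<phi>\<close> to itself with base
  value \<open>c\<close>.\<close>

lemma realises_id_I:
  assumes c: "c \<in> centralizer (pi1 Y \<tau>\<^sub>0) (fP ` carrier (pi1 X \<sigma>\<^sub>0)) \<inter> act_kernel Y \<tau>\<^sub>0"
    and u: "u \<in> fP ` carrier (pi1 X \<sigma>\<^sub>0)"
  shows "\<exists>k p. realises (c \<otimes>\<^bsub>pi1 Y \<tau>\<^sub>0\<^esub> u) (cog_id X) k p"
proof -
  have ca: "ar Y c" "src c = \<tau>\<^sub>0" "tgt Y c = \<tau>\<^sub>0"
    and K: "\<And>y. ar Y y \<Longrightarrow> src y = \<tau>\<^sub>0 \<Longrightarrow> \<exists>g\<in>Gr Y (tgt Y y). c \<star>[Y] y = y \<star>[Y] lc Y (tgt Y y) g"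
    using c Y.act_kernel_iff[of c \<tau>\<^sub>0] by (auto simp: arr_def)
  have com: "c \<star>[Y] fP v = fP v \<star>[Y] c" if v: "v \<in> arr X \<sigma>\<^sub>0 \<sigma>\<^sub>0" for v
  proof -
    have "c \<otimes>\<^bsub>pi1 Y \<tau>\<^sub>0\<^esub> fP v = fP v \<otimes>\<^bsub>pi1 Y \<tau>\<^sub>0\<^esub> c"
      using c v unfolding centralizer_def X.pi1_carrier by blast
    then show ?thesis using v ca by (simp add: Y.pi1_mult arr_def)
  qed
  obtain P where P': "\<And>\<sigma>. \<sigma> \<in> vts X \<Longrightarrow> P \<sigma> \<in> arr X \<sigma>\<^sub>0 \<sigma>" "P \<sigma>\<^sub>0 = lc X \<sigma>\<^sub>0 (lone X \<sigma>\<^sub>0)"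
    using based_arrows by metis
  have P: "ar X (P \<sigma>)" "src (P \<sigma>) = \<sigma>\<^sub>0" "tgt X (P \<sigma>) = \<sigma>" if "\<sigma> \<in> vts X" for \<sigma>
    using P'(1)[OF that] by (simp_all add: arr_def)
  have "\<forall>\<sigma>\<in>vts X. \<exists>g\<in>Gr Y (fV \<sigma>). c \<star>[Y] fP (P \<sigma>) = fP (P \<sigma>) \<star>[Y] lc Y (fV \<sigma>) g"
  proof
    fix \<sigma> assume \<sigma>: "\<sigma> \<in> vts X"
    show "\<exists>g\<in>Gr Y (fV \<sigma>). c \<star>[Y] fP (P \<sigma>) = fP (P \<sigma>) \<star>[Y] lc Y (fV \<sigma>) g"
      using K[of "fP (P \<sigma>)"] P[OF \<sigma>] by simp
  qed
  then obtain k where k: "\<And>\<sigma>. \<sigma> \<in> vts X \<Longrightarrow> k \<sigma> \<in> Gr Y (fV \<sigma>)"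
    "\<And>\<sigma>. \<sigma> \<in> vts X \<Longrightarrow> c \<star>[Y] fP (P \<sigma>) = fP (P \<sigma>) \<star>[Y] lc Y (fV \<sigma>) (k \<sigma>)"
    by metis
  have nat: "lc Y (fV (src x)) (k (src x)) \<star>[Y] fP x = fP x \<star>[Y] lc Y (fV (tgt X x)) (k (tgt X x))"
    if x: "ar X x" for x
  proof -
    let ?s = "src x" and ?t = "tgt X x"
    have s: "?s \<in> vts X" and t: "?t \<in> vts X" using x by simp_all
    note Ps = P[OF s] and Pt = P[OF t]
    \<comment> \<open>Closing \<open>x\<close> up with the chosen arrows gives a loop, whose image
      \<open>c\<close> commutes with.\<close>
    let ?v = "P ?s \<star>[X] x \<star>[X] iv X (P ?t)"
    have va: "?v \<in> arr X \<sigma>\<^sub>0 \<sigma>\<^sub>0" using Ps Pt x by (simp add: arr_def)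
    have vP: "?v \<star>[X] P ?t = P ?s \<star>[X] x" using Ps Pt x by (simp add: X.pm_assoc)
    have imv: "fP ?v \<star>[Y] fP (P ?t) = fP (P ?s) \<star>[Y] fP x"
      using im_pm[OF mor, of ?v "P ?t"] im_pm[OF mor, of "P ?s" x] va Ps Pt x unfolding vP by (simp add: arr_def)
    have "fP (P ?s) \<star>[Y] (lc Y (fV ?s) (k ?s) \<star>[Y] fP x) = c \<star>[Y] (fP (P ?s) \<star>[Y] fP x)"
      by (simp only: Y.pm_assoc[symmetric] k(2)[OF s])
    also have "\<dots> = fP ?v \<star>[Y] (c \<star>[Y] fP (P ?t))"
      unfolding imv[symmetric] by (simp only: Y.pm_assoc[symmetric] com[OF va])
    also have "\<dots> = fP (P ?s) \<star>[Y] (fP x \<star>[Y] lc Y (fV ?t) (k ?t))"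
      unfolding k(2)[OF t] by (simp only: Y.pm_assoc[symmetric] imv)
    finally show ?thesis
      by (rule Y.pm_left_cancel[rotated -1]) (use Ps x k(1)[OF s] k(1)[OF t] in simp_all)
  qed
  note m = AutD(1)[OF id_Aut]
  have H: "mor_htpy_by X Y k \<phi> (cog_comp X Y \<phi> (cog_id X))"
    by (rule htpyI[OF devY mor comp_mor[OF m]]) (use k(1) nat in \<open>simp_all add: comp_im[OF m] id_im, simp_all add: cog_comp_def cog_id_def\<close>)
  have c0: "c = lc Y \<tau>\<^sub>0 (k \<sigma>\<^sub>0)"
    using k(2)[OF base] k(1)[OF base] ca base unfolding P'(2) by simp
  obtain v where v: "v \<in> arr X \<sigma>\<^sub>0 \<sigma>\<^sub>0" "u = fP v" using u unfolding X.pi1_carrier by blast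
  have "c \<otimes>\<^bsub>pi1 Y \<tau>\<^sub>0\<^esub> u = fP v \<star>[Y] lc Y \<tau>\<^sub>0 (k \<sigma>\<^sub>0)"
    using v ca com[OF v(1)] c0 by (simp add: Y.pi1_mult arr_def)
  then have "realises (c \<otimes>\<^bsub>pi1 Y \<tau>\<^sub>0\<^esub> u) (cog_id X) k v"
    unfolding realises_def using id_Aut H v(1) by (simp add: cog_id_def)
  then show ?thesis by blast
qed

lemma is_eps_unique: "is_eps X Y \<phi> \<sigma>\<^sub>0 h D \<Longrightarrow> is_eps X Y \<phi> \<sigma>\<^sub>0 h D' \<Longrightarrow> D = D'"
  unfolding is_eps_iff using realises_unique realisesD(2) by (metis XX.mor_class_eq_iff devX)

lemma eps_eq:
  assumes "realises h \<eta> k p"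
  shows "eps X Y \<phi> \<sigma>\<^sub>0 h = mor_class X X \<eta>"
proof -
  have e: "is_eps X Y \<phi> \<sigma>\<^sub>0 h (mor_class X X \<eta>)" using assms is_eps_iff by blast
  show ?thesis unfolding eps_def by (rule the_equality, rule e) (rule is_eps_unique[OF _ e])
qed

lemma is_eps_ex1: "normalises h \<Longrightarrow> \<exists>!D. is_eps X Y \<phi> \<sigma>\<^sub>0 h D"
  using realises_ex is_eps_unique unfolding is_eps_iff by blast

text \<open>Given a deck transformation and its homotopy, any arrow from the base vertex to its
  image defines an element that it realises; that element is normalising by
  \<open>realises_normalises\<close>.\<close>

lemma deck_carrier: "eps X Y \<phi> \<sigma>\<^sub>0 ` {h. normalises h} = carrier (Deck X Y \<phi>)"
proof (intro subset_antisym subsetI)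
  fix D assume "D \<in> eps X Y \<phi> \<sigma>\<^sub>0 ` {h. normalises h}"
  then obtain h where h: "normalises h" "D = eps X Y \<phi> \<sigma>\<^sub>0 h" by blast
  obtain \<eta> k p where r: "realises h \<eta> k p" using realises_ex[OF h(1)] by blast
  show "D \<in> carrier (Deck X Y \<phi>)"
    unfolding h(2) eps_eq[OF r] Deck_def mor_htpy_def using realisesD(1,3)[OF r] by auto
next
  fix D assume "D \<in> carrier (Deck X Y \<phi>)"
  then obtain \<eta> k where \<eta>: "D = mor_class X X \<eta>" "\<eta> \<in> cog_Aut X" "mor_htpy_by X Y k \<phi> (cog_comp X Y \<phi> \<eta>)"
    unfolding Deck_def mor_htpy_def by auto
  have "mV \<eta> \<sigma>\<^sub>0 \<in> vts X" using AutD(1)[OF \<eta>(2)] base by simp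
  then obtain p where "p \<in> arr X \<sigma>\<^sub>0 (mV \<eta> \<sigma>\<^sub>0)" using X.connecting_arrow[OF conn base] by blast
  then have r: "realises (fP p \<star>[Y] lc Y \<tau>\<^sub>0 (k \<sigma>\<^sub>0)) \<eta> k p" using \<eta> by (simp add: realises_def)
  show "D \<in> eps X Y \<phi> \<sigma>\<^sub>0 ` {h. normalises h}"
    unfolding \<eta>(1) eps_eq[OF r, symmetric] using realises_normalises[OF r] by blast
qed

text \<open>The product in \<open>Deck\<close> is a union over representatives. By
  \<open>realises_htpy\<close> every pair of representatives still realises \<open>h\<close> and
  \<open>h'\<close>, so every composite realises the product and all members of the union
  agree.\<close>

lemma eps_mult:
  assumes "normalises h" "normalises h'"
  shows "eps X Y \<phi> \<sigma>\<^sub>0 (h \<star>[Y] h') = eps X Y \<phi> \<sigma>\<^sub>0 h \<otimes>\<^bsub>Deck X Y \<phi>\<^esub> eps X Y \<phi> \<sigma>\<^sub>0 h'"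
proof -
  obtain \<eta> k p where r: "realises h \<eta> k p" using realises_ex[OF assms(1)] by blast
  obtain \<eta>' k' p' where r': "realises h' \<eta>' k' p'" using realises_ex[OF assms(2)] by blast
  have eq: "mor_class X X (cog_comp X X \<theta> \<theta>') = eps X Y \<phi> \<sigma>\<^sub>0 (h \<star>[Y] h')"
    if t: "\<theta> \<in> mor_class X X \<eta>" "\<theta>' \<in> mor_class X X \<eta>'" for \<theta> \<theta>'
  proof -
    have "mor_htpy X X \<eta> \<theta>" "mor_htpy X X \<eta>' \<theta>'" using t by (simp_all add: mor_class_def)
    then obtain l q l' q' where "realises h \<theta> l q" "realises h' \<theta>' l' q'"
      using realises_htpy[OF r] realises_htpy[OF r'] by blast
    then obtain m s where "realises (h \<star>[Y] h') (cog_comp X X \<theta> \<theta>') m s" using realises_mult by blast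
    then show ?thesis by (rule eps_eq[symmetric])
  qed
  \<comment> \<open>A union of constant sets equals that set only over nonempty index sets.\<close>
  have "mor_class X X \<eta> \<noteq> {}" "mor_class X X \<eta>' \<noteq> {}"
    using XX.mor_htpy_refl[OF devX] realisesD(2)[OF r] realisesD(2)[OF r'] unfolding mor_class_def by blast+
  then have "eps X Y \<phi> \<sigma>\<^sub>0 (h \<star>[Y] h') =
     (\<Union>\<theta>\<in>mor_class X X \<eta>. \<Union>\<theta>'\<in>mor_class X X \<eta>'. eps X Y \<phi> \<sigma>\<^sub>0 (h \<star>[Y] h'))" by simp
  also have "\<dots> = (\<Union>\<theta>\<in>mor_class X X \<eta>. \<Union>\<theta>'\<in>mor_class X X \<eta>'. mor_class X X (cog_comp X X \<theta> \<theta>'))"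
    by (intro SUP_cong) (simp_all only: eq)
  also have "\<dots> = eps X Y \<phi> \<sigma>\<^sub>0 h \<otimes>\<^bsub>Deck X Y \<phi>\<^esub> eps X Y \<phi> \<sigma>\<^sub>0 h'"
    unfolding eps_eq[OF r] eps_eq[OF r'] by (simp add: Deck_def)
  finally show ?thesis .
qed

text \<open>If the class is that of the identity, \<open>realises_htpy\<close> replaces the
  realising automorphism by the identity without changing \<open>h\<close>.\<close>

lemma eps_one_iff:
  assumes "normalises h"
  shows "eps X Y \<phi> \<sigma>\<^sub>0 h = \<one>\<^bsub>Deck X Y \<phi>\<^esub> \<longleftrightarrow> (\<exists>k p. realises h (cog_id X) k p)"
proof
  obtain \<eta> k p where r: "realises h \<eta> k p" using realises_ex[OF assms] by blast
  assume "eps X Y \<phi> \<sigma>\<^sub>0 h = \<one>\<^bsub>Deck X Y \<phi>\<^esub>"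
  then have "mor_class X X \<eta> = mor_class X X (cog_id X)" by (simp add: eps_eq[OF r] Deck_def)
  then have "mor_htpy X X \<eta> (cog_id X)" using XX.mor_class_eq_iff[OF devX AutD(1)[OF id_Aut]] by blast
  then show "\<exists>k p. realises h (cog_id X) k p" by (rule realises_htpy[OF r])
next
  assume "\<exists>k p. realises h (cog_id X) k p"
  then show "eps X Y \<phi> \<sigma>\<^sub>0 h = \<one>\<^bsub>Deck X Y \<phi>\<^esub>" using eps_eq by (auto simp: Deck_def)
qed

end

theorem theorem5p12:
  fixes X :: "('v, 'e, 'g) cog" and Y :: "('w, 'd, 'h) cog"
    and \<phi> :: "('v, 'e, 'g, 'w, 'd, 'h) cog_map" and \<sigma>\<^sub>0 :: 'v and \<tau>\<^sub>0 :: 'w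
  defines "G \<equiv> pi1 Y \<tau>\<^sub>0"
  defines "U \<equiv> induced_hom X Y \<phi> ` carrier (pi1 X \<sigma>\<^sub>0)"
  defines "N \<equiv> G\<lparr>carrier := normalizer G U\<rparr>"
  defines "K \<equiv> act_kernel Y \<tau>\<^sub>0"
  defines "C \<equiv> centralizer G U \<inter> K"
  assumes "complex_of_groups X" and "scwol_connected (shape X)" and "developable X"
    and "complex_of_groups Y" and "scwol_connected (shape Y)" and "developable Y"
    and "cog_covering X Y \<phi>"
    and "\<sigma>\<^sub>0 \<in> verts (shape X)" and "mV \<phi> \<sigma>\<^sub>0 = \<tau>\<^sub>0"
  shows "(\<forall>h\<in>carrier N. \<exists>!D. is_eps X Y \<phi> \<sigma>\<^sub>0 h D) \<and>
    group_hom N (Deck X Y \<phi>) (eps X Y \<phi> \<sigma>\<^sub>0) \<and>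
    eps X Y \<phi> \<sigma>\<^sub>0 ` carrier N = carrier (Deck X Y \<phi>) \<and>
    kernel N (Deck X Y \<phi>) (eps X Y \<phi> \<sigma>\<^sub>0) = C <#>\<^bsub>G\<^esub> U \<and>
    Deck X Y \<phi> \<cong> N Mod (C <#>\<^bsub>G\<^esub> U)"
proof -
  interpret S: deck_setting X Y \<phi> \<sigma>\<^sub>0
    using assms(6-13)
    by (intro deck_setting.intro based_covering_map.intro covering_map.intro cog_pair.intro
        covering_map_axioms.intro based_covering_map_axioms.intro deck_setting_axioms.intro)
  let ?D = "Deck X Y \<phi>" and ?e = "eps X Y \<phi> \<sigma>\<^sub>0"
  have \<tau>: "\<tau>\<^sub>0 = mV \<phi> \<sigma>\<^sub>0" using assms by simp
  interpret G: group G unfolding G_def \<tau> by (rule S.Y.pi1_group) simp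
  have U: "subgroup U G" unfolding U_def G_def \<tau> by (rule S.U_subgroup)
  have N: "carrier N = {h. S.normalises h}"
    unfolding N_def G_def U_def \<tau> by (simp add: S.normalizer_eq)
  have gN: "group N"
    unfolding N_def by (rule G.subgroup_imp_group[OF G.normalizer_imp_subgroup[OF subgroup.subset[OF U]]])
  have mN: "x \<otimes>\<^bsub>N\<^esub> y = x \<star>[Y] y" if "x \<in> carrier N" "y \<in> carrier N" for x y
    using that unfolding N by (simp add: N_def G_def S.Y.pi1_mult S.normalises_def arr_def)
  have im: "?e ` carrier N = carrier ?D" unfolding N by (rule S.deck_carrier)
  have hom: "?e \<in> hom N ?D"
  proof (rule homI)
    show "?e x \<in> carrier ?D" if "x \<in> carrier N" for x using that im by blast
    show "?e (x \<otimes>\<^bsub>N\<^esub> y) = ?e x \<otimes>\<^bsub>?D\<^esub> ?e y" if "x \<in> carrier N" "y \<in> carrier N" for x y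
      unfolding mN[OF that] by (rule S.eps_mult) (use that N in auto)
  qed
  have ker: "{x \<in> carrier N. ?e x = \<one>\<^bsub>?D\<^esub>} = C <#>\<^bsub>G\<^esub> U"
  proof (intro subset_antisym subsetI)
    fix h assume "h \<in> {x \<in> carrier N. ?e x = \<one>\<^bsub>?D\<^esub>}"
    then obtain k p where "S.realises h (cog_id X) k p" using S.eps_one_iff N by blast
    from S.realises_id_D[OF this] show "h \<in> C <#>\<^bsub>G\<^esub> U"
      unfolding C_def K_def G_def U_def \<tau> set_mult_def by blast
  next
    fix h assume "h \<in> C <#>\<^bsub>G\<^esub> U"
    then obtain c u where "c \<in> C" "u \<in> U" "h = c \<otimes>\<^bsub>G\<^esub> u" unfolding set_mult_def by blast
    then obtain k p where r: "S.realises h (cog_id X) k p"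
      using S.realises_id_I unfolding C_def K_def G_def U_def \<tau> by blast
    have n: "S.normalises h" by (rule S.realises_normalises[OF r])
    then show "h \<in> {x \<in> carrier N. ?e x = \<one>\<^bsub>?D\<^esub>}" using S.eps_one_iff[OF n] r N by blast
  qed
  interpret N: group N by (rule gN)
  \<comment> \<open>The group structure on \<open>Deck\<close> is not checked directly: it is the
    image of the group \<open>N\<close> under a multiplicative map, once the image of the identity
    is known to be the identity of \<open>Deck\<close>.\<close>
  have one: "?e \<one>\<^bsub>N\<^esub> = \<one>\<^bsub>?D\<^esub>"
    using S.eps_eq[OF S.realises_one] by (simp add: N_def G_def \<tau> S.Y.pi1_one Deck_def)
  have "group (?D\<lparr>carrier := ?e ` carrier N, one := ?e \<one>\<^bsub>N\<^esub>\<rparr>)" by (rule N.hom_imp_img_group[OF hom])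
  moreover have "?D\<lparr>carrier := ?e ` carrier N, one := ?e \<one>\<^bsub>N\<^esub>\<rparr> = ?D" unfolding im one by simp
  ultimately have gD: "group ?D" by simp
  have gh: "group_hom N ?D ?e" using gN gD hom by (intro group_hom.intro group_hom_axioms.intro)
  have k: "kernel N ?D ?e = C <#>\<^bsub>G\<^esub> U" unfolding kernel_def by (rule ker)
  have "N Mod kernel N ?D ?e \<cong> ?D" by (rule group_hom.FactGroup_iso[OF gh im])
  then have iso: "?D \<cong> N Mod (C <#>\<^bsub>G\<^esub> U)"
    unfolding k[symmetric] by (rule group.iso_sym[OF normal.factorgroup_is_group[OF group_hom.normal_kernel[OF gh]]])
  have "\<forall>h\<in>carrier N. \<exists>!D. is_eps X Y \<phi> \<sigma>\<^sub>0 h D" unfolding N using S.is_eps_ex1 by blast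
  then show ?thesis using gh im k iso by (intro conjI)
qed

end
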